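(* Let $w=(w_l)$ be admissible, $0<\alpha<1$ and $\gamma>0$. Suppose the weak Bernstein--von Mises phenomenon holds true in $\mathcal M_0(w)$ with prior $\Pi$ and efficient centring $T_n$, and that $X\sim P_{f_0}$ where $f_0\in C^\gamma([0,1])$. Let $$C_n=\Big\{f:\ \sup_{l,k}\frac{|\langle f-T_n,\psi_{lk}\rangle|}{w_l}\le\frac{R_n}{\sqrt n}\Big\},$$ where $R_n$ (depending on $\alpha$ and $X$) is such that $\Pi(C_n\mid X)=1-\alpha$. Let $j_n$ be such that $2^{j_n}\sim(n/\log n)^{1/(2\gamma+1)}$, let $u_n=w_{j_n}/\sqrt{j_n}$, and set $$\bar C_n=C_n\cap\{f:\ \|f\|_{C^\gamma}\le u_n\}.$$ Then, as $n\to\infty$, $$P_{f_0}(f_0\in\bar C_n)\to1-\alpha\quad\text{and}\quad |\bar C_n|_\infty=O_{P_{f_0}}\big((n/\log n)^{-\gamma/(2\gamma+1)}u_n\big),$$ where $|\bar C_n|_\infty=\sup\{\|f-g\|_\infty:f,g\in\bar C_n\}$.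
   Context: Fix a wavelet basis $\{\psi_{lk}: l\ge J_0-1,\ k=0,\ldots,2^l-1\}$ of $L^2([0,1])$, which is $S$-regular, $S\ge0$: either the Haar basis ($S=J_0=0$), a periodised wavelet basis ($J_0=0$, $S>0$), or a boundary corrected (Cohen--Daubechies--Vial) wavelet basis ($S>0$, $J_0=J_0(S)$ large enough); by convention the scaling function is denoted as the first wavelet $\psi_{(J_0-1)0}$. Functions $f\in L^2$ are identified with their coefficient sequences $\{\langle f,\psi_{lk}\rangle\}\in\ell_2$; more generally $\langle x,\psi_{lk}\rangle=x_{lk}$ for a sequence $x$. $C^\gamma([0,1])$ is the set of continuous $f$ on $[0,1]$ with $\|f\|_{C^\gamma}=\|f\|_{\gamma,\infty}=\sup_{l,k}2^{l(\gamma+1/2)}|\langle f,\psi_{lk}\rangle|<\infty$. The notation $a_n\sim b_n$ means that $a_n/b_n$ is bounded away from $0$ and $\infty$. For a monotone increasing sequence $w=(w_l)_{l\ge J_0-1}$ with $w_l\ge1$, let $\mathcal M(w)$ be the Banach space of double-indexed sequences $x=\{x_{lk}\}$ with $\|x\|_{\mathcal M(w)}=\sup_l w_l^{-1}\max_k|x_{lk}|<\infty$, and $\mathcal M_0(w)$ its closed separable subspace of $x$ with $\lim_{l\to\infty}w_l^{-1}\max_k|x_{lk}|=0$. The sequence $w$ is admissible if $w_l/\sqrt l\uparrow\infty$ as $l\to\infty$. Models. White noise model: $X=\mathbb X^{(n)}=f+n^{-1/2}\mathbb W$, $\mathbb W=(g_{lk})$ with $g_{lk}$ i.i.d. $N(0,1)$,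 $f\in L^2$; $P_{f_0}$ is the law of $\mathbb X^{(n)}$ under $f_0$. Sampling model: $X=(X_1,\ldots,X_n)$ i.i.d. from a bounded density $f$ on $[0,1]$; $P_{f_0}$ is the law $P_0^{\mathbb N}$ of $(X_1,X_2,\ldots)$ under $dP_0=f_0dx$. $\Pi(\cdot\mid X)$ is the posterior distribution, on $\ell_2\subset\mathcal M_0(w)$, for the prior $\Pi$. Weak Bernstein--von Mises phenomenon: let $T_n=T_n(X)$ be an estimator of $f$ in $\mathcal M_0(w)$, and $\tilde\Pi_n$ the image of $\Pi(\cdot\mid X)$ under $f\mapsto\sqrt n(f-T_n)$. $\Pi$ satisfies the weak Bernstein--von Mises phenomenon in $\mathcal M_0(w)$ with centring $T_n$ if, for $X\sim P_{f_0}$ and fixed $f_0$, $\beta_{\mathcal M_0(w)}(\tilde\Pi_n,\mathcal N)\to0$ in $P_{f_0}$-probability as $n\to\infty$, where $\mathcal N$ is the law in $\mathcal M_0(w)$ of $\mathbb W$ (white noise model) or of $\mathbb G_{P_0}$, $f_0\in L^\infty$ (sampling model). Here $\mathbb G_P$ is the centred Gaussian process indexed by $L^2(P)$ with covariance $\int(g-Pg)(h-Ph)dP$, identified with the sequence $(\mathbb G_P(\psi_{lk}))$. For probability measures on a metric space $(S,d)$, $\beta_S(\mu,\nu)=\sup_{\|F\|_{BL}\le1}|\int F\,d(\mu-\nu)|$, $\|F\|_{BL}=\sup_x|F(x)|+\sup_{x\ne y}|F(x)-F(y)|/d(x,y)$. The centring $T_n$ is efficient if $\sqrt n(T_n-f_0)\to^d\mathcal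 N$ in $\mathcal M_0(w)$ under $P_{f_0}$ (for example, $T_n=\mathbb X^{(n)}$ in the white noise model). *)

theory Defs
  imports
    "HOL-Probability.Probability"
    "HOL-Library.Landau_Symbols"
begin

section \<open>Orthonormal bases of real \<open>L\<^sup>2\<close>-spaces\<close>

definition L2 :: "'a measure \<Rightarrow> ('a \<Rightarrow> real) set" where
  "L2 M = {f. f \<in> borel_measurable M \<and> integrable M (\<lambda>x. (f x)\<^sup>2)}"

definition orthonormal_on :: "'a measure \<Rightarrow> 'i set \<Rightarrow> ('i \<Rightarrow> 'a \<Rightarrow> real) \<Rightarrow> bool" where
  "orthonormal_on M I e \<longleftrightarrow>
     (\<forall>i\<in>I. e i \<in> L2 M) \<and>
     (\<forall>i\<in>I. \<forall>j\<in>I. (\<integral>x. e i x * e j x \<partial>M) = (if i = j then 1 else 0))"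

definition orthonormal_basis :: "'a measure \<Rightarrow> 'i set \<Rightarrow> ('i \<Rightarrow> 'a \<Rightarrow> real) \<Rightarrow> bool" where
  "orthonormal_basis M I e \<longleftrightarrow>
     orthonormal_on M I e \<and>
     (\<forall>f\<in>L2 M. (\<forall>i\<in>I. (\<integral>x. f x * e i x \<partial>M) = 0) \<longrightarrow> (AE x in M. f x = 0))"

definition unit_interval :: "real measure" where
  "unit_interval = restrict_space lborel {0..1}"


section \<open>Wavelet bases\<close>

definition dilate :: "int \<Rightarrow> int \<Rightarrow> (real \<Rightarrow> real) \<Rightarrow> real \<Rightarrow> real" where
  "dilate l k g x = 2 powr (real_of_int l / 2) * g (2 powr real_of_int l * x - real_of_int k)"

text \<open>
  Indices \<open>(l, k)\<close> of a wavelet basis of the unit interval. Level \<open>J0 - 1\<close> carries the scaling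
  functions of resolution \<open>J0\<close>: a single one if \<open>J0 = 0\<close> (Haar and periodised bases), and
  \<open>2 ^ J0\<close> of them for a boundary corrected basis. Level \<open>l \<ge> J0\<close> carries \<open>2 ^ l\<close> wavelets.
\<close>

definition level_size :: "nat \<Rightarrow> int \<Rightarrow> nat" where
  "level_size J0 l = 2 ^ nat (max l (int J0))"

definition wav_index :: "nat \<Rightarrow> (int \<times> nat) set" where
  "wav_index J0 = {(l, k). int J0 - 1 \<le> l \<and> k < level_size J0 l}"

subsection \<open>Haar basis\<close>

definition haar_mother :: "real \<Rightarrow> real" where
  "haar_mother x = indicator {0..<1/2} x - indicator {1/2..<1} x"

definition haar_basis :: "(int \<Rightarrow> nat \<Rightarrow> real \<Rightarrow> real) \<Rightarrow> bool" where
  "haar_basis \<psi> \<longleftrightarrow>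
     (\<forall>x\<in>{0..1}. \<psi> (-1) 0 x = 1 \<and>
        (\<forall>l\<ge>0. \<forall>k<level_size 0 l. \<psi> l k x = dilate l (int k) haar_mother x))"

subsection \<open>Regular multiresolution wavelets on the line\<close>

text \<open>Meyer's notion: \<open>S\<close> continuous derivatives, all of rapid decay.\<close>

definition regular_fun :: "nat \<Rightarrow> (real \<Rightarrow> real) \<Rightarrow> bool" where
  "regular_fun S g \<longleftrightarrow>
     (\<exists>D :: nat \<Rightarrow> real \<Rightarrow> real.
        D 0 = g \<and>
        (\<forall>a<S. \<forall>x. (D a has_real_derivative D (Suc a) x) (at x)) \<and>
        continuous_on UNIV (D S) \<and>
        (\<forall>a\<le>S. \<forall>m::nat. \<exists>C. \<forall>x. \<bar>D a x\<bar> * (1 + \<bar>x\<bar>) ^ m \<le> C))"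

definition refined_by :: "(real \<Rightarrow> real) \<Rightarrow> (real \<Rightarrow> real) \<Rightarrow> bool" where
  "refined_by \<phi> g \<longleftrightarrow>
     (\<exists>h :: int \<Rightarrow> real. (\<lambda>k. \<bar>h k\<bar>) summable_on UNIV \<and>
        (\<forall>x. g x = (\<Sum>\<^sub>\<infinity>k. h k * \<phi> (2 * x - real_of_int k))))"

definition line_wavelets :: "nat \<Rightarrow> (real \<Rightarrow> real) \<Rightarrow> (real \<Rightarrow> real) \<Rightarrow> bool" where
  "line_wavelets S \<phi> \<psi> \<longleftrightarrow>
     regular_fun S \<phi> \<and> regular_fun S \<psi> \<and>
     refined_by \<phi> \<phi> \<and> refined_by \<phi> \<psi> \<and>
     orthonormal_basis lborel {(l :: int, k :: int). -1 \<le> l}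
       (\<lambda>(l, k). if l = -1 then dilate 0 k \<phi> else dilate l k \<psi>)"

subsection \<open>Periodised bases\<close>

definition periodise :: "(real \<Rightarrow> real) \<Rightarrow> real \<Rightarrow> real" where
  "periodise g x = (\<Sum>\<^sub>\<infinity>m::int. g (x + real_of_int m))"

definition periodised_basis :: "nat \<Rightarrow> (int \<Rightarrow> nat \<Rightarrow> real \<Rightarrow> real) \<Rightarrow> bool" where
  "periodised_basis S \<psi> \<longleftrightarrow>
     (\<exists>\<phi>R \<psi>R. line_wavelets S \<phi>R \<psi>R \<and>
        (\<forall>x\<in>{0..1}. \<psi> (-1) 0 x = periodise \<phi>R x \<and>
           (\<forall>l\<ge>0. \<forall>k<level_size 0 l. \<psi> l k x = periodise (dilate l (int k) \<psi>R) x)))"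

subsection \<open>Boundary corrected bases (Cohen, Daubechies and Vial)\<close>

text \<open>Daubechies wavelets with \<open>N\<close> vanishing moments, translated to the support \<open>[-N + 1, N]\<close>.\<close>

definition daubechies :: "nat \<Rightarrow> nat \<Rightarrow> (real \<Rightarrow> real) \<Rightarrow> (real \<Rightarrow> real) \<Rightarrow> bool" where
  "daubechies S N \<phi> \<psi> \<longleftrightarrow>
     line_wavelets S \<phi> \<psi> \<and>
     (\<forall>x. x \<notin> {1 - real N..real N} \<longrightarrow> \<phi> x = 0 \<and> \<psi> x = 0) \<and>
     (\<forall>i<N. (\<integral>x. x ^ i * \<psi> x \<partial>lborel) = 0)"

text \<open>
  The edge functions of a half line. On \<open>[0, \<infinity>)\<close> the translates \<open>\<phi>(\<cdot> - m)\<close> with \<open>m \<ge> N\<close> are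
  kept; those with \<open>m \<le> N - 1\<close> are replaced by the combinations with coefficients
  \<open>n choose k\<close>, \<open>n = N - 1 - m\<close>, \<open>k < N\<close>, so that all polynomials of degree less than \<open>N\<close> are
  still generated. On \<open>(-\<infinity>, 0]\<close> the kept translates are those with \<open>m \<le> -N - 1\<close>.
  These edge functions are then orthonormalised among themselves.
\<close>

definition left_edge :: "nat \<Rightarrow> (real \<Rightarrow> real) \<Rightarrow> nat \<Rightarrow> real \<Rightarrow> real" where
  "left_edge N \<phi> k x = (\<Sum>n=k..2*N-2. real (n choose k) * \<phi> (x + real n - real N + 1))"

definition right_edge :: "nat \<Rightarrow> (real \<Rightarrow> real) \<Rightarrow> nat \<Rightarrow> real \<Rightarrow> real" where
  "right_edge N \<phi> k x = (\<Sum>n=k..2*N-2. real (n choose k) * \<phi> (x - real n + real N))"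

definition orthonormalised_edge ::
    "nat \<Rightarrow> real set \<Rightarrow> (nat \<Rightarrow> real \<Rightarrow> real) \<Rightarrow> (nat \<Rightarrow> real \<Rightarrow> real) \<Rightarrow> bool" where
  "orthonormalised_edge N H e b \<longleftrightarrow>
     orthonormal_on (restrict_space lborel H) {..<N} b \<and>
     (\<exists>a :: nat \<Rightarrow> nat \<Rightarrow> real. \<forall>k<N. \<forall>x\<in>H. b k x = (\<Sum>m<N. a k m * e m x))"

text \<open>
  The \<open>N\<close> edge wavelets of a half line: orthonormal elements of the next finer space that are
  orthogonal to the coarse space and to the retained wavelets \<open>\<psi>(\<cdot> - m)\<close>, \<open>m \<in> K\<close>.
  The set \<open>F\<close> collects the finer translates near the edge that may enter.
\<close>

definition edge_wavelets ::
    "nat \<Rightarrow> real set \<Rightarrow> int set \<Rightarrow> int set \<Rightarrow> (real \<Rightarrow> real) \<Rightarrow> (real \<Rightarrow> real) \<Rightarrow>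
      (nat \<Rightarrow> real \<Rightarrow> real) \<Rightarrow> (nat \<Rightarrow> real \<Rightarrow> real) \<Rightarrow> bool" where
  "edge_wavelets N H K F \<phi> \<psi> b d \<longleftrightarrow>
     orthonormal_on (restrict_space lborel H) {..<N} d \<and>
     (\<exists>(p :: nat \<Rightarrow> nat \<Rightarrow> real) (q :: nat \<Rightarrow> int \<Rightarrow> real). \<forall>k<N. \<forall>x\<in>H.
        d k x = (\<Sum>m<N. p k m * b m (2 * x)) + (\<Sum>m\<in>F. q k m * \<phi> (2 * x - real_of_int m))) \<and>
     (\<forall>k<N. (\<forall>m<N. (\<integral>x. d k x * b m x \<partial>restrict_space lborel H) = 0) \<and>
        (\<forall>m\<in>K. (\<integral>x. d k x * \<phi> (x - real_of_int m) \<partial>restrict_space lborel H) = 0 \<and>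
                (\<integral>x. d k x * \<psi> (x - real_of_int m) \<partial>restrict_space lborel H) = 0))"

text \<open>The \<open>2 ^ l\<close> functions of level \<open>l\<close> on the unit interval: \<open>N\<close> left ones, interior ones, \<open>N\<close> right ones.\<close>

definition interval_fun ::
    "nat \<Rightarrow> (real \<Rightarrow> real) \<Rightarrow> (nat \<Rightarrow> real \<Rightarrow> real) \<Rightarrow> (nat \<Rightarrow> real \<Rightarrow> real) \<Rightarrow>
      nat \<Rightarrow> nat \<Rightarrow> real \<Rightarrow> real" where
  "interval_fun N g gl gr l k x =
     (if k < N then dilate (int l) 0 (gl k) x
      else if k < 2 ^ l - N then dilate (int l) (int k) g x
      else dilate (int l) 0 (gr (2 ^ l - 1 - k)) (x - 1))"

definition cdv_basis :: "nat \<Rightarrow> nat \<Rightarrow> (int \<Rightarrow> nat \<Rightarrow> real \<Rightarrow> real) \<Rightarrow> bool" where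
  "cdv_basis S J0 \<psi> \<longleftrightarrow>
     (\<exists>N \<phi>R \<psi>R \<phi>l \<phi>r \<psi>l \<psi>r.
        daubechies S N \<phi>R \<psi>R \<and> 2 * N \<le> 2 ^ J0 \<and>
        orthonormalised_edge N {0..} (left_edge N \<phi>R) \<phi>l \<and>
        orthonormalised_edge N {..0} (right_edge N \<phi>R) \<phi>r \<and>
        edge_wavelets N {0..} {int N..} {int N..3 * int N - 2} \<phi>R \<psi>R \<phi>l \<psi>l \<and>
        edge_wavelets N {..0} {..- int N - 1} {1 - 3 * int N..- int N - 1} \<phi>R \<psi>R \<phi>r \<psi>r \<and>
        (\<forall>x\<in>{0..1}.
           (\<forall>k<2 ^ J0. \<psi> (int J0 - 1) k x = interval_fun N \<phi>R \<phi>l \<phi>r J0 k x) \<and>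
           (\<forall>l\<ge>J0. \<forall>k<2 ^ l. \<psi> (int l) k x = interval_fun N \<psi>R \<psi>l \<psi>r l k x)))"

subsection \<open>Regular wavelet bases of the unit interval\<close>

definition wavelet_basis :: "nat \<Rightarrow> nat \<Rightarrow> (int \<Rightarrow> nat \<Rightarrow> real \<Rightarrow> real) \<Rightarrow> bool" where
  "wavelet_basis S J0 \<psi> \<longleftrightarrow>
     orthonormal_basis unit_interval (wav_index J0) (\<lambda>(l, k). \<psi> l k) \<and>
     (S = 0 \<and> J0 = 0 \<and> haar_basis \<psi> \<or>
      S > 0 \<and> J0 = 0 \<and> periodised_basis S \<psi> \<or>
      S > 0 \<and> cdv_basis S J0 \<psi>)"


section \<open>Coefficient sequences and sequence spaces\<close>

text \<open>Sequences are extensional functions on \<open>wav_index J0\<close>, matching the product measures below.\<close>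

type_synonym wseq = "int \<times> nat \<Rightarrow> real"

definition wav_coeffs :: "nat \<Rightarrow> (int \<Rightarrow> nat \<Rightarrow> real \<Rightarrow> real) \<Rightarrow> (real \<Rightarrow> real) \<Rightarrow> wseq" where
  "wav_coeffs J0 \<psi> f = (\<lambda>(l, k)\<in>wav_index J0. \<integral>x. f x * \<psi> l k x \<partial>unit_interval)"

definition topology_borel :: "'a topology \<Rightarrow> 'a measure" where
  "topology_borel T = sigma (topspace T) {U. openin T U}"

definition ell2 :: "nat \<Rightarrow> wseq set" where
  "ell2 J0 = {x \<in> extensional (wav_index J0). (\<lambda>i. (x i)\<^sup>2) summable_on wav_index J0}"

definition ell2_dist :: "nat \<Rightarrow> wseq \<Rightarrow> wseq \<Rightarrow> real" where
  "ell2_dist J0 x y = sqrt (\<Sum>\<^sub>\<infinity>i\<in>wav_index J0. (x i - y i)\<^sup>2)"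

definition ell2_borel :: "nat \<Rightarrow> wseq measure" where
  "ell2_borel J0 = topology_borel (Metric_space.mtopology (ell2 J0) (ell2_dist J0))"

definition level_max :: "nat \<Rightarrow> wseq \<Rightarrow> int \<Rightarrow> real" where
  "level_max J0 x l = Max ((\<lambda>k. \<bar>x (l, k)\<bar>) ` {..<level_size J0 l})"

definition M_norm :: "nat \<Rightarrow> (int \<Rightarrow> real) \<Rightarrow> wseq \<Rightarrow> ereal" where
  "M_norm J0 w x = (SUP l\<in>{int J0 - 1..}. ereal (level_max J0 x l / w l))"

definition M0 :: "nat \<Rightarrow> (int \<Rightarrow> real) \<Rightarrow> wseq set" where
  "M0 J0 w = {x \<in> extensional (wav_index J0).
     M_norm J0 w x < \<infinity> \<and> ((\<lambda>l. level_max J0 x l / w l) \<longlongrightarrow> 0) at_top}"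

definition M_dist :: "nat \<Rightarrow> (int \<Rightarrow> real) \<Rightarrow> wseq \<Rightarrow> wseq \<Rightarrow> real" where
  "M_dist J0 w x y = real_of_ereal (M_norm J0 w (\<lambda>i. x i - y i))"

definition M0_topology :: "nat \<Rightarrow> (int \<Rightarrow> real) \<Rightarrow> wseq topology" where
  "M0_topology J0 w = Metric_space.mtopology (M0 J0 w) (M_dist J0 w)"

definition M0_borel :: "nat \<Rightarrow> (int \<Rightarrow> real) \<Rightarrow> wseq measure" where
  "M0_borel J0 w = topology_borel (M0_topology J0 w)"

definition admissible :: "nat \<Rightarrow> (int \<Rightarrow> real) \<Rightarrow> bool" where
  "admissible J0 w \<longleftrightarrow>
     mono_on {int J0 - 1..} w \<and> (\<forall>l\<ge>int J0 - 1. 1 \<le> w l) \<and>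
     mono_on {max 1 (int J0 - 1)..} (\<lambda>l. w l / sqrt (real_of_int l)) \<and>
     filterlim (\<lambda>l. w l / sqrt (real_of_int l)) at_top at_top"

definition C_norm :: "nat \<Rightarrow> real \<Rightarrow> wseq \<Rightarrow> ereal" where
  "C_norm J0 \<gamma> x =
     (SUP (l, k)\<in>wav_index J0. ereal (2 powr (real_of_int l * (\<gamma> + 1/2)) * \<bar>x (l, k)\<bar>))"

definition C_space :: "nat \<Rightarrow> (int \<Rightarrow> nat \<Rightarrow> real \<Rightarrow> real) \<Rightarrow> real \<Rightarrow> (real \<Rightarrow> real) set" where
  "C_space J0 \<psi> \<gamma> = {f. continuous_on {0..1} f \<and> C_norm J0 \<gamma> (wav_coeffs J0 \<psi> f) < \<infinity>}"

definition Linf_norm :: "(real \<Rightarrow> real) \<Rightarrow> ennreal" where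
  "Linf_norm f = esssup unit_interval (\<lambda>x. ennreal \<bar>f x\<bar>)"

text \<open>Diameter of a set of coefficient sequences, measured on the functions they represent.\<close>

definition sup_diameter :: "nat \<Rightarrow> (int \<Rightarrow> nat \<Rightarrow> real \<Rightarrow> real) \<Rightarrow> wseq set \<Rightarrow> ennreal" where
  "sup_diameter J0 \<psi> A =
     (SUP (f, g)\<in>{(f, g). f \<in> L2 unit_interval \<and> g \<in> L2 unit_interval \<and>
                          wav_coeffs J0 \<psi> f \<in> A \<and> wav_coeffs J0 \<psi> g \<in> A}.
        Linf_norm (\<lambda>x. f x - g x))"


section \<open>Convergence of laws and stochastic orders\<close>

definition BL_norm :: "'a set \<Rightarrow> ('a \<Rightarrow> 'a \<Rightarrow> real) \<Rightarrow> ('a \<Rightarrow> real) \<Rightarrow> ennreal" where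
  "BL_norm S d F =
     (SUP x\<in>S. ennreal \<bar>F x\<bar>) +
     (SUP (x, y)\<in>{(x, y). x \<in> S \<and> y \<in> S \<and> x \<noteq> y}. ennreal (\<bar>F x - F y\<bar> / d x y))"

definition BL_dist ::
    "'a set \<Rightarrow> ('a \<Rightarrow> 'a \<Rightarrow> real) \<Rightarrow> 'a measure \<Rightarrow> 'a measure \<Rightarrow> ennreal" where
  "BL_dist S d \<mu> \<nu> = (SUP F\<in>{F. BL_norm S d F \<le> 1}. ennreal \<bar>(\<integral>x. F x \<partial>\<mu>) - (\<integral>x. F x \<partial>\<nu>)\<bar>)"

definition weakly_converges :: "'a topology \<Rightarrow> (nat \<Rightarrow> 'a measure) \<Rightarrow> 'a measure \<Rightarrow> bool" where
  "weakly_converges T \<mu> \<nu> \<longleftrightarrow>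
     (\<forall>F. continuous_map T euclideanreal F \<and> bounded (F ` topspace T) \<longrightarrow>
        (\<lambda>n. \<integral>x. F x \<partial>\<mu> n) \<longlonglongrightarrow> (\<integral>x. F x \<partial>\<nu>))"

text \<open>Outer probability, so that suprema over uncountable families raise no measurability question.\<close>

definition outer_prob :: "'x measure \<Rightarrow> 'x set \<Rightarrow> ennreal" where
  "outer_prob P A = (INF B\<in>{B \<in> sets P. A \<subseteq> B}. emeasure P B)"

definition to_zero_in_prob :: "(nat \<Rightarrow> 'x measure) \<Rightarrow> (nat \<Rightarrow> 'x \<Rightarrow> ennreal) \<Rightarrow> bool" where
  "to_zero_in_prob P Y \<longleftrightarrow>
     (\<forall>\<epsilon>>0. (\<lambda>n. outer_prob (P n) {x \<in> space (P n). Y n x > ennreal \<epsilon>}) \<longlonglongrightarrow> 0)"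

definition bigO_in_prob ::
    "(nat \<Rightarrow> 'x measure) \<Rightarrow> (nat \<Rightarrow> 'x \<Rightarrow> ennreal) \<Rightarrow> (nat \<Rightarrow> real) \<Rightarrow> bool" where
  "bigO_in_prob P Y r \<longleftrightarrow>
     (\<forall>\<epsilon>>0. \<exists>C>0. \<forall>\<^sub>F n in sequentially.
        outer_prob (P n) {x \<in> space (P n). Y n x > ennreal (C * r n)} \<le> ennreal \<epsilon>)"


section \<open>Statistical models\<close>

definition std_normal :: "real measure" where
  "std_normal = density lborel std_normal_density"

subsection \<open>Gaussian white noise\<close>

definition seq_algebra :: "nat \<Rightarrow> wseq measure" where
  "seq_algebra J0 = PiM (wav_index J0) (\<lambda>_. borel)"

definition white_noise :: "nat \<Rightarrow> wseq measure" where
  "white_noise J0 = PiM (wav_index J0) (\<lambda>_. std_normal)"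

definition white_noise_law :: "nat \<Rightarrow> nat \<Rightarrow> wseq \<Rightarrow> wseq measure" where
  "white_noise_law J0 n f =
     distr (white_noise J0) (seq_algebra J0) (\<lambda>g. \<lambda>i\<in>wav_index J0. f i + g i / sqrt (real n))"

definition white_noise_limit :: "nat \<Rightarrow> (int \<Rightarrow> real) \<Rightarrow> wseq measure \<Rightarrow> bool" where
  "white_noise_limit J0 w N \<longleftrightarrow>
     N \<in> space (prob_algebra (M0_borel J0 w)) \<and>
     distr N (seq_algebra J0) (\<lambda>x. x) = white_noise J0"

subsection \<open>Sampling from a density\<close>

definition bounded_density :: "(real \<Rightarrow> real) \<Rightarrow> bool" where
  "bounded_density f \<longleftrightarrow>
     f \<in> borel_measurable unit_interval \<and> (\<exists>C. \<forall>x\<in>{0..1}. 0 \<le> f x \<and> f x \<le> C) \<and>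
     (\<integral>x. f x \<partial>unit_interval) = 1"

definition density_law :: "(real \<Rightarrow> real) \<Rightarrow> real measure" where
  "density_law f = density unit_interval (\<lambda>x. ennreal (f x))"

definition sampling_law :: "(real \<Rightarrow> real) \<Rightarrow> (nat \<Rightarrow> real) measure" where
  "sampling_law f = PiM UNIV (\<lambda>_. density_law f)"

text \<open>The events that depend on the first \<open>n\<close> observations only.\<close>

definition sample_algebra :: "nat \<Rightarrow> (nat \<Rightarrow> real) measure" where
  "sample_algebra n =
     vimage_algebra (space (PiM UNIV (\<lambda>_::nat. unit_interval))) (\<lambda>x. restrict x {..<n})
       (PiM {..<n} (\<lambda>_. unit_interval))"

text \<open>The function, unique up to null sets, with a given square summable coefficient sequence.\<close>

definition synth :: "nat \<Rightarrow> (int \<Rightarrow> nat \<Rightarrow> real \<Rightarrow> real) \<Rightarrow> wseq \<Rightarrow> real \<Rightarrow> real" where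
  "synth J0 \<psi> s = (SOME f. f \<in> L2 unit_interval \<and> wav_coeffs J0 \<psi> f = s)"

text \<open>
  The law of \<open>(G(\<psi>\<^sub>l\<^sub>k))\<close>: every finite linear combination of the coordinates is centred
  normal, possibly degenerate, with the variance given by the covariance function.
\<close>

definition bridge_cov ::
    "(int \<Rightarrow> nat \<Rightarrow> real \<Rightarrow> real) \<Rightarrow> real measure \<Rightarrow> int \<times> nat \<Rightarrow> int \<times> nat \<Rightarrow> real" where
  "bridge_cov \<psi> P = (\<lambda>(l, k) (l', k').
     \<integral>x. (\<psi> l k x - (\<integral>y. \<psi> l k y \<partial>P)) * (\<psi> l' k' x - (\<integral>y. \<psi> l' k' y \<partial>P)) \<partial>P)"

definition sampling_limit ::
    "nat \<Rightarrow> (int \<Rightarrow> nat \<Rightarrow> real \<Rightarrow> real) \<Rightarrow> (int \<Rightarrow> real) \<Rightarrow> (real \<Rightarrow> real) \<Rightarrow> wseq measure \<Rightarrow> bool" where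
  "sampling_limit J0 \<psi> w f0 N \<longleftrightarrow>
     N \<in> space (prob_algebra (M0_borel J0 w)) \<and>
     (\<forall>F a. finite F \<and> F \<subseteq> wav_index J0 \<longrightarrow>
        distr N borel (\<lambda>x. \<Sum>i\<in>F. a i * x i) =
        distr std_normal borel
          (\<lambda>z. sqrt (\<Sum>i\<in>F. \<Sum>j\<in>F. a i * a j * bridge_cov \<psi> (density_law f0) i j) * z))"

subsection \<open>Posterior distributions\<close>

text \<open>
  A version of the conditional law of the parameter given the data: disintegration of the joint
  law of parameter and data. \<open>D\<close> is the \<open>\<sigma>\<close>-algebra of the data.
\<close>

definition is_posterior ::
    "nat \<Rightarrow> 'x measure \<Rightarrow> (wseq \<Rightarrow> 'x measure) \<Rightarrow> wseq measure \<Rightarrow> ('x \<Rightarrow> wseq measure) \<Rightarrow> bool" where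
  "is_posterior J0 D law prior K \<longleftrightarrow>
     K \<in> D \<rightarrow>\<^sub>M prob_algebra (ell2_borel J0) \<and>
     (\<forall>A\<in>sets (ell2_borel J0). \<forall>B\<in>sets D.
        (\<integral>\<^sup>+f\<in>A. emeasure (law f) B \<partial>prior) =
        (\<integral>\<^sup>+f. (\<integral>\<^sup>+x\<in>B. emeasure (K x) A \<partial>law f) \<partial>prior))"


section \<open>The weak Bernstein--von Mises phenomenon and credible sets\<close>

text \<open>In the following, \<open>P n\<close> is the true law of the data, \<open>K n\<close> the posterior and \<open>T n\<close> the centring.\<close>

definition rescale :: "nat \<Rightarrow> nat \<Rightarrow> wseq \<Rightarrow> wseq \<Rightarrow> wseq" where
  "rescale J0 n t f = (\<lambda>i\<in>wav_index J0. sqrt (real n) * (f i - t i))"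

definition weak_BvM ::
    "nat \<Rightarrow> (int \<Rightarrow> real) \<Rightarrow> (nat \<Rightarrow> 'x measure) \<Rightarrow> (nat \<Rightarrow> 'x \<Rightarrow> wseq measure) \<Rightarrow>
      (nat \<Rightarrow> 'x \<Rightarrow> wseq) \<Rightarrow> wseq measure \<Rightarrow> bool" where
  "weak_BvM J0 w P K T N \<longleftrightarrow>
     to_zero_in_prob P (\<lambda>n x.
       BL_dist (M0 J0 w) (M_dist J0 w)
         (distr (K n x) (M0_borel J0 w) (rescale J0 n (T n x))) N)"

definition efficient_centring ::
    "nat \<Rightarrow> (int \<Rightarrow> real) \<Rightarrow> (nat \<Rightarrow> 'x measure) \<Rightarrow> (nat \<Rightarrow> 'x \<Rightarrow> wseq) \<Rightarrow> wseq \<Rightarrow> wseq measure \<Rightarrow> bool" where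
  "efficient_centring J0 w P T \<theta> N \<longleftrightarrow>
     weakly_converges (M0_topology J0 w)
       (\<lambda>n. distr (P n) (M0_borel J0 w) (\<lambda>x. rescale J0 n \<theta> (T n x))) N"

definition credible_set :: "nat \<Rightarrow> (int \<Rightarrow> real) \<Rightarrow> nat \<Rightarrow> wseq \<Rightarrow> real \<Rightarrow> wseq set" where
  "credible_set J0 w n t r =
     {f \<in> ell2 J0. (SUP (l, k)\<in>wav_index J0. ereal (\<bar>f (l, k) - t (l, k)\<bar> / w l)) \<le> ereal (r / sqrt (real n))}"

definition credible_band ::
    "nat \<Rightarrow> (int \<Rightarrow> real) \<Rightarrow> real \<Rightarrow> nat \<Rightarrow> wseq \<Rightarrow> real \<Rightarrow> real \<Rightarrow> wseq set" where
  "credible_band J0 w \<gamma> n t r u = credible_set J0 w n t r \<inter> {f. C_norm J0 \<gamma> f \<le> ereal u}"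

end

theory Submission
  imports Defs "HOL-Real_Asymp.Real_Asymp"
begin

text \<open>
  Let \<open>H\<close> be the distribution function of the norm of the limit \<open>N\<close>. On \<open>M0\<close> the weighted supremum
  is attained, so the sphere of radius \<open>t > 0\<close> lies in a countable union of coordinate hyperplanes
  off the origin, which are null for the Gaussian law \<open>N\<close>; since \<open>N\<close> is not degenerate at zero, \<open>H\<close>
  is continuous. Integrating Lipschitz step functions of the norm against the posterior,
  the Bernstein--von Mises property forces \<open>R n\<close> to lie with probability tending to one between points
  at which \<open>H\<close> is close to \<open>1 - \<alpha>\<close>. Efficiency of the centring gives the same limit \<open>H\<close> for the
  law of the rescaled centring error, whence the coverage. The smoothness constraint
  is eventually satisfied by \<open>f0\<close> because \<open>u\<close> diverges.

  For the diameter, the localisation \<open>(\<Sum>k. \<bar>\<psi> l k x\<bar>) \<le> C * 2 powr (l / 2)\<close> bounds the supremum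
  norm of a difference of two elements by \<open>C\<close> times the sum over \<open>l\<close> of \<open>2 powr (l / 2)\<close> times its
  largest coefficient at level \<open>l\<close>. Up to level \<open>j n\<close> the coefficients are controlled by the radius,
  above it by the smoothness constraint; both geometric sums are dominated by the level \<open>j n\<close>.
\<close>

section \<open>The sequence spaces\<close>

text \<open>The bounded Lipschitz distance sees only Lipschitz test functions, so indicators of
  balls are replaced by \<open>cts_step a b\<close> of the norm; the price
  \<open>1 / (b - a)\<close> is harmless because \<open>a < b\<close> stay fixed while
  \<open>n\<close> grows. Nothing is claimed about convergence of \<open>R n\<close>: comparison
  points are selected by their values under \<open>H\<close>, which continuity provides, so
  \<open>H\<close> may be flat around the level \<open>1 - \<alpha>\<close>. The two models have
  different data spaces but share this argument, which is therefore carried out in the locale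
  \<open>credible_setting\<close>; Gaussianity of the limit enters it only through
  \<open>no_atom\<close>. Radius zero is the delicate sphere: in the sampling model a constant basis
  function gives a coordinate concentrated at 0, so a nondegenerate coordinate has to be found. In
  the diameter, \<open>w (j n) = u n * sqrt (j n)\<close> separates the slack \<open>u n\<close>
  from the noise level, the square root of \<open>j n * 2 powr j n / n\<close>. The choice of
  \<open>j n\<close> brings noise and bias \<open>2 powr (- (j n * \<gamma>))\<close> to the same
  rate, the logarithm in \<open>n / ln n\<close> compensating for \<open>j n\<close> being of order
  at most \<open>ln n\<close>.\<close>

lemma level_size_pos [simp]: "0 < level_size J0 l"
  by (simp add: level_size_def)

text \<open>Levels are bounded below by \<open>J0 - 1\<close>, so once the tail of a sequence is
  controlled only finitely many coordinates remain.\<close>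

lemma finite_wav_index_below: "finite {(l, k) \<in> wav_index J0. l < L}"
proof -
  have "{(l, k) \<in> wav_index J0. l < L} \<subseteq> (SIGMA l:{int J0 - 1..<L}. {..<level_size J0 l})"
    by (auto simp: wav_index_def)
  then show ?thesis by (rule finite_subset) auto
qed

lemma countable_wav_index: "countable (wav_index J0)"
  by (rule countableI_type)

lemma wav_index_nonempty: "(int J0 - 1, 0) \<in> wav_index J0"
  by (simp add: wav_index_def)

section \<open>Square summable sequences\<close>

lemma square_add_summable_on:
  fixes x y :: "'i \<Rightarrow> real"
  assumes "(\<lambda>i. (x i)\<^sup>2) summable_on A" "(\<lambda>i. (y i)\<^sup>2) summable_on A"
  shows "(\<lambda>i. (x i + y i)\<^sup>2) summable_on A"
proof (rule summable_on_comparison_test)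
  show "(\<lambda>i. 2 * (x i)\<^sup>2 + 2 * (y i)\<^sup>2) summable_on A"
    by (intro summable_on_add summable_on_cmult_right assms)
  show "(x i + y i)\<^sup>2 \<le> 2 * (x i)\<^sup>2 + 2 * (y i)\<^sup>2" for i
    using zero_le_power2[of "x i - y i"] by (simp add: power2_eq_square algebra_simps)
qed auto

text \<open>Minkowski's inequality, passed from \<open>L2_set\<close> on finite index sets to the
  infinite sum through its finite subsums.\<close>

lemma sqrt_infsum_square_triangle:
  fixes x y :: "'i \<Rightarrow> real"
  assumes x: "(\<lambda>i. (x i)\<^sup>2) summable_on A" and y: "(\<lambda>i. (y i)\<^sup>2) summable_on A"
  shows "sqrt (\<Sum>\<^sub>\<infinity>i\<in>A. (x i + y i)\<^sup>2) \<le> sqrt (\<Sum>\<^sub>\<infinity>i\<in>A. (x i)\<^sup>2) + sqrt (\<Sum>\<^sub>\<infinity>i\<in>A. (y i)\<^sup>2)"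
    (is "_ \<le> ?a + ?b")
proof -
  have "(\<Sum>\<^sub>\<infinity>i\<in>A. (x i + y i)\<^sup>2) \<le> (?a + ?b)\<^sup>2"
  proof (rule infsum_le_finite_sums[OF square_add_summable_on[OF x y]])
    fix F assume F: "finite F" "F \<subseteq> A"
    have "L2_set (\<lambda>i. x i + y i) F \<le> L2_set x F + L2_set y F"
      by (rule L2_set_triangle_ineq)
    also have "\<dots> \<le> ?a + ?b"
      unfolding L2_set_def
      by (intro add_mono real_sqrt_le_mono finite_sum_le_infsum x y F) auto
    finally have "sqrt (\<Sum>i\<in>F. (x i + y i)\<^sup>2) \<le> ?a + ?b"
      by (simp add: L2_set_def)
    then show "(\<Sum>i\<in>F. (x i + y i)\<^sup>2) \<le> (?a + ?b)\<^sup>2"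
      by (rule sqrt_le_D)
  qed
  then show ?thesis
    by (intro real_le_lsqrt add_nonneg_nonneg real_sqrt_ge_zero infsum_nonneg) auto
qed

lemma ell2_diff_summable:
  assumes "x \<in> ell2 J0" "y \<in> ell2 J0"
  shows "(\<lambda>i. (x i - y i)\<^sup>2) summable_on wav_index J0"
  using square_add_summable_on[of x "wav_index J0" "\<lambda>i. - y i"] assms
  by (simp add: ell2_def)

lemma Metric_space_ell2: "Metric_space (ell2 J0) (ell2_dist J0)"
proof
  fix x y z
  show "0 \<le> ell2_dist J0 x y"
    by (simp add: ell2_dist_def infsum_nonneg)
  show "ell2_dist J0 x y = ell2_dist J0 y x"
    by (simp add: ell2_dist_def power2_commute)
  assume x: "x \<in> ell2 J0" and y: "y \<in> ell2 J0"
  show "ell2_dist J0 x y = 0 \<longleftrightarrow> x = y"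
  proof
    assume "ell2_dist J0 x y = 0"
    then have "(\<Sum>\<^sub>\<infinity>i\<in>wav_index J0. (x i - y i)\<^sup>2) = 0"
      by (simp add: ell2_dist_def)
    then have "(x i - y i)\<^sup>2 = 0" if "i \<in> wav_index J0" for i
      using nonneg_infsum_le_0D[of _ _ i] ell2_diff_summable[OF x y] that by force
    then show "x = y"
      using x y by (intro extensionalityI[of _ "wav_index J0"]) (auto simp: ell2_def)
  qed (simp add: ell2_dist_def)
  assume z: "z \<in> ell2 J0"
  show "ell2_dist J0 x z \<le> ell2_dist J0 x y + ell2_dist J0 y z"
    using sqrt_infsum_square_triangle[OF ell2_diff_summable[OF x y] ell2_diff_summable[OF y z]]
    by (simp add: ell2_dist_def)
qed

lemma abs_diff_le_ell2_dist:
  assumes "x \<in> ell2 J0" "y \<in> ell2 J0" "i \<in> wav_index J0"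
  shows "\<bar>x i - y i\<bar> \<le> ell2_dist J0 x y"
proof -
  have "(\<Sum>i\<in>{i}. (x i - y i)\<^sup>2) \<le> (\<Sum>\<^sub>\<infinity>i\<in>wav_index J0. (x i - y i)\<^sup>2)"
    by (intro finite_sum_le_infsum ell2_diff_summable) (use assms in auto)
  then show ?thesis
    unfolding ell2_dist_def by (intro real_le_rsqrt) simp
qed

text \<open>Chebyshev counting: each such index contributes at least
  \<open>\<epsilon>\<^sup>2\<close> to the sum, which bounds the cardinality of all finite subsets
  uniformly.\<close>

lemma finite_square_summable_on_ge:
  fixes x :: "'i \<Rightarrow> real"
  assumes x: "(\<lambda>i. (x i)\<^sup>2) summable_on A" and "0 < \<epsilon>"
  shows "finite {i \<in> A. \<epsilon> \<le> \<bar>x i\<bar>}"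
proof -
  let ?s = "\<Sum>\<^sub>\<infinity>i\<in>A. (x i)\<^sup>2"
  have "card F \<le> nat \<lceil>?s / \<epsilon>\<^sup>2\<rceil>" if F: "F \<subseteq> {i \<in> A. \<epsilon> \<le> \<bar>x i\<bar>}" "finite F" for F
  proof -
    have "real (card F) * \<epsilon>\<^sup>2 = (\<Sum>i\<in>F. \<epsilon>\<^sup>2)" by simp
    also have "\<dots> \<le> (\<Sum>i\<in>F. (x i)\<^sup>2)"
      using F \<open>0 < \<epsilon>\<close> by (intro sum_mono) (auto simp: abs_le_square_iff[symmetric])
    also have "\<dots> \<le> ?s"
      using F by (intro finite_sum_le_infsum x) auto
    finally have "real (card F) \<le> ?s / \<epsilon>\<^sup>2"
      using \<open>0 < \<epsilon>\<close> by (simp add: field_simps)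
    then show ?thesis by linarith
  qed
  then show ?thesis
    using finite_if_finite_subsets_card_bdd by blast
qed

section \<open>The weighted supremum norm\<close>

text \<open>\<open>real_of_ereal\<close> sends infinity to 0, so this value is meaningful only where
  \<open>M_norm\<close> is finite; this is why the estimates below assume
  \<open>M_vanishing\<close>.\<close>

definition M_nrm :: "nat \<Rightarrow> (int \<Rightarrow> real) \<Rightarrow> wseq \<Rightarrow> real" where
  "M_nrm J0 w x = real_of_ereal (M_norm J0 w x)"

text \<open>Weights of at least 1 let plain coordinate bounds pass to weighted ones; this embeds
  \<open>ell2 J0\<close> in \<open>M0 J0 w\<close> and makes the embedding a contraction.\<close>

locale weight =
  fixes J0 :: nat and w :: "int \<Rightarrow> real"
  assumes weight_ge_1: "int J0 - 1 \<le> l \<Longrightarrow> 1 \<le> w l"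
begin

lemma weight_pos: "(l, k) \<in> wav_index J0 \<Longrightarrow> 0 < w l"
  using weight_ge_1[of l] by (simp add: wav_index_def)

lemma level_max_div_le_iff:
  assumes "int J0 - 1 \<le> l"
  shows "level_max J0 x l / w l \<le> r \<longleftrightarrow> (\<forall>k. (l, k) \<in> wav_index J0 \<longrightarrow> \<bar>x (l, k)\<bar> \<le> r * w l)"
proof -
  have "level_max J0 x l / w l \<le> r \<longleftrightarrow> level_max J0 x l \<le> r * w l"
    using weight_ge_1[OF assms] by (simp add: divide_le_eq)
  also have "\<dots> \<longleftrightarrow> (\<forall>k<level_size J0 l. \<bar>x (l, k)\<bar> \<le> r * w l)"
    unfolding level_max_def by (subst Max_le_iff) (auto simp: lessThan_empty_iff)
  finally show ?thesis
    using assms by (auto simp: wav_index_def)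
qed

lemma level_max_div_nonneg:
  assumes "int J0 - 1 \<le> l" shows "0 \<le> level_max J0 x l / w l"
proof -
  have "\<bar>x (l, 0)\<bar> \<le> level_max J0 x l"
    unfolding level_max_def by (intro Max_ge) auto
  then show ?thesis using weight_ge_1[OF assms] by simp
qed

lemma M_norm_le_iff:
  "M_norm J0 w x \<le> ereal r \<longleftrightarrow> (\<forall>l k. (l, k) \<in> wav_index J0 \<longrightarrow> \<bar>x (l, k)\<bar> \<le> r * w l)"
proof -
  have "M_norm J0 w x \<le> ereal r \<longleftrightarrow> (\<forall>l\<ge>int J0 - 1. level_max J0 x l / w l \<le> r)"
    unfolding M_norm_def by (auto simp: SUP_le_iff)
  also have "\<dots> \<longleftrightarrow> (\<forall>l k. (l, k) \<in> wav_index J0 \<longrightarrow> \<bar>x (l, k)\<bar> \<le> r * w l)"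
    using level_max_div_le_iff by (auto simp: wav_index_def)
  finally show ?thesis .
qed

lemma M_norm_nonneg: "0 \<le> M_norm J0 w x"
proof -
  have "0 \<le> ereal (level_max J0 x (int J0 - 1) / w (int J0 - 1))"
    using level_max_div_nonneg by simp
  also have "\<dots> \<le> M_norm J0 w x"
    unfolding M_norm_def by (intro SUP_upper) auto
  finally show ?thesis .
qed

lemma M_norm_cong: "(\<And>i. i \<in> wav_index J0 \<Longrightarrow> \<bar>x i\<bar> = \<bar>y i\<bar>) \<Longrightarrow> M_norm J0 w x = M_norm J0 w y"
  unfolding M_norm_def level_max_def
  by (intro SUP_cong arg_cong[where f = ereal] arg_cong2[where f = "(/)"] arg_cong[where f = Max] image_cong)
    (auto simp: wav_index_def)

lemma M_nrm_cong: "(\<And>i. i \<in> wav_index J0 \<Longrightarrow> \<bar>x i\<bar> = \<bar>y i\<bar>) \<Longrightarrow> M_nrm J0 w x = M_nrm J0 w y"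
  unfolding M_nrm_def using M_norm_cong by metis

lemma M_nrm_nonneg: "0 \<le> M_nrm J0 w x"
  unfolding M_nrm_def using M_norm_nonneg real_of_ereal_pos by blast

text \<open>Membership in \<open>M0\<close> stripped of extensionality, which pointwise differences
  need not preserve, with the limit spelled out as coordinate inequalities.\<close>

definition M_vanishing :: "wseq \<Rightarrow> bool" where
  "M_vanishing x \<longleftrightarrow> (\<forall>\<epsilon>>0. \<exists>L. \<forall>l k. (l, k) \<in> wav_index J0 \<and> L \<le> l \<longrightarrow> \<bar>x (l, k)\<bar> \<le> \<epsilon> * w l)"

lemma M_vanishing_finite:
  assumes "M_vanishing x" shows "M_norm J0 w x < \<infinity>"
proof -
  obtain L where L: "\<And>l k. (l, k) \<in> wav_index J0 \<Longrightarrow> L \<le> l \<Longrightarrow> \<bar>x (l, k)\<bar> \<le> 1 * w l"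
    using assms unfolding M_vanishing_def by (metis zero_less_one)
  let ?I = "{(l, k) \<in> wav_index J0. l < L}"
  have fin: "finite ?I" by (rule finite_wav_index_below)
  \<comment> \<open>The summand 1 serves the tail, where the vanishing condition was used with
    tolerance 1; the finite sum dominates each of the remaining coordinates.\<close>
  define B where "B = 1 + (\<Sum>i\<in>?I. \<bar>x i\<bar>)"
  have "1 \<le> B" unfolding B_def by (simp add: sum_nonneg)
  have "\<bar>x (l, k)\<bar> \<le> B * w l" if "(l, k) \<in> wav_index J0" for l k
  proof (cases "L \<le> l")
    case True
    then have "\<bar>x (l, k)\<bar> \<le> 1 * w l" using L that by blast
    also have "\<dots> \<le> B * w l"
      using \<open>1 \<le> B\<close> weight_pos[OF that] by (intro mult_right_mono) auto
    finally show ?thesis .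
  next
    case False
    then have "\<bar>x (l, k)\<bar> \<le> (\<Sum>i\<in>?I. \<bar>x i\<bar>)"
      using that fin by (intro member_le_sum[where i = "(l, k)" and f = "\<lambda>i. \<bar>x i\<bar>"]) auto
    also have "\<dots> \<le> B * 1" unfolding B_def by simp
    also have "\<dots> \<le> B * w l"
      using \<open>1 \<le> B\<close> weight_ge_1[of l] that by (intro mult_left_mono) (auto simp: wav_index_def)
    finally show ?thesis .
  qed
  then have "M_norm J0 w x \<le> ereal B" by (simp add: M_norm_le_iff)
  then show ?thesis by (rule order_le_less_trans) simp
qed

lemma M0_iff: "x \<in> M0 J0 w \<longleftrightarrow> x \<in> extensional (wav_index J0) \<and> M_vanishing x"
proof -
  have "((\<lambda>l. level_max J0 x l / w l) \<longlongrightarrow> 0) at_top \<longleftrightarrow> M_vanishing x"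
  proof
    assume lim: "((\<lambda>l. level_max J0 x l / w l) \<longlongrightarrow> 0) at_top"
    show "M_vanishing x" unfolding M_vanishing_def
    proof (intro allI impI)
      fix \<epsilon> :: real assume "0 < \<epsilon>"
      then have "\<forall>\<^sub>F l in at_top. level_max J0 x l / w l < \<epsilon>"
        using lim by (rule order_tendstoD(2)[rotated])
      then obtain L where L: "\<And>l. L \<le> l \<Longrightarrow> level_max J0 x l / w l < \<epsilon>"
        unfolding eventually_at_top_linorder by blast
      then show "\<exists>L. \<forall>l k. (l, k) \<in> wav_index J0 \<and> L \<le> l \<longrightarrow> \<bar>x (l, k)\<bar> \<le> \<epsilon> * w l"
      proof (intro exI[of _ L] allI impI)
        fix l k assume "(l, k) \<in> wav_index J0 \<and> L \<le> l"
        then show "\<bar>x (l, k)\<bar> \<le> \<epsilon> * w l"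
          using level_max_div_le_iff[of l x \<epsilon>] L[of l] by (simp add: wav_index_def)
      qed
    qed
  next
    assume van: "M_vanishing x"
    show "((\<lambda>l. level_max J0 x l / w l) \<longlongrightarrow> 0) at_top"
    proof (rule tendstoI)
      fix e :: real assume "0 < e"
      then obtain L where L: "\<And>l k. (l, k) \<in> wav_index J0 \<Longrightarrow> L \<le> l \<Longrightarrow> \<bar>x (l, k)\<bar> \<le> e / 2 * w l"
        using van unfolding M_vanishing_def by (metis half_gt_zero)
      have "dist (level_max J0 x l / w l) 0 < e" if l: "max L (int J0 - 1) \<le> l" for l
      proof -
        have "level_max J0 x l / w l \<le> e / 2"
          using l L by (subst level_max_div_le_iff) auto
        then show ?thesis
          unfolding dist_real_def diff_0_right
          using l level_max_div_nonneg[of l x] \<open>0 < e\<close> by linarith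
      qed
      then show "\<forall>\<^sub>F l in at_top. dist (level_max J0 x l / w l) 0 < e"
        unfolding eventually_at_top_linorder by blast
    qed
  qed
  then show ?thesis
    using M_vanishing_finite unfolding M0_def by auto
qed

lemma M_vanishing_cong: "(\<And>i. i \<in> wav_index J0 \<Longrightarrow> \<bar>x i\<bar> = \<bar>y i\<bar>) \<Longrightarrow> M_vanishing x = M_vanishing y"
  unfolding M_vanishing_def by auto

lemma M_vanishing_scale_diff:
  assumes "M_vanishing x" "M_vanishing y"
  shows "M_vanishing (\<lambda>i. c * (x i - y i))"
  unfolding M_vanishing_def
proof (intro allI impI)
  fix \<epsilon> :: real assume "0 < \<epsilon>"
  \<comment> \<open>Each sequence gets half of the tolerance; \<open>\<bar>c\<bar> + 1\<close>
    instead of \<open>\<bar>c\<bar>\<close> avoids dividing by zero.\<close>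
  define d where "d = \<epsilon> / (2 * (\<bar>c\<bar> + 1))"
  have "0 < d" using \<open>0 < \<epsilon>\<close> by (simp add: d_def)
  then obtain L L' where L: "\<And>l k. (l, k) \<in> wav_index J0 \<Longrightarrow> L \<le> l \<Longrightarrow> \<bar>x (l, k)\<bar> \<le> d * w l"
    and L': "\<And>l k. (l, k) \<in> wav_index J0 \<Longrightarrow> L' \<le> l \<Longrightarrow> \<bar>y (l, k)\<bar> \<le> d * w l"
    using assms unfolding M_vanishing_def by metis
  have "\<bar>c * (x (l, k) - y (l, k))\<bar> \<le> \<epsilon> * w l" if I: "(l, k) \<in> wav_index J0" "max L L' \<le> l" for l k
  proof -
    have "\<bar>c * (x (l, k) - y (l, k))\<bar> \<le> (\<bar>c\<bar> + 1) * (d * w l + d * w l)"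
      unfolding abs_mult using I L[of l k] L'[of l k] by (intro mult_mono) auto
    also have "\<dots> = (d * (2 * (\<bar>c\<bar> + 1))) * w l" by (simp add: algebra_simps)
    also have "d * (2 * (\<bar>c\<bar> + 1)) = \<epsilon>" by (simp add: d_def)
    finally show ?thesis .
  qed
  then show "\<exists>L. \<forall>l k. (l, k) \<in> wav_index J0 \<and> L \<le> l \<longrightarrow> \<bar>c * (x (l, k) - y (l, k))\<bar> \<le> \<epsilon> * w l"
    by blast
qed

text \<open>Only finitely many coordinates reach \<open>\<epsilon>\<close>, so beyond some level all
  lie below \<open>\<epsilon>\<close>, hence below \<open>\<epsilon> * w l\<close>.\<close>

lemma ell2_subset_M0: "ell2 J0 \<subseteq> M0 J0 w"
proof
  fix x assume x: "x \<in> ell2 J0"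
  have "M_vanishing x" unfolding M_vanishing_def
  proof (intro allI impI)
    fix \<epsilon> :: real assume "0 < \<epsilon>"
    let ?F = "{i \<in> wav_index J0. \<epsilon> \<le> \<bar>x i\<bar>}"
    have "finite ?F"
      using x \<open>0 < \<epsilon>\<close> by (intro finite_square_summable_on_ge) (auto simp: ell2_def)
    then obtain L where L: "\<And>i. i \<in> ?F \<Longrightarrow> fst i \<le> L"
      using bdd_above_finite[of "fst ` ?F"] unfolding bdd_above_def by fastforce
    have "\<bar>x (l, k)\<bar> \<le> \<epsilon> * w l" if "(l, k) \<in> wav_index J0" "L + 1 \<le> l" for l k
    proof -
      have "\<bar>x (l, k)\<bar> < \<epsilon>" using L[of "(l, k)"] that by force
      moreover have "\<epsilon> * 1 \<le> \<epsilon> * w l"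
        using weight_ge_1[of l] that \<open>0 < \<epsilon>\<close> by (intro mult_left_mono) (auto simp: wav_index_def)
      ultimately show ?thesis by simp
    qed
    then show "\<exists>L. \<forall>l k. (l, k) \<in> wav_index J0 \<and> L \<le> l \<longrightarrow> \<bar>x (l, k)\<bar> \<le> \<epsilon> * w l"
      by blast
  qed
  then show "x \<in> M0 J0 w" using x by (simp add: M0_iff ell2_def)
qed

lemma M_nrm_le_iff:
  assumes "M_vanishing x"
  shows "M_nrm J0 w x \<le> r \<longleftrightarrow> (\<forall>l k. (l, k) \<in> wav_index J0 \<longrightarrow> \<bar>x (l, k)\<bar> \<le> r * w l)"
proof -
  have "M_norm J0 w x = ereal (M_nrm J0 w x)"
    unfolding M_nrm_def using M_vanishing_finite[OF assms] M_norm_nonneg[of x]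
    by (cases "M_norm J0 w x") auto
  then show ?thesis by (simp add: M_norm_le_iff[symmetric])
qed

lemma abs_le_M_nrm:
  "M_vanishing x \<Longrightarrow> (l, k) \<in> wav_index J0 \<Longrightarrow> \<bar>x (l, k)\<bar> \<le> M_nrm J0 w x * w l"
  using M_nrm_le_iff by blast

text \<open>Stated with a scalar so that \<open>c = 1\<close> gives the triangle inequality of the
  metric and \<open>c = sqrt n\<close> the Lipschitz constant of \<open>rescale\<close>.\<close>

lemma M_nrm_scale_diff_le:
  assumes "M_vanishing x" "M_vanishing y"
  shows "M_nrm J0 w (\<lambda>i. c * (x i - y i)) \<le> \<bar>c\<bar> * (M_nrm J0 w x + M_nrm J0 w y)"
proof -
  have "\<bar>c * (x (l, k) - y (l, k))\<bar> \<le> \<bar>c\<bar> * (M_nrm J0 w x + M_nrm J0 w y) * w l"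
    if I: "(l, k) \<in> wav_index J0" for l k
  proof -
    have "\<bar>x (l, k) - y (l, k)\<bar> \<le> (M_nrm J0 w x + M_nrm J0 w y) * w l"
      using abs_le_M_nrm[OF assms(1) I] abs_le_M_nrm[OF assms(2) I] by (simp add: distrib_right)
    then show ?thesis
      by (simp add: abs_mult mult.assoc mult_left_mono)
  qed
  then show ?thesis
    by (simp add: M_nrm_le_iff M_vanishing_scale_diff assms)
qed

lemma M_vanishing_diff: "M_vanishing x \<Longrightarrow> M_vanishing y \<Longrightarrow> M_vanishing (\<lambda>i. x i - y i)"
  using M_vanishing_scale_diff[of x y 1] by simp

lemma M_nrm_diff_le:
  "M_vanishing x \<Longrightarrow> M_vanishing y \<Longrightarrow> M_nrm J0 w (\<lambda>i. x i - y i) \<le> M_nrm J0 w x + M_nrm J0 w y"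
  using M_nrm_scale_diff_le[of x y 1] by simp

lemma M_nrm_commute: "M_nrm J0 w (\<lambda>i. x i - y i) = M_nrm J0 w (\<lambda>i. y i - x i)"
  by (rule M_nrm_cong) auto

lemma Metric_space_M0: "Metric_space (M0 J0 w) (M_dist J0 w)"
proof -
  have *: "M_dist J0 w x y = M_nrm J0 w (\<lambda>i. x i - y i)" for x y
    by (simp add: M_dist_def M_nrm_def)
  show ?thesis
  proof
    fix x y z
    show "0 \<le> M_dist J0 w x y" unfolding * by (rule M_nrm_nonneg)
    show "M_dist J0 w x y = M_dist J0 w y x" unfolding * by (rule M_nrm_commute)
    assume x: "x \<in> M0 J0 w" and y: "y \<in> M0 J0 w"
    then have xy: "M_vanishing (\<lambda>i. x i - y i)"
      by (simp add: M0_iff M_vanishing_diff)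
    show "M_dist J0 w x y = 0 \<longleftrightarrow> x = y"
    proof
      assume "M_dist J0 w x y = 0"
      then have "x i = y i" if "i \<in> wav_index J0" for i
        using abs_le_M_nrm[OF xy, of "fst i" "snd i"] that by (simp add: *)
      then show "x = y"
        using x y by (intro extensionalityI[of _ "wav_index J0"]) (auto simp: M0_iff)
    next
      assume "x = y"
      then have "M_dist J0 w x y \<le> 0"
        unfolding * using xy by (simp add: M_nrm_le_iff)
      then show "M_dist J0 w x y = 0"
        unfolding * using M_nrm_nonneg[of "\<lambda>i. x i - y i"] by linarith
    qed
    assume z: "z \<in> M0 J0 w"
    have "M_nrm J0 w (\<lambda>i. x i - z i) = M_nrm J0 w (\<lambda>i. (x i - y i) - (z i - y i))"
      by simp
    also have "\<dots> \<le> M_nrm J0 w (\<lambda>i. x i - y i) + M_nrm J0 w (\<lambda>i. z i - y i)"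
      using x y z by (intro M_nrm_diff_le M_vanishing_diff) (auto simp: M0_iff)
    finally show "M_dist J0 w x z \<le> M_dist J0 w x y + M_dist J0 w y z"
      unfolding * M_nrm_commute[of z y] .
  qed
qed

lemma M_nrm_lipschitz:
  assumes "x \<in> M0 J0 w" "y \<in> M0 J0 w"
  shows "\<bar>M_nrm J0 w x - M_nrm J0 w y\<bar> \<le> M_dist J0 w x y"
proof -
  have *: "M_nrm J0 w x \<le> M_nrm J0 w (\<lambda>i. x i - y i) + M_nrm J0 w y" if "M_vanishing x" "M_vanishing y" for x y
  proof -
    have "M_vanishing (\<lambda>i. - y i)"
      using that(2) by (subst M_vanishing_cong[of _ y]) auto
    moreover have "M_nrm J0 w (\<lambda>i. - y i) = M_nrm J0 w y" by (rule M_nrm_cong) auto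
    ultimately show ?thesis
      using M_nrm_diff_le[OF M_vanishing_diff[OF that], of "\<lambda>i. - y i"] by simp
  qed
  show ?thesis
    using *[of x y] *[of y x] assms M_nrm_commute[of x y]
    by (simp add: M0_iff M_dist_def M_nrm_def abs_le_iff)
qed

lemma rescale_eq: "i \<in> wav_index J0 \<Longrightarrow> rescale J0 n t f i = sqrt (real n) * (f i - t i)"
  by (simp add: rescale_def)

lemma M_vanishing_rescale:
  assumes "M_vanishing t" "M_vanishing f" shows "M_vanishing (rescale J0 n t f)"
  using M_vanishing_scale_diff[OF assms(2,1), of "sqrt (real n)"]
  by (subst M_vanishing_cong) (auto simp: rescale_eq)

lemma rescale_in_M0:
  assumes "t \<in> M0 J0 w" "f \<in> M0 J0 w" shows "rescale J0 n t f \<in> M0 J0 w"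
  using assms M_vanishing_rescale by (simp add: M0_iff) (simp add: rescale_def)

lemma rescale_lipschitz:
  assumes "x \<in> M0 J0 w" "y \<in> M0 J0 w"
  shows "M_dist J0 w (rescale J0 n t x) (rescale J0 n t y) \<le> sqrt (real n) * M_dist J0 w x y"
proof -
  have xy: "M_vanishing (\<lambda>i. x i - y i)"
    using assms by (simp add: M0_iff M_vanishing_diff)
  \<comment> \<open>Subtracting the zero sequence makes the scaled difference estimate serve as
    homogeneity of the norm.\<close>
  have z: "M_vanishing (\<lambda>_. 0)"
    unfolding M_vanishing_def using weight_pos by (auto intro!: exI[of _ 0] less_imp_le)
  then have z': "M_nrm J0 w (\<lambda>_. 0) = 0"
    using M_nrm_le_iff[of "\<lambda>_. 0" 0] M_nrm_nonneg[of "\<lambda>_. 0"] by simp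
  have "M_nrm J0 w (\<lambda>i. rescale J0 n t x i - rescale J0 n t y i)
    = M_nrm J0 w (\<lambda>i. sqrt (real n) * ((x i - y i) - 0))"
    by (rule M_nrm_cong) (simp add: rescale_eq algebra_simps)
  also have "\<dots> \<le> sqrt (real n) * M_nrm J0 w (\<lambda>i. x i - y i)"
    using M_nrm_scale_diff_le[OF xy z, of "sqrt (real n)"] z' by simp
  finally show ?thesis by (simp add: M_dist_def M_nrm_def)
qed

lemma M_dist_le_ell2_dist:
  assumes "x \<in> ell2 J0" "y \<in> ell2 J0"
  shows "M_dist J0 w x y \<le> ell2_dist J0 x y"
proof -
  have xy: "M_vanishing (\<lambda>i. x i - y i)"
    using assms ell2_subset_M0 M_vanishing_diff unfolding M0_iff[symmetric]
    by (meson M0_iff subsetD)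
  have "\<bar>x (l, k) - y (l, k)\<bar> \<le> ell2_dist J0 x y * w l" if "(l, k) \<in> wav_index J0" for l k
  proof -
    have "\<bar>x (l, k) - y (l, k)\<bar> \<le> ell2_dist J0 x y * 1"
      using abs_diff_le_ell2_dist[OF assms that] by simp
    also have "\<dots> \<le> ell2_dist J0 x y * w l"
      using weight_ge_1[of l] that Metric_space.nonneg[OF Metric_space_ell2]
      by (intro mult_left_mono) (auto simp: wav_index_def)
    finally show ?thesis .
  qed
  then show ?thesis
    using M_nrm_le_iff[OF xy] by (simp add: M_dist_def M_nrm_def)
qed

text \<open>Multiplication by \<open>sqrt n\<close>, positive for \<open>n \<ge> 1\<close>, turns
  the credible set into a ball around 0 for the rescaled parameter. Its posterior mass thereby
  becomes a value of a distribution function.\<close>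

lemma mem_credible_set_iff:
  assumes "t \<in> M0 J0 w" "f \<in> ell2 J0" "1 \<le> n"
  shows "f \<in> credible_set J0 w n t r \<longleftrightarrow> M_nrm J0 w (rescale J0 n t f) \<le> r"
proof -
  have v: "M_vanishing (rescale J0 n t f)"
    using assms ell2_subset_M0 by (intro M_vanishing_rescale) (auto simp: M0_iff)
  have "\<bar>f (l, k) - t (l, k)\<bar> / w l \<le> r / sqrt (real n) \<longleftrightarrow> \<bar>rescale J0 n t f (l, k)\<bar> \<le> r * w l"
    if "(l, k) \<in> wav_index J0" for l k
    using weight_pos[OF that] \<open>1 \<le> n\<close>
    unfolding rescale_eq[OF that] abs_mult by (simp add: field_simps)
  then show ?thesis
    unfolding M_nrm_le_iff[OF v] credible_set_def using assms(2)
    by (auto simp: SUP_le_iff split: prod.splits)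
qed

end

section \<open>Borel sets of metric topologies and measurability of Lipschitz maps\<close>

lemma sets_topology_borel: "sets (topology_borel T) = sigma_sets (topspace T) {U. openin T U}"
  unfolding topology_borel_def by (intro sets_measure_of) (auto dest: openin_subset)

lemma space_topology_borel: "space (topology_borel T) = topspace T"
  unfolding topology_borel_def by (intro space_measure_of) (auto dest: openin_subset)

lemma continuous_map_measurable_topology_borel:
  assumes "continuous_map X Y f"
  shows "f \<in> topology_borel X \<rightarrow>\<^sub>M topology_borel Y"
  unfolding topology_borel_def[of Y]
proof (rule measurable_measure_of)
  show "f \<in> space (topology_borel X) \<rightarrow> topspace Y"
    using continuous_map_image_subset_topspace[OF assms] by (auto simp: space_topology_borel)
  fix U assume "U \<in> {U. openin Y U}"
  then have "openin X {x \<in> topspace X. f x \<in> U}"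
    using assms by (simp add: continuous_map_def)
  moreover have "f -` U \<inter> space (topology_borel X) = {x \<in> topspace X. f x \<in> U}"
    by (auto simp: space_topology_borel)
  ultimately show "f -` U \<inter> space (topology_borel X) \<in> sets (topology_borel X)"
    by (simp add: sets_topology_borel sigma_sets.Basic)
qed (auto dest: openin_subset)

lemma topology_borel_euclidean: "topology_borel euclideanreal = borel"
  by (simp add: topology_borel_def borel_def)

lemma lipschitz_continuous_map:
  assumes A: "Metric_space A d" and B: "Metric_space B e"
    and f: "\<And>x. x \<in> A \<Longrightarrow> f x \<in> B"
    and L: "\<And>x y. x \<in> A \<Longrightarrow> y \<in> A \<Longrightarrow> e (f x) (f y) \<le> L * d x y"
  shows "continuous_map (Metric_space.mtopology A d) (Metric_space.mtopology B e) f"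
proof -
  interpret A: Metric_space A d by fact
  interpret B: Metric_space B e by fact
  show ?thesis
    unfolding A.metric_continuous_map[OF B]
  proof (intro conjI ballI allI impI)
    show "f ` A \<subseteq> B" using f by blast
    fix a and \<epsilon> :: real assume a: "a \<in> A" and "0 < \<epsilon>"
    \<comment> \<open>The radius uses \<open>\<bar>L\<bar> + 1\<close>, so that no sign condition on
      \<open>L\<close> is required.\<close>
    show "\<exists>\<delta>>0. \<forall>x. x \<in> A \<and> d a x < \<delta> \<longrightarrow> e (f a) (f x) < \<epsilon>"
    proof (intro exI[of _ "\<epsilon> / (\<bar>L\<bar> + 1)"] conjI allI impI)
      show "0 < \<epsilon> / (\<bar>L\<bar> + 1)" using \<open>0 < \<epsilon>\<close> by simp
      fix x assume x: "x \<in> A \<and> d a x < \<epsilon> / (\<bar>L\<bar> + 1)"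
      have "e (f a) (f x) \<le> (\<bar>L\<bar> + 1) * d a x"
        using L[OF a, of x] x A.nonneg[of a x]
        by (smt (verit) mult_right_mono)
      also have "\<dots> < \<epsilon>" using x by (simp add: pos_less_divide_eq mult.commute)
      finally show "e (f a) (f x) < \<epsilon>" .
    qed
  qed
qed

lemma lipschitz_continuous_map_real:
  fixes f :: "'a \<Rightarrow> real"
  assumes "Metric_space A d" "\<And>x y. x \<in> A \<Longrightarrow> y \<in> A \<Longrightarrow> \<bar>f x - f y\<bar> \<le> L * d x y"
  shows "continuous_map (Metric_space.mtopology A d) euclideanreal f"
  using lipschitz_continuous_map[OF assms(1) Met_TC.Metric_space_axioms, of f L] assms(2)
  by (simp add: dist_real_def)

context weight
begin

lemma space_M0_borel: "space (M0_borel J0 w) = M0 J0 w"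
  by (simp add: M0_borel_def M0_topology_def space_topology_borel
      Metric_space.topspace_mtopology[OF Metric_space_M0])

lemma space_ell2_borel: "space (ell2_borel J0) = ell2 J0"
  by (simp add: ell2_borel_def space_topology_borel
      Metric_space.topspace_mtopology[OF Metric_space_ell2])

text \<open>The posterior is a measure on the Borel sets of the \<open>ell2\<close> metric, its
  image one on those of \<open>M0\<close>; the map is Lipschitz between the two because
  \<open>ell2_dist\<close> dominates \<open>M_dist\<close>.\<close>

lemma rescale_measurable_ell2:
  assumes "t \<in> M0 J0 w"
  shows "rescale J0 n t \<in> ell2_borel J0 \<rightarrow>\<^sub>M M0_borel J0 w"
  unfolding M0_borel_def ell2_borel_def M0_topology_def
proof (intro continuous_map_measurable_topology_borel
    lipschitz_continuous_map[OF Metric_space_ell2 Metric_space_M0])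
  fix x y assume x: "x \<in> ell2 J0" then show "rescale J0 n t x \<in> M0 J0 w"
    using ell2_subset_M0 by (intro rescale_in_M0 assms) auto
  assume y: "y \<in> ell2 J0"
  have "M_dist J0 w (rescale J0 n t x) (rescale J0 n t y) \<le> sqrt (real n) * M_dist J0 w x y"
    using x y ell2_subset_M0 by (intro rescale_lipschitz) auto
  also have "\<dots> \<le> sqrt (real n) * ell2_dist J0 x y"
    by (intro mult_left_mono M_dist_le_ell2_dist x y) auto
  finally show "M_dist J0 w (rescale J0 n t x) (rescale J0 n t y) \<le> sqrt (real n) * ell2_dist J0 x y" .
qed

lemma rescale_measurable_M0:
  assumes "t \<in> M0 J0 w"
  shows "rescale J0 n t \<in> M0_borel J0 w \<rightarrow>\<^sub>M M0_borel J0 w"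
  unfolding M0_borel_def M0_topology_def
  by (intro continuous_map_measurable_topology_borel rescale_in_M0 assms
    lipschitz_continuous_map[OF Metric_space_M0 Metric_space_M0, where L = "sqrt (real n)"] rescale_lipschitz)

lemma lipschitz_M0_continuous:
  "(\<And>x y. x \<in> M0 J0 w \<Longrightarrow> y \<in> M0 J0 w \<Longrightarrow> \<bar>f x - f y\<bar> \<le> L * M_dist J0 w x y) \<Longrightarrow>
    continuous_map (M0_topology J0 w) euclideanreal f"
  unfolding M0_topology_def by (rule lipschitz_continuous_map_real[OF Metric_space_M0])

lemma continuous_M0_measurable:
  "continuous_map (M0_topology J0 w) euclideanreal f \<Longrightarrow> f \<in> borel_measurable (M0_borel J0 w)"
  unfolding M0_borel_def topology_borel_euclidean[symmetric]
  by (rule continuous_map_measurable_topology_borel)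

lemma M_nrm_measurable [measurable]: "M_nrm J0 w \<in> borel_measurable (M0_borel J0 w)"
  using M_nrm_lipschitz by (intro continuous_M0_measurable lipschitz_M0_continuous[where L = 1]) auto

lemma coordinate_measurable:
  assumes "i \<in> wav_index J0"
  shows "(\<lambda>x. x i) \<in> borel_measurable (M0_borel J0 w)"
proof (intro continuous_M0_measurable lipschitz_M0_continuous[where L = "w (fst i)"])
  fix x y assume "x \<in> M0 J0 w" "y \<in> M0 J0 w"
  then have "M_vanishing (\<lambda>i. x i - y i)"
    by (simp add: M0_iff M_vanishing_diff)
  from abs_le_M_nrm[OF this, of "fst i" "snd i"] show "\<bar>x i - y i\<bar> \<le> w (fst i) * M_dist J0 w x y"
    using assms by (simp add: M_dist_def M_nrm_def mult.commute)
qed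

lemma M0_borel_subset_seq_algebra: "(\<lambda>x. x) \<in> M0_borel J0 w \<rightarrow>\<^sub>M seq_algebra J0"
  unfolding seq_algebra_def
proof (rule measurable_PiM_single')
  show "(\<lambda>x. x) \<in> space (M0_borel J0 w) \<rightarrow> (\<Pi>\<^sub>E i\<in>wav_index J0. space borel)"
    by (auto simp: space_M0_borel M0_iff PiE_def)
qed (rule coordinate_measurable)

end

section \<open>Coverage of the credible sets\<close>

text \<open>If \<open>A n\<close> almost surely forces \<open>Y n\<close> above
  \<open>\<epsilon>\<close>, then every measurable cover of that exceedance set has at least the
  mass of \<open>A n\<close>. Outer probabilities thus bound ordinary ones, whether or not
  \<open>Y n\<close> is measurable.\<close>

lemma to_zero_in_probD:
  assumes zero: "to_zero_in_prob P Y" and "0 < \<epsilon>"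
    and prob: "\<And>n. prob_space (P n)"
    and A: "\<And>n. n \<ge> 1 \<Longrightarrow> A n \<in> sets (P n)"
    and AE: "\<And>n. n \<ge> 1 \<Longrightarrow> AE x in P n. x \<in> A n \<longrightarrow> ennreal \<epsilon> < Y n x"
  shows "(\<lambda>n. measure (P n) (A n)) \<longlonglongrightarrow> 0"
proof -
  let ?O = "\<lambda>n. outer_prob (P n) {x \<in> space (P n). ennreal \<epsilon> < Y n x}"
  have le: "emeasure (P n) (A n) \<le> ?O n" if n: "n \<ge> 1" for n
    unfolding outer_prob_def
  proof (rule INF_greatest)
    fix B assume B: "B \<in> {B \<in> sets (P n). {x \<in> space (P n). ennreal \<epsilon> < Y n x} \<subseteq> B}"
    show "emeasure (P n) (A n) \<le> emeasure (P n) B"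
    proof (rule emeasure_mono_AE)
      show "AE x in P n. x \<in> A n \<longrightarrow> x \<in> B"
        using AE[OF n] AE_space by eventually_elim (use B in auto)
    qed (use B in auto)
  qed
  have "?O \<longlonglongrightarrow> 0"
    using zero \<open>0 < \<epsilon>\<close> by (simp add: to_zero_in_prob_def)
  then have "(\<lambda>n. emeasure (P n) (A n)) \<longlonglongrightarrow> 0"
    by (rule tendsto_sandwich[OF _ _ tendsto_const, rotated 2])
      (auto intro!: eventually_sequentiallyI[of 1] le)
  then have "(\<lambda>n. ennreal (measure (P n) (A n))) \<longlonglongrightarrow> ennreal 0"
    by (simp add: finite_measure.emeasure_eq_measure[OF prob_space.finite_measure[OF prob]])
  then show ?thesis
    by (subst (asm) tendsto_ennreal_iff) auto
qed

text \<open>The step is the affine function \<open>(b - x) / (b - a)\<close> clamped to the unit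
  interval, and clamping does not increase distances.\<close>

lemma cts_step_lipschitz:
  assumes "a < b" shows "\<bar>cts_step a b x - cts_step a b y\<bar> \<le> \<bar>x - y\<bar> / (b - a)"
proof -
  have *: "cts_step a b x = max 0 (min 1 ((b - x) / (b - a)))" for x
    using assms by (auto simp: cts_step_def divide_simps)
  have "\<bar>cts_step a b x - cts_step a b y\<bar> \<le> \<bar>(b - x) / (b - a) - (b - y) / (b - a)\<bar>"
    unfolding * by linarith
  also have "\<dots> = \<bar>x - y\<bar> / (b - a)"
    using assms by (simp add: diff_divide_distrib[symmetric] abs_minus_commute)
  finally show ?thesis .
qed

lemma abs_cts_step_le: "a < b \<Longrightarrow> \<bar>cts_step a b x\<bar> \<le> 1"
  by (auto simp: cts_step_def divide_simps)

text \<open>Without atoms the distribution function is continuous, and its limits 0 and 1 let the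
  intermediate value theorem reach every level strictly between them.\<close>

lemma (in real_distribution) cdf_attains:
  assumes atomless: "\<And>t. measure M {t} = 0" and p: "0 < p" "p < 1"
  obtains t where "cdf M t = p"
proof -
  have "\<forall>\<^sub>F t in at_bot. cdf M t < p"
    using order_tendstoD(2)[OF cdf_lim_at_bot] p by blast
  then obtain s where s: "cdf M s < p"
    unfolding eventually_at_bot_linorder by blast
  have "\<forall>\<^sub>F t in at_top. p < cdf M t"
    using order_tendstoD(1)[OF cdf_lim_at_top_prob] p by blast
  then obtain t where t: "p < cdf M t"
    unfolding eventually_at_top_linorder by blast
  have "s \<le> t"
    using s t cdf_nondecreasing[of t s] by linarith
  have "\<forall>x. s \<le> x \<and> x \<le> t \<longrightarrow> isCont (cdf M) x"
    using atomless by (simp add: isCont_cdf)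
  with s t \<open>s \<le> t\<close> obtain x where "cdf M x = p"
    using IVT[of "cdf M" s p t] by auto
  then show thesis by (rule that)
qed

context weight
begin

text \<open>Moving the norm to the real line makes \<open>cdf\<close> and its sandwich by
  \<open>cts_step\<close> integrals available.\<close>

definition nrm_law :: "wseq measure \<Rightarrow> real measure" where
  "nrm_law Q = distr Q borel (M_nrm J0 w)"

lemma M_nrm_measurable_cong: "sets Q = sets (M0_borel J0 w) \<Longrightarrow> M_nrm J0 w \<in> borel_measurable Q"
  using measurable_cong_sets[of Q "M0_borel J0 w" borel borel] M_nrm_measurable by simp

lemma real_distribution_nrm_law:
  assumes "prob_space Q" "sets Q = sets (M0_borel J0 w)"
  shows "real_distribution (nrm_law Q)"
proof -
  interpret prob_space Q by fact
  show ?thesis unfolding nrm_law_def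
    by (rule real_distribution_distr) (rule M_nrm_measurable_cong[OF assms(2)])
qed

lemma cdf_nrm_law:
  assumes "sets Q = sets (M0_borel J0 w)"
  shows "cdf (nrm_law Q) t = measure Q {x \<in> M0 J0 w. M_nrm J0 w x \<le> t}"
proof -
  have "space Q = M0 J0 w"
    using sets_eq_imp_space_eq[OF assms] by (simp add: space_M0_borel)
  then have "M_nrm J0 w -` {..t} \<inter> space Q = {x \<in> M0 J0 w. M_nrm J0 w x \<le> t}"
    by auto
  then show ?thesis
    by (simp add: cdf_def nrm_law_def measure_distr[OF M_nrm_measurable_cong[OF assms]])
qed

lemma integral_nrm_law:
  assumes "sets Q = sets (M0_borel J0 w)" "a < b"
  shows "(\<integral>x. cts_step a b x \<partial>nrm_law Q) = (\<integral>x. cts_step a b (M_nrm J0 w x) \<partial>Q)"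
  unfolding nrm_law_def
  by (rule integral_distr[OF M_nrm_measurable_cong[OF assms(1)]])
    (intro borel_measurable_continuous_onI uniformly_continuous_imp_continuous
      cts_step_uniformly_continuous assms)

lemma continuous_cts_step_nrm:
  assumes "a < b"
  shows "continuous_map (M0_topology J0 w) euclideanreal (\<lambda>x. cts_step a b (M_nrm J0 w x))"
proof (rule lipschitz_M0_continuous)
  fix x y assume "x \<in> M0 J0 w" "y \<in> M0 J0 w"
  then have "\<bar>M_nrm J0 w x - M_nrm J0 w y\<bar> / (b - a) \<le> M_dist J0 w x y / (b - a)"
    using assms by (intro divide_right_mono M_nrm_lipschitz) auto
  then show "\<bar>cts_step a b (M_nrm J0 w x) - cts_step a b (M_nrm J0 w y)\<bar> \<le> 1 / (b - a) * M_dist J0 w x y"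
    using cts_step_lipschitz[OF assms, of "M_nrm J0 w x" "M_nrm J0 w y"] by simp
qed

text \<open>Composed with the norm, the step has supremum at most 1 and Lipschitz constant at most
  \<open>1 / (b - a)\<close>. Dividing by the sum \<open>c\<close> of the two yields an admissible
  test function, and undoing the division gives the factor.\<close>

lemma integral_cts_step_BL_dist:
  assumes ab: "a < b" and e: "0 \<le> e"
    and BL: "BL_dist (M0 J0 w) (M_dist J0 w) Q N \<le> ennreal e"
  shows "\<bar>(\<integral>x. cts_step a b (M_nrm J0 w x) \<partial>Q) - (\<integral>x. cts_step a b (M_nrm J0 w x) \<partial>N)\<bar>
    \<le> e * (1 + 1 / (b - a))"
proof -
  interpret Metric_space "M0 J0 w" "M_dist J0 w" by (rule Metric_space_M0)
  define F where "F x = cts_step a b (M_nrm J0 w x)" for x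
  define c where "c = 1 + 1 / (b - a)"
  have "0 < c" using ab unfolding c_def by (intro add_pos_pos) auto
  have "BL_norm (M0 J0 w) (M_dist J0 w) (\<lambda>x. F x / c) \<le> ennreal (1 / c) + ennreal (1 / (b - a) / c)"
    unfolding BL_norm_def
  proof (intro add_mono SUP_least)
    fix x
    have "\<bar>F x / c\<bar> \<le> 1 / c"
      using \<open>0 < c\<close> abs_cts_step_le[OF ab] by (simp add: F_def divide_right_mono)
    then show "ennreal \<bar>F x / c\<bar> \<le> ennreal (1 / c)"
      by (rule ennreal_leI)
  next
    fix p assume "p \<in> {(x, y). x \<in> M0 J0 w \<and> y \<in> M0 J0 w \<and> x \<noteq> y}"
    then obtain x y where p: "p = (x, y)" and xy: "x \<in> M0 J0 w" "y \<in> M0 J0 w" "x \<noteq> y"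
      by blast
    have "\<bar>F x - F y\<bar> \<le> \<bar>M_nrm J0 w x - M_nrm J0 w y\<bar> / (b - a)"
      unfolding F_def by (rule cts_step_lipschitz[OF ab])
    also have "\<dots> \<le> M_dist J0 w x y / (b - a)"
      using ab by (intro divide_right_mono M_nrm_lipschitz xy) auto
    finally have "\<bar>F x - F y\<bar> / M_dist J0 w x y \<le> 1 / (b - a)"
      using mdist_pos_less[OF xy(3,1,2)] by (simp add: divide_le_eq mult.commute)
    then have "\<bar>F x - F y\<bar> / M_dist J0 w x y / c \<le> 1 / (b - a) / c"
      using \<open>0 < c\<close> by (intro divide_right_mono) auto
    moreover have "\<bar>F x / c - F y / c\<bar> / M_dist J0 w x y = \<bar>F x - F y\<bar> / M_dist J0 w x y / c"
      using \<open>0 < c\<close> by (simp add: diff_divide_distrib[symmetric] mult.commute)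
    ultimately show "(case p of (x, y) \<Rightarrow> ennreal (\<bar>F x / c - F y / c\<bar> / M_dist J0 w x y))
        \<le> ennreal (1 / (b - a) / c)"
      unfolding p by (simp add: ennreal_leI)
  qed
  also have "\<dots> = ennreal (1 / c + 1 / (b - a) / c)"
    using \<open>0 < c\<close> ab by (intro ennreal_plus[symmetric]) auto
  also have "1 / c + 1 / (b - a) / c = c / c"
    by (subst (3) c_def) (simp add: add_divide_distrib)
  also have "c / c = 1" using \<open>0 < c\<close> by simp
  finally have "BL_norm (M0 J0 w) (M_dist J0 w) (\<lambda>x. F x / c) \<le> 1" by simp
  then have "ennreal \<bar>(\<integral>x. F x / c \<partial>Q) - (\<integral>x. F x / c \<partial>N)\<bar> \<le> BL_dist (M0 J0 w) (M_dist J0 w) Q N"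
    unfolding BL_dist_def by (intro SUP_upper2[of "\<lambda>x. F x / c"]) auto
  also note BL
  finally have "\<bar>(\<integral>x. F x / c \<partial>Q) - (\<integral>x. F x / c \<partial>N)\<bar> \<le> e"
    using e by simp
  then have "\<bar>((\<integral>x. F x \<partial>Q) - (\<integral>x. F x \<partial>N)) / c\<bar> \<le> e"
    by (simp add: diff_divide_distrib)
  then show ?thesis
    using \<open>0 < c\<close> by (simp add: F_def c_def[symmetric] divide_le_eq)
qed

end

section \<open>The radius of the credible set\<close>

text \<open>The common interface of the two statistical models: an arbitrary data space with true
  laws \<open>P n\<close>, on which the coverage and diameter arguments are run once.\<close>

locale credible_setting = weight +
  fixes P :: "nat \<Rightarrow> 'x measure" and K :: "nat \<Rightarrow> 'x \<Rightarrow> wseq measure" and T :: "nat \<Rightarrow> 'x \<Rightarrow> wseq"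
    and R :: "nat \<Rightarrow> 'x \<Rightarrow> real" and N :: "wseq measure" and \<theta> :: wseq and \<alpha> :: real
  assumes prob_P: "\<And>n. prob_space (P n)"
    and T_measurable: "\<And>n. n \<ge> 1 \<Longrightarrow> T n \<in> P n \<rightarrow>\<^sub>M M0_borel J0 w"
    and R_measurable: "\<And>n. n \<ge> 1 \<Longrightarrow> R n \<in> borel_measurable (P n)"
    and K_prob: "\<And>n x. n \<ge> 1 \<Longrightarrow> x \<in> space (P n) \<Longrightarrow> K n x \<in> space (prob_algebra (ell2_borel J0))"
    and BvM: "weak_BvM J0 w P K T N"
    and efficient: "efficient_centring J0 w P T \<theta> N"
    and level: "\<And>n. n \<ge> 1 \<Longrightarrow> AE x in P n. measure (K n x) (credible_set J0 w n (T n x) (R n x)) = 1 - \<alpha>"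
    and N: "N \<in> space (prob_algebra (M0_borel J0 w))"
    and no_atom: "\<And>t. 0 \<le> t \<Longrightarrow> measure N {x \<in> M0 J0 w. M_nrm J0 w x = t} = 0"
    and theta: "\<theta> \<in> ell2 J0"
    and alpha: "0 < \<alpha>" "\<alpha> < 1"
begin

lemma prob_N: "prob_space N" and sets_N: "sets N = sets (M0_borel J0 w)"
  using N by (auto simp: space_prob_algebra)

definition posterior_law :: "nat \<Rightarrow> 'x \<Rightarrow> wseq measure" where
  "posterior_law n x = distr (K n x) (M0_borel J0 w) (rescale J0 n (T n x))"

abbreviation cdf_N :: "real \<Rightarrow> real" where
  "cdf_N \<equiv> cdf (nrm_law N)"

sublocale N: real_distribution "nrm_law N"
  by (rule real_distribution_nrm_law[OF prob_N sets_N])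

lemma cdf_N_attains:
  assumes "0 < p" "p < 1" obtains t where "cdf_N t = p"
proof -
  have "measure (nrm_law N) {t} = 0" for t
  proof -
    have "M_nrm J0 w -` {t} \<inter> space N = {x \<in> M0 J0 w. M_nrm J0 w x = t}"
      using sets_eq_imp_space_eq[OF sets_N] by (auto simp: space_M0_borel)
    then have "measure (nrm_law N) {t} = measure N {x \<in> M0 J0 w. M_nrm J0 w x = t}"
      unfolding nrm_law_def by (subst measure_distr[OF M_nrm_measurable_cong[OF sets_N]]) auto
    also have "\<dots> = 0"
    proof (cases "0 \<le> t")
      case False
      then have "{x \<in> M0 J0 w. M_nrm J0 w x = t} = {}"
        using M_nrm_nonneg by auto
      then show ?thesis by (simp only: measure_empty)
    qed (rule no_atom)
    finally show ?thesis .
  qed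
  then show thesis using N.cdf_attains assms that by blast
qed

text \<open>Monotonicity read backwards: points chosen by increasing values of the distribution
  function are strictly ordered, as the step functions between them require.\<close>

lemma cdf_N_less_imp: "cdf_N s < cdf_N t \<Longrightarrow> s < t"
  using N.cdf_nondecreasing[of t s] by linarith

lemma T_in_M0: "n \<ge> 1 \<Longrightarrow> x \<in> space (P n) \<Longrightarrow> T n x \<in> M0 J0 w"
  using measurable_space[OF T_measurable] by (simp add: space_M0_borel)

text \<open>The third claim is the purpose: it makes \<open>R n x\<close> a
  \<open>1 - \<alpha>\<close> quantile of the norm under the rescaled posterior.\<close>

lemma posterior_law:
  assumes n: "n \<ge> 1" and x: "x \<in> space (P n)"
  shows "prob_space (posterior_law n x)" "sets (posterior_law n x) = sets (M0_borel J0 w)"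
    and "cdf (nrm_law (posterior_law n x)) r = measure (K n x) (credible_set J0 w n (T n x) r)"
proof -
  have K: "prob_space (K n x)" "sets (K n x) = sets (ell2_borel J0)"
    using K_prob[OF n x] by (auto simp: space_prob_algebra)
  have [measurable]: "rescale J0 n (T n x) \<in> K n x \<rightarrow>\<^sub>M M0_borel J0 w"
    using rescale_measurable_ell2[OF T_in_M0[OF n x]] measurable_cong_sets[OF K(2) refl] by blast
  show sets: "sets (posterior_law n x) = sets (M0_borel J0 w)"
    by (simp add: posterior_law_def)
  show "prob_space (posterior_law n x)"
    unfolding posterior_law_def by (rule prob_space.prob_space_distr[OF K(1)]) measurable
  have "{y \<in> M0 J0 w. M_nrm J0 w y \<le> r} \<in> sets (M0_borel J0 w)"
    unfolding space_M0_borel[symmetric] by measurable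
  then have "cdf (nrm_law (posterior_law n x)) r =
      measure (K n x) (rescale J0 n (T n x) -` {y \<in> M0 J0 w. M_nrm J0 w y \<le> r} \<inter> space (K n x))"
    unfolding cdf_nrm_law[OF sets] unfolding posterior_law_def by (subst measure_distr) auto
  also have "rescale J0 n (T n x) -` {y \<in> M0 J0 w. M_nrm J0 w y \<le> r} \<inter> space (K n x)
      = credible_set J0 w n (T n x) r"
  proof -
    have "space (K n x) = ell2 J0"
      using sets_eq_imp_space_eq[OF K(2)] by (simp add: space_ell2_borel)
    moreover have "credible_set J0 w n (T n x) r \<subseteq> ell2 J0"
      by (auto simp: credible_set_def)
    ultimately show ?thesis
      using mem_credible_set_iff[OF T_in_M0[OF n x] _ n, of _ r] ell2_subset_M0
        rescale_in_M0[OF T_in_M0[OF n x]] by blast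
  qed
  finally show "cdf (nrm_law (posterior_law n x)) r = measure (K n x) (credible_set J0 w n (T n x) r)" .
qed

text \<open>For either law the integral of \<open>cts_step a b\<close> lies between the values of
  its distribution function at \<open>a\<close> and at \<open>b\<close>; closeness in the bounded
  Lipschitz distance links the two integrals.\<close>

lemma posterior_law_BL:
  assumes "n \<ge> 1" "x \<in> space (P n)" "a < b" "0 \<le> e"
    and "BL_dist (M0 J0 w) (M_dist J0 w) (posterior_law n x) N \<le> ennreal e"
  shows "cdf (nrm_law (posterior_law n x)) a \<le> cdf_N b + e * (1 + 1 / (b - a))"
    and "cdf_N a - e * (1 + 1 / (b - a)) \<le> cdf (nrm_law (posterior_law n x)) b"
proof -
  interpret Q: real_distribution "nrm_law (posterior_law n x)"
    using posterior_law assms by (intro real_distribution_nrm_law)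
  note Q.cdf_cts_step[OF \<open>a < b\<close>] N.cdf_cts_step[OF \<open>a < b\<close>]
    integral_cts_step_BL_dist[OF assms(3-5)]
    integral_nrm_law[OF posterior_law(2)[OF assms(1,2)] \<open>a < b\<close>]
    integral_nrm_law[OF sets_N \<open>a < b\<close>]
  then show "cdf (nrm_law (posterior_law n x)) a \<le> cdf_N b + e * (1 + 1 / (b - a))"
    and "cdf_N a - e * (1 + 1 / (b - a)) \<le> cdf (nrm_law (posterior_law n x)) b"
    by linarith+
qed

lemma to_zero_posterior_law:
  "to_zero_in_prob P (\<lambda>n x. BL_dist (M0 J0 w) (M_dist J0 w) (posterior_law n x) N)"
  using BvM by (simp add: weak_BvM_def posterior_law_def)

lemma radius_level:
  "n \<ge> 1 \<Longrightarrow> AE x in P n. cdf (nrm_law (posterior_law n x)) (R n x) = 1 - \<alpha>"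
  by (rule AE_mp[OF level]) (auto intro!: AE_I2 simp: posterior_law)

lemma cdf_posterior_mono:
  assumes "n \<ge> 1" "x \<in> space (P n)" "r \<le> s"
  shows "cdf (nrm_law (posterior_law n x)) r \<le> cdf (nrm_law (posterior_law n x)) s"
proof -
  interpret Q: real_distribution "nrm_law (posterior_law n x)"
    using posterior_law assms by (intro real_distribution_nrm_law)
  show ?thesis by (rule Q.cdf_nondecreasing) fact
qed

text \<open>If \<open>R n x \<le> a\<close>, the posterior distribution function at \<open>a\<close>
  is at least \<open>1 - \<alpha>\<close>, whereas closeness to \<open>N\<close> would cap it at
  \<open>cdf_N b + e * c\<close>, which is smaller. So the event forces the distance above
  \<open>e\<close>.\<close>

lemma radius_not_small:
  assumes "a < b" "cdf_N b < 1 - \<alpha>"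
  shows "(\<lambda>n. measure (P n) {x \<in> space (P n). R n x \<le> a}) \<longlonglongrightarrow> 0"
proof -
  define c where "c = 1 + 1 / (b - a)"
  have "0 < c" using assms unfolding c_def by (intro add_pos_pos) auto
  \<comment> \<open>Half of the available gap, divided by the factor \<open>c\<close> of the test
    function, so that the error \<open>e * c\<close> leaves a strict inequality.\<close>
  define e where "e = (1 - \<alpha> - cdf_N b) / (2 * c)"
  have "0 < e" using assms \<open>0 < c\<close> by (simp add: e_def)
  have ec: "e * c < 1 - \<alpha> - cdf_N b" using assms \<open>0 < c\<close> by (simp add: e_def)
  show ?thesis
  proof (rule to_zero_in_probD[OF to_zero_posterior_law \<open>0 < e\<close> prob_P])
    fix n :: nat assume n: "n \<ge> 1"
    note [measurable] = R_measurable[OF n]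
    show "{x \<in> space (P n). R n x \<le> a} \<in> sets (P n)" by measurable
    show "AE x in P n. x \<in> {x \<in> space (P n). R n x \<le> a} \<longrightarrow>
        ennreal e < BL_dist (M0 J0 w) (M_dist J0 w) (posterior_law n x) N"
      using radius_level[OF n] AE_space
    proof eventually_elim
      fix x assume x: "cdf (nrm_law (posterior_law n x)) (R n x) = 1 - \<alpha>" "x \<in> space (P n)"
      show "x \<in> {x \<in> space (P n). R n x \<le> a} \<longrightarrow>
        ennreal e < BL_dist (M0 J0 w) (M_dist J0 w) (posterior_law n x) N"
        using cdf_posterior_mono[OF n x(2), of "R n x" a] x(1) ec \<open>0 < e\<close>
          posterior_law_BL(1)[OF n x(2) \<open>a < b\<close>, of e]
        unfolding c_def by (smt (verit) linorder_not_less mem_Collect_eq)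
    qed
  qed
qed

text \<open>Mirror image: if \<open>b \<le> R n x\<close>, the posterior distribution function at
  \<open>b\<close> is at most \<open>1 - \<alpha>\<close>, whereas closeness to \<open>N\<close>
  would keep it at least at \<open>cdf_N a - e * c\<close>, which is larger.\<close>

lemma radius_not_large:
  assumes "a < b" "1 - \<alpha> < cdf_N a"
  shows "(\<lambda>n. measure (P n) {x \<in> space (P n). b \<le> R n x}) \<longlonglongrightarrow> 0"
proof -
  define c where "c = 1 + 1 / (b - a)"
  have "0 < c" using assms unfolding c_def by (intro add_pos_pos) auto
  define e where "e = (cdf_N a - (1 - \<alpha>)) / (2 * c)"
  have "0 < e" using assms \<open>0 < c\<close> by (simp add: e_def)
  have ec: "e * c < cdf_N a - (1 - \<alpha>)" using assms \<open>0 < c\<close> by (simp add: e_def)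
  show ?thesis
  proof (rule to_zero_in_probD[OF to_zero_posterior_law \<open>0 < e\<close> prob_P])
    fix n :: nat assume n: "n \<ge> 1"
    note [measurable] = R_measurable[OF n]
    show "{x \<in> space (P n). b \<le> R n x} \<in> sets (P n)" by measurable
    show "AE x in P n. x \<in> {x \<in> space (P n). b \<le> R n x} \<longrightarrow>
        ennreal e < BL_dist (M0 J0 w) (M_dist J0 w) (posterior_law n x) N"
      using radius_level[OF n] AE_space
    proof eventually_elim
      fix x assume x: "cdf (nrm_law (posterior_law n x)) (R n x) = 1 - \<alpha>" "x \<in> space (P n)"
      show "x \<in> {x \<in> space (P n). b \<le> R n x} \<longrightarrow>
        ennreal e < BL_dist (M0 J0 w) (M_dist J0 w) (posterior_law n x) N"
        using cdf_posterior_mono[OF n x(2), of b "R n x"] x(1) ec \<open>0 < e\<close>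
          posterior_law_BL(2)[OF n x(2) \<open>a < b\<close>, of e]
        unfolding c_def by (smt (verit) linorder_not_less mem_Collect_eq)
    qed
  qed
qed

lemma radius_bounded_in_prob:
  obtains M where "(\<lambda>n. measure (P n) {x \<in> space (P n). M \<le> R n x}) \<longlonglongrightarrow> 0"
proof -
  obtain s where s: "cdf_N s = 1 - \<alpha> / 2" using cdf_N_attains[of "1 - \<alpha> / 2"] alpha by auto
  \<comment> \<open>The level \<open>1 - \<alpha> / 2\<close> is any level strictly between
    \<open>1 - \<alpha>\<close> and 1, and the step from \<open>s\<close> to \<open>s + 1\<close>
    any positive gap.\<close>
  then show thesis
    using radius_not_large[of s "s + 1"] alpha that by simp
qed

section \<open>Coverage probability\<close>

definition centring_law :: "nat \<Rightarrow> wseq measure" where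
  "centring_law n = distr (P n) (M0_borel J0 w) (\<lambda>x. rescale J0 n \<theta> (T n x))"

definition centring_error :: "nat \<Rightarrow> 'x \<Rightarrow> real" where
  "centring_error n x = M_nrm J0 w (rescale J0 n \<theta> (T n x))"

lemma rescaled_centring_measurable:
  "n \<ge> 1 \<Longrightarrow> (\<lambda>x. rescale J0 n \<theta> (T n x)) \<in> P n \<rightarrow>\<^sub>M M0_borel J0 w"
  using measurable_compose[OF T_measurable rescale_measurable_M0] theta ell2_subset_M0 by blast

lemma centring_error_measurable: "n \<ge> 1 \<Longrightarrow> centring_error n \<in> borel_measurable (P n)"
  unfolding centring_error_def
  using measurable_compose[OF rescaled_centring_measurable M_nrm_measurable] .

lemma cdf_centring:
  assumes "n \<ge> 1"
  shows "real_distribution (nrm_law (centring_law n))"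
    and "cdf (nrm_law (centring_law n)) t = measure (P n) {x \<in> space (P n). centring_error n x \<le> t}"
proof -
  interpret prob_space "P n" by (rule prob_P)
  note [measurable] = rescaled_centring_measurable[OF assms]
  show "real_distribution (nrm_law (centring_law n))"
    unfolding centring_law_def
    by (intro real_distribution_nrm_law prob_space_distr rescaled_centring_measurable assms) simp
  have "{y \<in> M0 J0 w. M_nrm J0 w y \<le> t} \<in> sets (M0_borel J0 w)"
    unfolding space_M0_borel[symmetric] by measurable
  moreover have "(\<lambda>x. rescale J0 n \<theta> (T n x)) -` {y \<in> M0 J0 w. M_nrm J0 w y \<le> t} \<inter> space (P n)
      = {x \<in> space (P n). centring_error n x \<le> t}"
    using measurable_space[OF rescaled_centring_measurable[OF assms]]
    by (auto simp: centring_error_def space_M0_borel)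
  ultimately show "cdf (nrm_law (centring_law n)) t =
      measure (P n) {x \<in> space (P n). centring_error n x \<le> t}"
    by (subst cdf_nrm_law) (simp_all add: centring_law_def measure_distr)
qed

lemma centring_cts_step_tendsto:
  assumes "a < b"
  shows "(\<lambda>n. \<integral>x. cts_step a b x \<partial>nrm_law (centring_law n)) \<longlonglongrightarrow> (\<integral>x. cts_step a b x \<partial>nrm_law N)"
proof -
  have "bounded ((\<lambda>x. cts_step a b (M_nrm J0 w x)) ` topspace (M0_topology J0 w))"
    using abs_cts_step_le[OF assms] by (auto simp: bounded_iff)
  then show ?thesis
    using efficient continuous_cts_step_nrm[OF assms]
    unfolding efficient_centring_def weakly_converges_def integral_nrm_law[OF sets_N assms]
    by (subst integral_nrm_law[OF _ assms]) (simp_all add: centring_law_def)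
qed

text \<open>The credible set compares the parameter with \<open>T n x\<close>, efficiency compares
  \<open>T n x\<close> with the parameter; the norm does not see the sign.\<close>

lemma coverage_event:
  assumes "n \<ge> 1" "x \<in> space (P n)"
  shows "\<theta> \<in> credible_set J0 w n (T n x) (R n x) \<longleftrightarrow> centring_error n x \<le> R n x"
proof -
  have "M_nrm J0 w (rescale J0 n (T n x) \<theta>) = centring_error n x"
    unfolding centring_error_def by (rule M_nrm_cong) (simp add: rescale_eq abs_mult abs_minus_commute)
  then show ?thesis
    using mem_credible_set_iff[OF T_in_M0[OF assms] theta assms(1)] by simp
qed

text \<open>Coverage implies that the centring error is at most \<open>b\<close> or that the radius
  is at least \<open>b\<close>. The second event is asymptotically negligible and the first has
  limiting probability at most \<open>cdf_N c\<close>.\<close>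

lemma coverage_upper:
  assumes "0 < \<epsilon>" "\<epsilon> < \<alpha>"
  shows "\<forall>\<^sub>F n in sequentially. measure (P n) {x \<in> space (P n). centring_error n x \<le> R n x} < 1 - \<alpha> + \<epsilon>"
proof -
  \<comment> \<open>Three distinct levels inside the allowed slack: the pair \<open>a\<close>,
    \<open>b\<close> keeps the radius below \<open>b\<close>, the pair \<open>b\<close>,
    \<open>c\<close> leaves room for the step function in the weak limit. The bound on
    \<open>\<epsilon>\<close> keeps the levels below 1.\<close>
  obtain a where a: "cdf_N a = 1 - \<alpha> + \<epsilon> / 4" using cdf_N_attains[of "1 - \<alpha> + \<epsilon> / 4"] assms alpha by auto
  obtain b where b: "cdf_N b = 1 - \<alpha> + \<epsilon> / 3" using cdf_N_attains[of "1 - \<alpha> + \<epsilon> / 3"] assms alpha by auto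
  obtain c where c: "cdf_N c = 1 - \<alpha> + \<epsilon> / 2" using cdf_N_attains[of "1 - \<alpha> + \<epsilon> / 2"] assms alpha by auto
  have "a < b" "b < c" using a b c assms by (simp_all add: cdf_N_less_imp)
  have "(\<lambda>n. measure (P n) {x \<in> space (P n). b \<le> R n x}) \<longlonglongrightarrow> 0"
    using radius_not_large[OF \<open>a < b\<close>] a assms by simp
  then have "(\<lambda>n. (\<integral>x. cts_step b c x \<partial>nrm_law (centring_law n)) + measure (P n) {x \<in> space (P n). b \<le> R n x})
      \<longlonglongrightarrow> (\<integral>x. cts_step b c x \<partial>nrm_law N) + 0"
    by (intro tendsto_add centring_cts_step_tendsto \<open>b < c\<close>)
  moreover have "(\<integral>x. cts_step b c x \<partial>nrm_law N) + 0 < 1 - \<alpha> + \<epsilon>"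
    using N.cdf_cts_step(2)[OF \<open>b < c\<close>] c assms by simp
  ultimately have "\<forall>\<^sub>F n in sequentially. (\<integral>x. cts_step b c x \<partial>nrm_law (centring_law n))
      + measure (P n) {x \<in> space (P n). b \<le> R n x} < 1 - \<alpha> + \<epsilon>"
    by (rule order_tendstoD)
  with eventually_ge_at_top[of 1] show ?thesis
  proof eventually_elim
    fix n :: nat
    assume n: "1 \<le> n" and lt: "(\<integral>x. cts_step b c x \<partial>nrm_law (centring_law n))
      + measure (P n) {x \<in> space (P n). b \<le> R n x} < 1 - \<alpha> + \<epsilon>"
    interpret prob_space "P n" by (rule prob_P)
    note [measurable] = R_measurable[OF n] centring_error_measurable[OF n]
    have sets: "{x \<in> space (P n). centring_error n x \<le> b} \<in> sets (P n)"
      "{x \<in> space (P n). centring_error n x \<le> R n x} \<in> sets (P n)"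
      "{x \<in> space (P n). b \<le> R n x} \<in> sets (P n)" "{x \<in> space (P n). R n x \<le> b} \<in> sets (P n)"
      by measurable
    have "prob {x \<in> space (P n). centring_error n x \<le> R n x}
        \<le> prob ({x \<in> space (P n). centring_error n x \<le> b} \<union> {x \<in> space (P n). b \<le> R n x})"
      by (rule finite_measure_mono) (force, intro sets.Un sets)
    also have "\<dots> \<le> prob {x \<in> space (P n). centring_error n x \<le> b} + prob {x \<in> space (P n). b \<le> R n x}"
      by (intro measure_Un_le sets)
    also have "prob {x \<in> space (P n). centring_error n x \<le> b} \<le> (\<integral>x. cts_step b c x \<partial>nrm_law (centring_law n))"
      using real_distribution.cdf_cts_step(1)[OF cdf_centring(1)[OF n] \<open>b < c\<close>] cdf_centring(2)[OF n] by simp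
    finally show "prob {x \<in> space (P n). centring_error n x \<le> R n x} < 1 - \<alpha> + \<epsilon>"
      using lt by simp
  qed
qed

text \<open>Dually, a centring error of at most \<open>b\<close> implies coverage or a radius of at
  most \<open>b\<close>. Now the pair \<open>b\<close>, \<open>c\<close> controls the radius and the
  pair \<open>a\<close>, \<open>b\<close> carries the weak limit.\<close>

lemma coverage_lower:
  assumes "0 < \<epsilon>" "\<epsilon> < 1 - \<alpha>"
  shows "\<forall>\<^sub>F n in sequentially. 1 - \<alpha> - \<epsilon> < measure (P n) {x \<in> space (P n). centring_error n x \<le> R n x}"
proof -
  obtain a where a: "cdf_N a = 1 - \<alpha> - \<epsilon> / 2" using cdf_N_attains[of "1 - \<alpha> - \<epsilon> / 2"] assms alpha by auto
  obtain b where b: "cdf_N b = 1 - \<alpha> - \<epsilon> / 3" using cdf_N_attains[of "1 - \<alpha> - \<epsilon> / 3"] assms alpha by auto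
  obtain c where c: "cdf_N c = 1 - \<alpha> - \<epsilon> / 4" using cdf_N_attains[of "1 - \<alpha> - \<epsilon> / 4"] assms alpha by auto
  have "a < b" "b < c" using a b c assms by (simp_all add: cdf_N_less_imp)
  have "(\<lambda>n. measure (P n) {x \<in> space (P n). R n x \<le> b}) \<longlonglongrightarrow> 0"
    using radius_not_small[OF \<open>b < c\<close>] c assms by simp
  then have "(\<lambda>n. (\<integral>x. cts_step a b x \<partial>nrm_law (centring_law n)) - measure (P n) {x \<in> space (P n). R n x \<le> b})
      \<longlonglongrightarrow> (\<integral>x. cts_step a b x \<partial>nrm_law N) - 0"
    by (intro tendsto_diff centring_cts_step_tendsto \<open>a < b\<close>)
  moreover have "1 - \<alpha> - \<epsilon> < (\<integral>x. cts_step a b x \<partial>nrm_law N) - 0"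
    using N.cdf_cts_step(1)[OF \<open>a < b\<close>] a assms by simp
  ultimately have "\<forall>\<^sub>F n in sequentially. 1 - \<alpha> - \<epsilon> < (\<integral>x. cts_step a b x \<partial>nrm_law (centring_law n))
      - measure (P n) {x \<in> space (P n). R n x \<le> b}"
    by (rule order_tendstoD)
  with eventually_ge_at_top[of 1] show ?thesis
  proof eventually_elim
    fix n :: nat
    assume n: "1 \<le> n" and lt: "1 - \<alpha> - \<epsilon> < (\<integral>x. cts_step a b x \<partial>nrm_law (centring_law n))
      - measure (P n) {x \<in> space (P n). R n x \<le> b}"
    interpret prob_space "P n" by (rule prob_P)
    note [measurable] = R_measurable[OF n] centring_error_measurable[OF n]
    have sets: "{x \<in> space (P n). centring_error n x \<le> b} \<in> sets (P n)"
      "{x \<in> space (P n). centring_error n x \<le> R n x} \<in> sets (P n)"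
      "{x \<in> space (P n). b \<le> R n x} \<in> sets (P n)" "{x \<in> space (P n). R n x \<le> b} \<in> sets (P n)"
      by measurable
    have "(\<integral>x. cts_step a b x \<partial>nrm_law (centring_law n)) \<le> prob {x \<in> space (P n). centring_error n x \<le> b}"
      using real_distribution.cdf_cts_step(2)[OF cdf_centring(1)[OF n] \<open>a < b\<close>] cdf_centring(2)[OF n] by simp
    also have "\<dots> \<le> prob ({x \<in> space (P n). centring_error n x \<le> R n x} \<union> {x \<in> space (P n). R n x \<le> b})"
      by (rule finite_measure_mono) (force, intro sets.Un sets)
    also have "\<dots> \<le> prob {x \<in> space (P n). centring_error n x \<le> R n x} + prob {x \<in> space (P n). R n x \<le> b}"
      by (intro measure_Un_le sets)
    finally show "1 - \<alpha> - \<epsilon> < prob {x \<in> space (P n). centring_error n x \<le> R n x}"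
      using lt by simp
  qed
qed

lemma coverage:
  "(\<lambda>n. measure (P n) {x \<in> space (P n). \<theta> \<in> credible_set J0 w n (T n x) (R n x)}) \<longlonglongrightarrow> 1 - \<alpha>"
proof -
  have "(\<lambda>n. measure (P n) {x \<in> space (P n). centring_error n x \<le> R n x}) \<longlonglongrightarrow> 1 - \<alpha>"
  proof (rule order_tendstoI)
    fix y assume y: "y < 1 - \<alpha>"
    \<comment> \<open>Capped at half of \<open>1 - \<alpha>\<close> so that
      \<open>coverage_lower\<close> applies even when \<open>y\<close> is far below the
      limit.\<close>
    define \<epsilon> where "\<epsilon> = min ((1 - \<alpha>) / 2) (1 - \<alpha> - y)"
    have "0 < \<epsilon>" "\<epsilon> < 1 - \<alpha>" "y \<le> 1 - \<alpha> - \<epsilon>" using y alpha by (auto simp: \<epsilon>_def min_def field_simps)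
    then show "\<forall>\<^sub>F n in sequentially. y < measure (P n) {x \<in> space (P n). centring_error n x \<le> R n x}"
      using coverage_lower[of \<epsilon>] by (auto elim!: eventually_mono)
  next
    fix y assume y: "1 - \<alpha> < y"
    define \<epsilon> where "\<epsilon> = min (\<alpha> / 2) (y - (1 - \<alpha>))"
    have "0 < \<epsilon>" "\<epsilon> < \<alpha>" "1 - \<alpha> + \<epsilon> \<le> y" using y alpha by (auto simp: \<epsilon>_def min_def field_simps)
    then show "\<forall>\<^sub>F n in sequentially. measure (P n) {x \<in> space (P n). centring_error n x \<le> R n x} < y"
      using coverage_upper[of \<epsilon>] by (auto elim!: eventually_mono)
  qed
  then show ?thesis
  proof (rule Lim_transform_eventually)
    show "\<forall>\<^sub>F n in sequentially. measure (P n) {x \<in> space (P n). centring_error n x \<le> R n x}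
      = measure (P n) {x \<in> space (P n). \<theta> \<in> credible_set J0 w n (T n x) (R n x)}"
      using eventually_ge_at_top[of 1]
      by eventually_elim (intro arg_cong2[where f = measure] Collect_cong, auto simp: coverage_event)
  qed
qed

end

section \<open>Localisation of the wavelets\<close>

text \<open>A uniform bound on the sum of all integer translates of \<open>\<bar>g\<bar>\<close>,
  phrased through finite sums so that no summability is presupposed.\<close>

definition translates_bounded :: "(real \<Rightarrow> real) \<Rightarrow> real \<Rightarrow> bool" where
  "translates_bounded g B \<longleftrightarrow>
     (\<forall>y F. finite F \<longrightarrow> (\<Sum>k\<in>F. \<bar>g (y - real_of_int k)\<bar>) \<le> B)"

lemma translates_boundedD:
  "translates_bounded g B \<Longrightarrow> finite F \<Longrightarrow> (\<Sum>k\<in>F. \<bar>g (y - real_of_int k)\<bar>) \<le> B"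
  by (simp add: translates_bounded_def)

lemma translates_bounded_inj:
  assumes "translates_bounded g B" "finite A" "inj_on h A"
  shows "(\<Sum>a\<in>A. \<bar>g (y - real_of_int (h a))\<bar>) \<le> B"
  using translates_boundedD[OF assms(1), of "h ` A" y] assms by (simp add: sum.reindex)

lemma translates_bounded_abs_le: "translates_bounded g B \<Longrightarrow> \<bar>g y\<bar> \<le> B"
  using translates_boundedD[of g B "{0}" y] by simp

lemma summable_on_inverse_square_int: "(\<lambda>i::int. 1 / (1 + \<bar>real_of_int i\<bar>)\<^sup>2) summable_on UNIV"
proof -
  let ?f = "\<lambda>i::int. 1 / (1 + \<bar>real_of_int i\<bar>)\<^sup>2"
  have "summable (\<lambda>n. inverse (real (Suc n) ^ 2))"
    using inverse_power_summable[of 2] by (subst summable_Suc_iff) simp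
  then have nat: "(\<lambda>n::nat. 1 / (1 + real n)\<^sup>2) summable_on UNIV"
    by (intro norm_summable_imp_summable_on) (simp add: inverse_eq_divide add.commute)
  have "?f summable_on range int"
    using nat by (subst summable_on_reindex) (auto simp: o_def)
  moreover have "?f summable_on (\<lambda>n. - int n) ` {1..}"
    using summable_on_subset_banach[OF nat, of "{1..}"]
    by (subst summable_on_reindex) (auto simp: o_def inj_on_def)
  moreover have "range int \<inter> (\<lambda>n. - int n) ` {1..} = {}" by auto
  ultimately have "?f summable_on (range int \<union> (\<lambda>n. - int n) ` {1..})"
    by (rule summable_on_Un_disjoint)
  also have "range int \<union> (\<lambda>n. - int n) ` {1..} = UNIV"
  proof (rule UNIV_eq_I[symmetric])
    fix i :: int show "i \<in> range int \<union> (\<lambda>n. - int n) ` {1..}"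
    proof (cases "0 \<le> i")
      case True then show ?thesis by (metis UnI1 nonneg_int_cases rangeI)
    next
      case False
      then have "i = - int (nat (- i))" "1 \<le> nat (- i)" by auto
      then show ?thesis by blast
    qed
  qed
  finally show ?thesis .
qed

text \<open>Replacing \<open>y\<close> by its integer part at most doubles
  \<open>1 + \<bar>y - k\<bar>\<close>, whence the factor 4 after squaring. The reflection of
  \<open>k\<close> at that integer then gives one convergent series for all
  \<open>y\<close>.\<close>

lemma quadratic_decay_translates_bounded:
  assumes g: "\<And>x. \<bar>g x\<bar> * (1 + \<bar>x\<bar>)\<^sup>2 \<le> C"
  shows "\<exists>B. translates_bounded g B"
proof -
  let ?f = "\<lambda>i::int. 1 / (1 + \<bar>real_of_int i\<bar>)\<^sup>2"
  have "0 \<le> C" using g[of 0] by (simp add: abs_ge_zero[THEN order_trans])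
  have "(\<Sum>k\<in>F. \<bar>g (y - real_of_int k)\<bar>) \<le> 4 * C * infsum ?f UNIV" if F: "finite F" for y F
  proof -
    define m where "m = \<lfloor>y\<rfloor>"
    have "\<bar>g (y - real_of_int k)\<bar> \<le> 4 * C * ?f (m - k)" for k
    proof -
      have "\<bar>real_of_int (m - k)\<bar> \<le> \<bar>y - real_of_int k\<bar> + 1"
        unfolding m_def of_int_diff using floor_correct[of y] by linarith
      then have "1 + \<bar>real_of_int (m - k)\<bar> \<le> 2 * (1 + \<bar>y - real_of_int k\<bar>)"
        using abs_ge_zero[of "y - real_of_int k"] by argo
      then have "(1 + \<bar>real_of_int (m - k)\<bar>)\<^sup>2 \<le> (2 * (1 + \<bar>y - real_of_int k\<bar>))\<^sup>2"
        by (intro power_mono) auto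
      then have "\<bar>g (y - real_of_int k)\<bar> * (1 + \<bar>real_of_int (m - k)\<bar>)\<^sup>2
          \<le> \<bar>g (y - real_of_int k)\<bar> * (2 * (1 + \<bar>y - real_of_int k\<bar>))\<^sup>2"
        by (intro mult_left_mono) auto
      also have "\<dots> = 4 * (\<bar>g (y - real_of_int k)\<bar> * (1 + \<bar>y - real_of_int k\<bar>)\<^sup>2)"
        by (simp only: power_mult_distrib) simp
      also have "\<dots> \<le> 4 * C" using g[of "y - real_of_int k"] by simp
      finally have "\<bar>g (y - real_of_int k)\<bar> * (1 + \<bar>real_of_int (m - k)\<bar>)\<^sup>2 \<le> 4 * C" .
      moreover have "0 < (1 + \<bar>real_of_int (m - k)\<bar>)\<^sup>2" by (intro zero_less_power) auto
      ultimately show ?thesis by (simp add: pos_le_divide_eq)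
    qed
    then have "(\<Sum>k\<in>F. \<bar>g (y - real_of_int k)\<bar>) \<le> (\<Sum>k\<in>F. 4 * C * ?f (m - k))"
      by (rule sum_mono)
    also have "\<dots> = 4 * C * (\<Sum>i\<in>(\<lambda>k. m - k) ` F. ?f i)"
      by (subst sum.reindex) (auto simp: inj_on_def sum_distrib_left)
    also have "\<dots> \<le> 4 * C * infsum ?f UNIV"
      using F \<open>0 \<le> C\<close>
      by (intro mult_left_mono finite_sum_le_infsum summable_on_inverse_square_int) auto
    finally show ?thesis .
  qed
  then show ?thesis unfolding translates_bounded_def by blast
qed

lemma regular_fun_translates_bounded:
  assumes "regular_fun S g" shows "\<exists>B. translates_bounded g B"
proof -
  obtain D where "D 0 = g" and "\<forall>a\<le>S. \<forall>m::nat. \<exists>C. \<forall>x. \<bar>D a x\<bar> * (1 + \<bar>x\<bar>) ^ m \<le> C"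
    using assms unfolding regular_fun_def by blast
  then obtain C where "\<And>x. \<bar>g x\<bar> * (1 + \<bar>x\<bar>)\<^sup>2 \<le> C" by blast
  then show ?thesis by (rule quadratic_decay_translates_bounded)
qed

lemma haar_mother_translates_bounded: "\<exists>B. translates_bounded haar_mother B"
proof (rule quadratic_decay_translates_bounded)
  fix x :: real
  show "\<bar>haar_mother x\<bar> * (1 + \<bar>x\<bar>)\<^sup>2 \<le> 4"
  proof (cases "x \<in> {0..<1}")
    case True
    then have "\<bar>haar_mother x\<bar> \<le> 1" "(1 + \<bar>x\<bar>)\<^sup>2 \<le> 2\<^sup>2"
      using power_mono[of "1 + x" 2 2] by (auto simp: haar_mother_def indicator_def)
    then have "\<bar>haar_mother x\<bar> * (1 + \<bar>x\<bar>)\<^sup>2 \<le> 1 * 2\<^sup>2"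
      by (intro mult_mono) auto
    then show ?thesis by simp
  qed (auto simp: haar_mother_def indicator_def)
qed

definition localised :: "nat \<Rightarrow> (int \<Rightarrow> nat \<Rightarrow> real \<Rightarrow> real) \<Rightarrow> real \<Rightarrow> bool" where
  "localised J0 \<psi> C \<longleftrightarrow> 0 \<le> C \<and>
     (\<forall>l\<ge>int J0 - 1. \<forall>x\<in>{0..1}. (\<Sum>k<level_size J0 l. \<bar>\<psi> l k x\<bar>) \<le> C * 2 powr (real_of_int l / 2))"

text \<open>The scaling level is one single level, so any bound there takes the required form after
  division by its factor \<open>q\<close>.\<close>

lemma localisedI:
  assumes coarse: "\<And>x. x \<in> {0..1} \<Longrightarrow> (\<Sum>k<2 ^ J0. \<bar>\<psi> (int J0 - 1) k x\<bar>) \<le> A"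
    and fine: "\<And>l x. J0 \<le> l \<Longrightarrow> x \<in> {0..1} \<Longrightarrow>
      (\<Sum>k<2 ^ l. \<bar>\<psi> (int l) k x\<bar>) \<le> B * 2 powr (real l / 2)"
  shows "\<exists>C. localised J0 \<psi> C"
proof -
  define q where "q = 2 powr (real_of_int (int J0 - 1) / 2)"
  have "0 < q" by (simp add: q_def)
  define C where "C = max 0 (max (A / q) B)"
  have "(\<Sum>k<level_size J0 l. \<bar>\<psi> l k x\<bar>) \<le> C * 2 powr (real_of_int l / 2)"
    if l: "int J0 - 1 \<le> l" and x: "x \<in> {0..1}" for l x
  proof (cases "l = int J0 - 1")
    case True
    have "(\<Sum>k<level_size J0 l. \<bar>\<psi> l k x\<bar>) \<le> A / q * q"
      using coarse[OF x] \<open>0 < q\<close> True by (simp add: level_size_def)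
    also have "\<dots> \<le> C * q" using \<open>0 < q\<close> by (intro mult_right_mono) (auto simp: C_def)
    finally show ?thesis using True by (simp add: q_def)
  next
    case False
    then obtain l' where l': "l = int l'" "J0 \<le> l'"
      using l by (intro that[of "nat l"]) auto
    have "(\<Sum>k<level_size J0 l. \<bar>\<psi> l k x\<bar>) \<le> B * 2 powr (real l' / 2)"
      using fine[OF l'(2) x] l' by (simp add: level_size_def max_absorb1)
    also have "\<dots> \<le> C * 2 powr (real l' / 2)"
      by (intro mult_right_mono) (auto simp: C_def)
    finally show ?thesis using l' by simp
  qed
  moreover have "0 \<le> C" by (simp add: C_def)
  ultimately show ?thesis unfolding localised_def by blast
qed

lemma sum_abs_dilate_le:
  assumes "translates_bounded g B"
  shows "(\<Sum>k<n. \<bar>dilate l (int k) g x\<bar>) \<le> B * 2 powr (real_of_int l / 2)"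
proof -
  have "(\<Sum>k<n. \<bar>dilate l (int k) g x\<bar>)
      = (\<Sum>k<n. \<bar>g (2 powr real_of_int l * x - real_of_int (int k))\<bar>) * 2 powr (real_of_int l / 2)"
    unfolding sum_distrib_right by (intro sum.cong) (auto simp: dilate_def abs_mult)
  also have "\<dots> \<le> B * 2 powr (real_of_int l / 2)"
    by (intro mult_right_mono translates_bounded_inj[OF assms]) auto
  finally show ?thesis .
qed

lemma haar_basis_localised:
  assumes "haar_basis \<psi>" shows "\<exists>C. localised 0 \<psi> C"
proof -
  obtain B where B: "translates_bounded haar_mother B"
    using haar_mother_translates_bounded by blast
  show ?thesis
  proof (rule localisedI)
    fix x :: real assume x: "x \<in> {0..1}"
    then show "(\<Sum>k<2 ^ 0. \<bar>\<psi> (int 0 - 1) k x\<bar>) \<le> 1"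
      using assms by (simp add: haar_basis_def)
    fix l :: nat
    have "(\<Sum>k<2 ^ l. \<bar>\<psi> (int l) k x\<bar>) = (\<Sum>k<2 ^ l. \<bar>dilate (int l) (int k) haar_mother x\<bar>)"
      using assms x by (intro sum.cong) (auto simp: haar_basis_def level_size_def)
    also have "\<dots> \<le> B * 2 powr (real l / 2)"
      using sum_abs_dilate_le[OF B, where l = "int l"] by simp
    finally show "(\<Sum>k<2 ^ l. \<bar>\<psi> (int l) k x\<bar>) \<le> B * 2 powr (real l / 2)" .
  qed
qed

text \<open>The pairs \<open>(k, m)\<close> of a position and a period shift give pairwise distinct translates
  \<open>k - 2\<^sup>l m\<close> of the wavelet on the line, so no translate is counted twice.\<close>

lemma sum_abs_periodise_dilate_le:
  assumes B: "translates_bounded g B"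
  shows "(\<Sum>k<2 ^ l. \<bar>periodise (dilate (int l) (int k) g) x\<bar>) \<le> B * 2 powr (real l / 2)"
proof -
  define a where "a k m = dilate (int l) (int k) g (x + real_of_int m)" for k and m :: int
  have a: "a k m = 2 powr (real l / 2) * g (2 ^ l * x - real_of_int (int k - 2 ^ l * m))" for k m
    by (simp add: a_def dilate_def powr_realpow algebra_simps)
  have le: "(\<Sum>k\<in>A. \<bar>\<Sum>m\<in>F. a k m\<bar>) \<le> B * 2 powr (real l / 2)"
    and le': "(\<Sum>k\<in>A. \<Sum>m\<in>F. \<bar>a k m\<bar>) \<le> B * 2 powr (real l / 2)"
    if F: "finite F" and A: "A \<subseteq> {..<2 ^ l}" for F A
  proof -
    have "inj_on (\<lambda>(k, m). int k - 2 ^ l * m) (A \<times> F)"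
    proof (rule inj_onI, clarsimp)
      fix k m k' m' assume "k \<in> A" "k' \<in> A" and eq: "int k - 2 ^ l * m = int k' - 2 ^ l * m'"
      then have k: "int k < 2 ^ l" "int k' < 2 ^ l"
        using A by (auto simp: subset_iff zless_nat_conj of_nat_less_iff[symmetric] simp del: of_nat_less_iff)
      have "(int k - 2 ^ l * m) mod 2 ^ l = (int k' - 2 ^ l * m') mod 2 ^ l" using eq by simp
      then have "int k mod 2 ^ l = int k' mod 2 ^ l"
        by (metis mod_diff_right_eq mod_mult_self1_is_0 diff_zero)
      then have "k = k'" using k by simp
      then show "k = k' \<and> m = m'" using eq by simp
    qed
    moreover have "finite (A \<times> F)" using A F finite_subset by blast
    ultimately have "(\<Sum>p\<in>A \<times> F. \<bar>g (2 ^ l * x - real_of_int ((\<lambda>(k, m). int k - 2 ^ l * m) p))\<bar>) \<le> B"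
      by (intro translates_bounded_inj[OF B])
    moreover have "(\<Sum>k\<in>A. \<Sum>m\<in>F. \<bar>a k m\<bar>) =
        (\<Sum>p\<in>A \<times> F. \<bar>g (2 ^ l * x - real_of_int ((\<lambda>(k, m). int k - 2 ^ l * m) p))\<bar>) * 2 powr (real l / 2)"
      unfolding sum.cartesian_product sum_distrib_right
      by (intro sum.cong refl) (auto simp: a abs_mult)
    ultimately show le': "(\<Sum>k\<in>A. \<Sum>m\<in>F. \<bar>a k m\<bar>) \<le> B * 2 powr (real l / 2)"
      by (simp add: mult_right_mono)
    have "(\<Sum>k\<in>A. \<bar>\<Sum>m\<in>F. a k m\<bar>) \<le> (\<Sum>k\<in>A. \<Sum>m\<in>F. \<bar>a k m\<bar>)"
      by (intro sum_mono sum_abs)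
    with le' show "(\<Sum>k\<in>A. \<bar>\<Sum>m\<in>F. a k m\<bar>) \<le> B * 2 powr (real l / 2)" by linarith
  qed
  have summable: "a k summable_on UNIV" if "k < 2 ^ l" for k
  proof (rule abs_summable_summable, rule nonneg_bdd_above_summable_on)
    show "bdd_above (sum (\<lambda>m. norm (a k m)) ` {F. F \<subseteq> UNIV \<and> finite F})"
      using le'[of _ "{k}"] that by (intro bdd_aboveI[of _ "B * 2 powr (real l / 2)"]) auto
  qed auto
  \<comment> \<open>The bound holds with the same finite set of shifts for all positions, so it
    passes to the limit along finite sets.\<close>
  have "((\<lambda>F. \<Sum>k<2 ^ l. \<bar>\<Sum>m\<in>F. a k m\<bar>) \<longlongrightarrow> (\<Sum>k<2 ^ l. \<bar>infsum (a k) UNIV\<bar>))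
      (finite_subsets_at_top UNIV)"
    by (intro tendsto_sum tendsto_rabs infsum_tendsto summable) simp
  moreover have "\<forall>\<^sub>F F in finite_subsets_at_top UNIV. (\<Sum>k<2 ^ l. \<bar>\<Sum>m\<in>F. a k m\<bar>) \<le> B * 2 powr (real l / 2)"
    by (rule eventually_finite_subsets_at_top_weakI) (intro le; simp)
  ultimately have "(\<Sum>k<2 ^ l. \<bar>infsum (a k) UNIV\<bar>) \<le> B * 2 powr (real l / 2)"
    by (rule tendsto_upperbound) simp
  moreover have "a k = (\<lambda>m. dilate (int l) (int k) g (x + real_of_int m))" for k
    by (simp add: a_def fun_eq_iff)
  ultimately show ?thesis by (simp add: periodise_def)
qed

lemma periodised_basis_localised:
  assumes "periodised_basis S \<psi>" shows "\<exists>C. localised 0 \<psi> C"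
proof -
  obtain \<phi>R \<psi>R where line: "line_wavelets S \<phi>R \<psi>R"
    and coarse: "\<And>x. x \<in> {0..1} \<Longrightarrow> \<psi> (-1) 0 x = periodise \<phi>R x"
    and fine: "\<And>x l k. x \<in> {0..1} \<Longrightarrow> 0 \<le> l \<Longrightarrow> k < level_size 0 l \<Longrightarrow>
      \<psi> l k x = periodise (dilate l (int k) \<psi>R) x"
    using assms unfolding periodised_basis_def by blast
  obtain A B where A: "translates_bounded \<phi>R A" and B: "translates_bounded \<psi>R B"
    using line regular_fun_translates_bounded unfolding line_wavelets_def by blast
  \<comment> \<open>Presents the scaling function as a dilate at level 0, so that the periodisation
    estimate with \<open>l = 0\<close> and its single position covers the coarse level.\<close>
  have dilate_0: "dilate 0 0 \<phi>R = \<phi>R" by (simp add: dilate_def fun_eq_iff)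
  show ?thesis
  proof (rule localisedI)
    fix x :: real assume x: "x \<in> {0..1}"
    then show "(\<Sum>k<2 ^ 0. \<bar>\<psi> (int 0 - 1) k x\<bar>) \<le> A"
      using coarse sum_abs_periodise_dilate_le[OF A, of 0 x] dilate_0 by simp
    fix l :: nat
    have "(\<Sum>k<2 ^ l. \<bar>\<psi> (int l) k x\<bar>) = (\<Sum>k<2 ^ l. \<bar>periodise (dilate (int l) (int k) \<psi>R) x\<bar>)"
      using fine x by (intro sum.cong) (auto simp: level_size_def)
    also have "\<dots> \<le> B * 2 powr (real l / 2)"
      by (rule sum_abs_periodise_dilate_le[OF B])
    finally show "(\<Sum>k<2 ^ l. \<bar>\<psi> (int l) k x\<bar>) \<le> B * 2 powr (real l / 2)" .
  qed
qed

section \<open>Edge functions of boundary corrected bases\<close>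

text \<open>There are only \<open>N\<close> edge functions per level at each end, so a uniform bound
  on the half line \<open>H\<close> takes the place of summability over translates.\<close>

definition family_bounded :: "nat \<Rightarrow> real set \<Rightarrow> (nat \<Rightarrow> real \<Rightarrow> real) \<Rightarrow> bool" where
  "family_bounded N H b \<longleftrightarrow> (\<exists>B\<ge>0. \<forall>k<N. \<forall>x\<in>H. \<bar>b k x\<bar> \<le> B)"

lemma family_boundedI:
  assumes "\<And>k. k < N \<Longrightarrow> \<exists>B. \<forall>x\<in>H. \<bar>b k x\<bar> \<le> B"
  shows "family_bounded N H b"
proof -
  obtain B where B: "\<And>k x. k < N \<Longrightarrow> x \<in> H \<Longrightarrow> \<bar>b k x\<bar> \<le> B k" using assms by metis
  have "\<bar>b k x\<bar> \<le> (\<Sum>k<N. \<bar>B k\<bar>)" if "k < N" "x \<in> H" for k x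
  proof -
    have "\<bar>b k x\<bar> \<le> \<bar>B k\<bar>" using B[OF that] by simp
    also have "\<dots> \<le> (\<Sum>k<N. \<bar>B k\<bar>)" using that by (intro member_le_sum) auto
    finally show ?thesis .
  qed
  then show ?thesis unfolding family_bounded_def by (meson abs_ge_zero sum_nonneg)
qed

lemma bounded_lincomb:
  fixes f :: "'i \<Rightarrow> 'x \<Rightarrow> real"
  assumes "\<And>i x. i \<in> I \<Longrightarrow> x \<in> H \<Longrightarrow> \<bar>f i x\<bar> \<le> B" and "x \<in> H"
  shows "\<bar>\<Sum>i\<in>I. a i * f i x\<bar> \<le> (\<Sum>i\<in>I. \<bar>a i\<bar> * B)"
  using assms by (intro sum_abs[THEN order_trans] sum_mono) (auto simp: abs_mult mult_left_mono)

lemma orthonormalised_edge_bounded: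
  assumes "orthonormalised_edge N H e b" and "\<And>m x. x \<in> H \<Longrightarrow> \<bar>e m x\<bar> \<le> B m"
  shows "family_bounded N H b"
proof (rule family_boundedI)
  fix k assume "k < N"
  obtain a where a: "\<And>k x. k < N \<Longrightarrow> x \<in> H \<Longrightarrow> b k x = (\<Sum>m<N. a k m * e m x)"
    using assms(1) unfolding orthonormalised_edge_def by blast
  define D where "D = Max (insert 0 (B ` {..<N}))"
  have D: "\<bar>e m x\<bar> \<le> D" if "m \<in> {..<N}" "x \<in> H" for m x
    using assms(2)[OF that(2), of m] that(1) unfolding D_def by (intro order_trans[OF _ Max_ge]) auto
  have "\<bar>b k x\<bar> \<le> (\<Sum>m<N. \<bar>a k m\<bar> * D)" if "x \<in> H" for x
    unfolding a[OF \<open>k < N\<close> that] by (rule bounded_lincomb[OF D that])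
  then show "\<exists>B. \<forall>x\<in>H. \<bar>b k x\<bar> \<le> B" by blast
qed

text \<open>The refinement relation evaluates the edge scaling functions at \<open>2 * x\<close>, so
  \<open>H\<close> must be closed under doubling, as both half lines are.\<close>

lemma edge_wavelets_bounded:
  assumes "edge_wavelets N H K F \<phi> \<psi> b d" and b: "family_bounded N H b"
    and \<phi>: "\<And>x. \<bar>\<phi> x\<bar> \<le> A" and H: "\<And>x. x \<in> H \<Longrightarrow> 2 * x \<in> H"
  shows "family_bounded N H d"
proof (rule family_boundedI)
  fix k assume "k < N"
  obtain p q where d: "\<And>k x. k < N \<Longrightarrow> x \<in> H \<Longrightarrow>
      d k x = (\<Sum>m<N. p k m * b m (2 * x)) + (\<Sum>m\<in>F. q k m * \<phi> (2 * x - real_of_int m))"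
    using assms(1) unfolding edge_wavelets_def by blast
  obtain B where B: "\<And>k x. k < N \<Longrightarrow> x \<in> H \<Longrightarrow> \<bar>b k x\<bar> \<le> B"
    using b unfolding family_bounded_def by blast
  have "\<bar>d k x\<bar> \<le> (\<Sum>m<N. \<bar>p k m\<bar> * B) + (\<Sum>m\<in>F. \<bar>q k m\<bar> * A)" if "x \<in> H" for x
    unfolding d[OF \<open>k < N\<close> that] using B H \<phi> that
    by (intro abs_triangle_ineq[THEN order_trans] add_mono bounded_lincomb[of _ H]) auto
  then show "\<exists>B. \<forall>x\<in>H. \<bar>d k x\<bar> \<le> B" by blast
qed

text \<open>At most \<open>N\<close> positions belong to each end, and the interior sum is enlarged
  to all positions. On coarse levels the two end ranges may overlap or the subtraction
  \<open>2 ^ l - N\<close> truncate; this only enlarges the majorant.\<close>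

lemma sum_abs_interval_fun_le:
  assumes g: "translates_bounded g B"
    and gl: "family_bounded N {0..} gl" and gr: "family_bounded N {..0} gr"
  shows "\<exists>C. \<forall>l. \<forall>x\<in>{0..1}. (\<Sum>k<2 ^ l. \<bar>interval_fun N g gl gr l k x\<bar>) \<le> C * 2 powr (real l / 2)"
proof -
  obtain Bl Br where Bl: "0 \<le> Bl" "\<And>k x. k < N \<Longrightarrow> 0 \<le> x \<Longrightarrow> \<bar>gl k x\<bar> \<le> Bl"
    and Br: "0 \<le> Br" "\<And>k x. k < N \<Longrightarrow> x \<le> 0 \<Longrightarrow> \<bar>gr k x\<bar> \<le> Br"
    using gl gr unfolding family_bounded_def by (metis atLeast_iff atMost_iff)
  have "(\<Sum>k<2 ^ l. \<bar>interval_fun N g gl gr l k x\<bar>)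
      \<le> (real N * Bl + B + real N * Br) * 2 powr (real l / 2)" if x: "x \<in> {0..1}" for l x
  proof -
    let ?q = "2 powr (real l / 2)"
    have *: "\<bar>interval_fun N g gl gr l k x\<bar> \<le> (if k \<in> {..<N} then Bl * ?q else 0)
        + \<bar>dilate (int l) (int k) g x\<bar> + (if k \<in> {2 ^ l - N..} then Br * ?q else 0)"
      if k: "k < 2 ^ l" for k
    proof -
      consider "k < N" | "\<not> k < N" "k < 2 ^ l - N" | "\<not> k < N" "\<not> k < 2 ^ l - N" by blast
      then show ?thesis
      proof cases
        case 1
        then have "\<bar>interval_fun N g gl gr l k x\<bar> \<le> Bl * ?q"
          using Bl(2)[OF 1, of "2 powr real l * x"] x
          by (simp add: interval_fun_def dilate_def abs_mult mult.commute mult_right_mono)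
        then show ?thesis using 1 Br by (simp add: add_increasing2)
      next
        case 2
        then show ?thesis by (simp add: interval_fun_def)
      next
        case 3
        then have "2 ^ l - 1 - k < N" "2 ^ l - N \<le> k" using k by linarith+
        then have "\<bar>interval_fun N g gl gr l k x\<bar> \<le> Br * ?q"
          using 3 Br(2)[of "2 ^ l - 1 - k" "2 powr real l * (x - 1)"] x
          by (simp add: interval_fun_def dilate_def abs_mult mult.commute mult_right_mono
              mult_nonpos_nonneg)
        then show ?thesis using 3 by (simp add: add_increasing)
      qed
    qed
    have "(\<Sum>k<2 ^ l. \<bar>interval_fun N g gl gr l k x\<bar>)
        \<le> (\<Sum>k<2 ^ l. if k \<in> {..<N} then Bl * ?q else 0)
          + (\<Sum>k<2 ^ l. \<bar>dilate (int l) (int k) g x\<bar>) + (\<Sum>k<2 ^ l. if k \<in> {2 ^ l - N..} then Br * ?q else 0)"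
      unfolding sum.distrib[symmetric] by (intro sum_mono *) auto
    also have "\<dots> \<le> real N * (Bl * ?q) + B * ?q + real N * (Br * ?q)"
    proof (intro add_mono)
      have "card ({..<2 ^ l} \<inter> {..<N}) \<le> card {..<N}" by (intro card_mono) auto
      then have "real (card ({..<2 ^ l} \<inter> {..<N})) * (Bl * ?q) \<le> real N * (Bl * ?q)"
        using Bl by (intro mult_right_mono) auto
      then show "(\<Sum>k<2 ^ l. if k \<in> {..<N} then Bl * ?q else 0) \<le> real N * (Bl * ?q)"
        by (subst sum.inter_restrict[symmetric]) auto
      have "card ({..<2 ^ l} \<inter> {2 ^ l - N..}) \<le> card {2 ^ l - N..<2 ^ l}" by (intro card_mono) auto
      also have "\<dots> \<le> N" by simp
      finally have "real (card ({..<2 ^ l} \<inter> {2 ^ l - N..})) * (Br * ?q) \<le> real N * (Br * ?q)"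
        using Br by (intro mult_right_mono) auto
      then show "(\<Sum>k<2 ^ l. if k \<in> {2 ^ l - N..} then Br * ?q else 0) \<le> real N * (Br * ?q)"
        by (subst sum.inter_restrict[symmetric]) auto
      show "(\<Sum>k<2 ^ l. \<bar>dilate (int l) (int k) g x\<bar>) \<le> B * ?q"
        using sum_abs_dilate_le[OF g, where l = "int l"] by simp
    qed
    finally show ?thesis by (simp add: algebra_simps)
  qed
  then show ?thesis by blast
qed

lemma cdv_basis_localised:
  assumes "cdv_basis S J0 \<psi>" shows "\<exists>C. localised J0 \<psi> C"
proof -
  obtain N \<phi>R \<psi>R \<phi>l \<phi>r \<psi>l \<psi>r where
    line: "line_wavelets S \<phi>R \<psi>R"
    and \<phi>l: "orthonormalised_edge N {0..} (left_edge N \<phi>R) \<phi>l"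
    and \<phi>r: "orthonormalised_edge N {..0} (right_edge N \<phi>R) \<phi>r"
    and \<psi>l: "edge_wavelets N {0..} {int N..} {int N..3 * int N - 2} \<phi>R \<psi>R \<phi>l \<psi>l"
    and \<psi>r: "edge_wavelets N {..0} {..- int N - 1} {1 - 3 * int N..- int N - 1} \<phi>R \<psi>R \<phi>r \<psi>r"
    and coarse: "\<And>x k. x \<in> {0..1} \<Longrightarrow> k < 2 ^ J0 \<Longrightarrow>
      \<psi> (int J0 - 1) k x = interval_fun N \<phi>R \<phi>l \<phi>r J0 k x"
    and fine: "\<And>x l k. x \<in> {0..1} \<Longrightarrow> J0 \<le> l \<Longrightarrow> k < 2 ^ l \<Longrightarrow>
      \<psi> (int l) k x = interval_fun N \<psi>R \<psi>l \<psi>r l k x"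
    using assms unfolding cdv_basis_def daubechies_def by blast
  obtain A B where A: "translates_bounded \<phi>R A" and B: "translates_bounded \<psi>R B"
    using line regular_fun_translates_bounded unfolding line_wavelets_def by blast
  note \<phi>_le = translates_bounded_abs_le[OF A]
  have left: "\<bar>left_edge N \<phi>R m x\<bar> \<le> (\<Sum>n=m..2*N-2. \<bar>real (n choose m)\<bar> * A)" for m x
    unfolding left_edge_def
    using \<phi>_le by (rule bounded_lincomb[where H = UNIV and f = "\<lambda>n x. \<phi>R (x + real n - real N + 1)"]) simp
  have right: "\<bar>right_edge N \<phi>R m x\<bar> \<le> (\<Sum>n=m..2*N-2. \<bar>real (n choose m)\<bar> * A)" for m x
    unfolding right_edge_def
    using \<phi>_le by (rule bounded_lincomb[where H = UNIV and f = "\<lambda>n x. \<phi>R (x - real n + real N)"]) simp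
  have bl: "family_bounded N {0..} \<phi>l" and br: "family_bounded N {..0} \<phi>r"
    using orthonormalised_edge_bounded[OF \<phi>l left] orthonormalised_edge_bounded[OF \<phi>r right] by auto
  have dl: "family_bounded N {0..} \<psi>l"
    by (rule edge_wavelets_bounded[OF \<psi>l bl \<phi>_le]) simp
  have dr: "family_bounded N {..0} \<psi>r"
    by (rule edge_wavelets_bounded[OF \<psi>r br \<phi>_le]) simp
  obtain D E where
    D: "\<And>l x. x \<in> {0..1} \<Longrightarrow> (\<Sum>k<2 ^ l. \<bar>interval_fun N \<phi>R \<phi>l \<phi>r l k x\<bar>) \<le> D * 2 powr (real l / 2)"
    and E: "\<And>l x. x \<in> {0..1} \<Longrightarrow> (\<Sum>k<2 ^ l. \<bar>interval_fun N \<psi>R \<psi>l \<psi>r l k x\<bar>) \<le> E * 2 powr (real l / 2)"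
    using sum_abs_interval_fun_le[OF A bl br] sum_abs_interval_fun_le[OF B dl dr] by metis
  show ?thesis
  proof (rule localisedI)
    fix x :: real assume x: "x \<in> {0..1}"
    show "(\<Sum>k<2 ^ J0. \<bar>\<psi> (int J0 - 1) k x\<bar>) \<le> D * 2 powr (real J0 / 2)"
      using D[OF x, of J0] coarse[OF x] by simp
    fix l assume "J0 \<le> l"
    then show "(\<Sum>k<2 ^ l. \<bar>\<psi> (int l) k x\<bar>) \<le> E * 2 powr (real l / 2)"
      using E[OF x, of l] fine[OF x] by simp
  qed
qed

lemma wavelet_basis_localised:
  assumes "wavelet_basis S J0 \<psi>" shows "\<exists>C. localised J0 \<psi> C"
  using assms haar_basis_localised periodised_basis_localised cdv_basis_localised
  unfolding wavelet_basis_def by blast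

section \<open>Orthonormal expansions\<close>

lemma L2_mult_integrable:
  assumes "f \<in> L2 M" "g \<in> L2 M" shows "integrable M (\<lambda>x. f x * g x)"
proof (rule Bochner_Integration.integrable_bound)
  show "integrable M (\<lambda>x. (f x)\<^sup>2 + (g x)\<^sup>2)"
    using assms by (auto simp: L2_def)
  show "(\<lambda>x. f x * g x) \<in> borel_measurable M"
    using assms by (auto simp: L2_def)
  show "AE x in M. norm (f x * g x) \<le> norm ((f x)\<^sup>2 + (g x)\<^sup>2)"
  proof (rule AE_I2)
    fix x
    have "2 * \<bar>f x\<bar> * \<bar>g x\<bar> \<le> (f x)\<^sup>2 + (g x)\<^sup>2"
      using zero_le_power2[of "\<bar>f x\<bar> - \<bar>g x\<bar>"] by (simp add: power2_diff)
    moreover have "0 \<le> \<bar>f x\<bar> * \<bar>g x\<bar>" by simp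
    ultimately have "\<bar>f x\<bar> * \<bar>g x\<bar> \<le> (f x)\<^sup>2 + (g x)\<^sup>2" by linarith
    then show "norm (f x * g x) \<le> norm ((f x)\<^sup>2 + (g x)\<^sup>2)"
      by (simp add: abs_mult)
  qed
qed

lemma L2_diff:
  assumes f: "f \<in> L2 M" and g: "g \<in> L2 M" shows "(\<lambda>x. f x - g x) \<in> L2 M"
proof -
  have "integrable M (\<lambda>x. (f x)\<^sup>2 + (g x)\<^sup>2 - 2 * (f x * g x))"
    using assms by (intro Bochner_Integration.integrable_diff Bochner_Integration.integrable_add
        integrable_mult_right L2_mult_integrable) (auto simp: L2_def)
  then show ?thesis
    using assms by (simp add: L2_def power2_diff mult.assoc borel_measurable_diff)
qed

lemma (in finite_measure) bounded_in_L2: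
  assumes [measurable]: "f \<in> borel_measurable M" and "\<And>x. x \<in> space M \<Longrightarrow> \<bar>f x\<bar> \<le> B"
  shows "f \<in> L2 M"
proof -
  have "integrable M (\<lambda>x. (f x)\<^sup>2)"
  proof (rule integrable_const_bound[where B = "B\<^sup>2"])
    show "AE x in M. norm ((f x)\<^sup>2) \<le> B\<^sup>2"
    proof (rule AE_I2)
      fix x assume "x \<in> space M"
      then have "\<bar>f x\<bar>\<^sup>2 \<le> B\<^sup>2" using assms(2) by (intro power_mono) auto
      then show "norm ((f x)\<^sup>2) \<le> B\<^sup>2" by simp
    qed
  qed simp
  then show ?thesis by (simp add: L2_def)
qed

text \<open>Dominated convergence works along sequences, unordered sums along finite subsets; an
  enumeration of \<open>I\<close> provides a sequence of finite sets that connects the two.\<close>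

lemma filterlim_finite_exhaustion:
  fixes I :: "'i set"
  assumes "countable I"
  shows "filterlim (\<lambda>n. {i \<in> I. to_nat_on I i < n}) (finite_subsets_at_top I) sequentially"
    and "finite {i \<in> I. to_nat_on I i < n}"
proof -
  show fin: "finite {i \<in> I. to_nat_on I i < n}" for n
  proof (rule finite_imageD)
    show "finite (to_nat_on I ` {i \<in> I. to_nat_on I i < n})"
      by (rule finite_subset[of _ "{..<n}"]) auto
    show "inj_on (to_nat_on I) {i \<in> I. to_nat_on I i < n}"
      using inj_on_to_nat_on[OF assms] by (rule inj_on_subset) auto
  qed
  show "filterlim (\<lambda>n. {i \<in> I. to_nat_on I i < n}) (finite_subsets_at_top I) sequentially"
    unfolding filterlim_finite_subsets_at_top
  proof (intro allI impI)
    fix X assume X: "finite X \<and> X \<subseteq> I"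
    have "\<forall>\<^sub>F n in sequentially. \<forall>i\<in>X. to_nat_on I i < n"
      using X by (intro eventually_ball_finite ballI eventually_gt_at_top) auto
    then show "\<forall>\<^sub>F n in sequentially. finite {i \<in> I. to_nat_on I i < n}
        \<and> X \<subseteq> {i \<in> I. to_nat_on I i < n} \<and> {i \<in> I. to_nat_on I i < n} \<subseteq> I"
      by eventually_elim (use X fin in auto)
  qed
qed

text \<open>The sum of the uniformly bounded series is in \<open>L\<^sup>2\<close> and has the coefficients of \<open>h\<close> by
  dominated convergence, so that completeness identifies it with \<open>h\<close>.\<close>

lemma (in finite_measure) orthonormal_series_bound:
  fixes e :: "'i \<Rightarrow> 'a \<Rightarrow> real"
  assumes basis: "orthonormal_basis M I e" and "countable I" and h: "h \<in> L2 M"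
    and bound: "\<And>x F. x \<in> space M \<Longrightarrow> finite F \<Longrightarrow> F \<subseteq> I \<Longrightarrow>
      (\<Sum>i\<in>F. \<bar>(\<integral>y. h y * e i y \<partial>M) * e i x\<bar>) \<le> B"
  shows "AE x in M. \<bar>h x\<bar> \<le> B"
proof -
  define c where "c i = (\<integral>y. h y * e i y \<partial>M)" for i
  define F where "F n = {i \<in> I. to_nat_on I i < n}" for n
  define s where "s x = (\<Sum>\<^sub>\<infinity>i\<in>I. c i * e i x)" for x
  have F: "finite (F n)" "F n \<subseteq> I" for n
    using filterlim_finite_exhaustion(2)[OF \<open>countable I\<close>] by (auto simp: F_def)
  have e: "e i \<in> L2 M" if "i \<in> I" for i
    using basis that by (auto simp: orthonormal_basis_def orthonormal_on_def)
  then have [measurable]: "e i \<in> borel_measurable M" if "i \<in> I" for i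
    using that by (simp add: L2_def)
  have le: "\<bar>\<Sum>i\<in>F n. c i * e i x\<bar> \<le> B" if "x \<in> space M" for n x
    using bound[OF that F, of n] by (intro order_trans[OF sum_abs]) (simp add: c_def)
  have lim: "(\<lambda>n. \<Sum>i\<in>F n. c i * e i x) \<longlonglongrightarrow> s x" if "x \<in> space M" for x
  proof -
    have "(\<lambda>i. c i * e i x) summable_on I"
    proof (rule abs_summable_summable, rule nonneg_bdd_above_summable_on)
      show "bdd_above (sum (\<lambda>i. norm (c i * e i x)) ` {F. F \<subseteq> I \<and> finite F})"
        using bound[OF that] by (intro bdd_aboveI[of _ B]) (auto simp: c_def)
    qed simp
    then have "((\<lambda>F. \<Sum>i\<in>F. c i * e i x) \<longlongrightarrow> s x) (finite_subsets_at_top I)"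
      unfolding s_def by (rule infsum_tendsto)
    then show ?thesis
      unfolding F_def by (rule filterlim_compose) (rule filterlim_finite_exhaustion[OF \<open>countable I\<close>])
  qed
  have S_meas: "(\<lambda>x. \<Sum>i\<in>F n. c i * e i x) \<in> borel_measurable M" for n
    using F(2)[of n] by (intro borel_measurable_sum borel_measurable_times) auto
  have s_meas [measurable]: "s \<in> borel_measurable M"
    by (rule borel_measurable_LIMSEQ_real[OF lim S_meas])
  have s_le: "\<bar>s x\<bar> \<le> B" if "x \<in> space M" for x
    by (rule tendsto_upperbound[OF tendsto_rabs[OF lim[OF that]]]) (use le[OF that] in auto)
  have s: "s \<in> L2 M" using s_meas s_le by (rule bounded_in_L2)
  have "(\<integral>x. s x * e j x \<partial>M) = c j" if j: "j \<in> I" for j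
  proof -
    \<comment> \<open>On a finite measure space constants are square integrable, so
      \<open>B * e j\<close> is an integrable majorant.\<close>
    have const: "(\<lambda>_. B) \<in> L2 M" by (rule bounded_in_L2[where B = "\<bar>B\<bar>"]) auto
    have "(\<lambda>n. \<integral>x. (\<Sum>i\<in>F n. c i * e i x) * e j x \<partial>M) \<longlonglongrightarrow> (\<integral>x. s x * e j x \<partial>M)"
    proof (rule integral_dominated_convergence[where w = "\<lambda>x. \<bar>B * e j x\<bar>"])
      show "integrable M (\<lambda>x. \<bar>B * e j x\<bar>)"
        using L2_mult_integrable[OF const e[OF j]] by (rule Bochner_Integration.integrable_abs)
      show "AE x in M. (\<lambda>n. (\<Sum>i\<in>F n. c i * e i x) * e j x) \<longlonglongrightarrow> s x * e j x"
        by (intro AE_I2 tendsto_mult lim tendsto_const)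
      show "AE x in M. norm ((\<Sum>i\<in>F n. c i * e i x) * e j x) \<le> \<bar>B * e j x\<bar>" for n
        using le by (intro AE_I2) (auto simp: abs_mult intro!: mult_right_mono order_trans[OF le])
    qed (use S_meas j in \<open>auto intro!: borel_measurable_times\<close>)
    moreover have "\<forall>\<^sub>F n in sequentially. (\<integral>x. (\<Sum>i\<in>F n. c i * e i x) * e j x \<partial>M) = c j"
      using eventually_gt_at_top[of "to_nat_on I j"]
    proof eventually_elim
      fix n assume "to_nat_on I j < n"
      then have jF: "j \<in> F n" using j by (simp add: F_def)
      have "(\<integral>x. (\<Sum>i\<in>F n. c i * e i x) * e j x \<partial>M) = (\<integral>x. (\<Sum>i\<in>F n. c i * (e i x * e j x)) \<partial>M)"
        by (simp add: sum_distrib_right mult.assoc)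
      also have "\<dots> = (\<Sum>i\<in>F n. \<integral>x. c i * (e i x * e j x) \<partial>M)"
        using F(2)[of n] j by (intro Bochner_Integration.integral_sum integrable_mult_right L2_mult_integrable e) auto
      also have "\<dots> = (\<Sum>i\<in>F n. c i * (if i = j then 1 else 0))"
        using F(2)[of n] j basis
        by (intro sum.cong) (auto simp: orthonormal_basis_def orthonormal_on_def subset_iff)
      also have "\<dots> = (\<Sum>i\<in>F n. if i = j then c i else 0)"
        by (intro sum.cong) auto
      also have "\<dots> = c j" using jF F(1)[of n] by (simp add: sum.delta')
      finally show "(\<integral>x. (\<Sum>i\<in>F n. c i * e i x) * e j x \<partial>M) = c j" .
    qed
    then have "(\<lambda>n. \<integral>x. (\<Sum>i\<in>F n. c i * e i x) * e j x \<partial>M) \<longlonglongrightarrow> c j"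
      by (rule tendsto_eventually)
    ultimately show ?thesis by (rule LIMSEQ_unique)
  qed
  then have zero: "(\<integral>x. (h x - s x) * e j x \<partial>M) = 0" if "j \<in> I" for j
    using L2_mult_integrable[OF h e[OF that]] L2_mult_integrable[OF s e[OF that]] that
    by (simp add: left_diff_distrib c_def)
  have complete: "\<forall>f\<in>L2 M. (\<forall>i\<in>I. (\<integral>x. f x * e i x \<partial>M) = 0) \<longrightarrow> (AE x in M. f x = 0)"
    using basis unfolding orthonormal_basis_def by (rule conjunct2)
  have "AE x in M. h x - s x = 0"
    by (rule mp[OF bspec[OF complete L2_diff[OF h s]]]) (simp add: zero)
  then show ?thesis
  proof (rule AE_mp, intro AE_I2 impI)
    fix x assume "x \<in> space M" "h x - s x = 0"
    then show "\<bar>h x\<bar> \<le> B" using s_le[of x] by simp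
  qed
qed

text \<open>Expansion of the squared distance between \<open>f\<close> and its finite partial sum,
  which is nonnegative.\<close>

lemma bessel:
  fixes e :: "'i \<Rightarrow> 'a \<Rightarrow> real"
  assumes orth: "orthonormal_on M I e" and f: "f \<in> L2 M" and F: "finite F" "F \<subseteq> I"
  shows "(\<Sum>i\<in>F. (\<integral>x. f x * e i x \<partial>M)\<^sup>2) \<le> (\<integral>x. (f x)\<^sup>2 \<partial>M)"
proof -
  define c where "c i = (\<integral>x. f x * e i x \<partial>M)" for i
  have e: "e i \<in> L2 M" if "i \<in> F" for i
    using orth F that by (auto simp: orthonormal_on_def)
  have ee: "(\<integral>x. e i x * e j x \<partial>M) = (if i = j then 1 else 0)" if "i \<in> F" "j \<in> F" for i j
    using orth F that by (auto simp: orthonormal_on_def subset_iff)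
  have int: "integrable M (\<lambda>x. f x * e i x)" "integrable M (\<lambda>x. e i x * e j x)" if "i \<in> F" "j \<in> F" for i j
    using that f e by (auto intro: L2_mult_integrable)
  have "0 \<le> (\<integral>x. (f x - (\<Sum>i\<in>F. c i * e i x))\<^sup>2 \<partial>M)" by simp
  also have "\<dots> = (\<integral>x. (f x)\<^sup>2 - 2 * (\<Sum>i\<in>F. c i * (f x * e i x))
      + (\<Sum>i\<in>F. \<Sum>j\<in>F. c i * (c j * (e i x * e j x))) \<partial>M)"
  proof (intro Bochner_Integration.integral_cong refl)
    fix x
    have "(\<Sum>i\<in>F. c i * e i x)\<^sup>2 = (\<Sum>i\<in>F. \<Sum>j\<in>F. c i * (c j * (e i x * e j x)))"
      by (simp add: power2_eq_square sum_product mult_ac)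
    moreover have "f x * (\<Sum>i\<in>F. c i * e i x) = (\<Sum>i\<in>F. c i * (f x * e i x))"
      by (simp add: sum_distrib_left mult_ac)
    ultimately show "(f x - (\<Sum>i\<in>F. c i * e i x))\<^sup>2 = (f x)\<^sup>2 - 2 * (\<Sum>i\<in>F. c i * (f x * e i x))
      + (\<Sum>i\<in>F. \<Sum>j\<in>F. c i * (c j * (e i x * e j x)))"
      by (simp add: power2_diff)
  qed
  also have "\<dots> = (\<integral>x. (f x)\<^sup>2 \<partial>M) - 2 * (\<Sum>i\<in>F. c i * c i)
      + (\<Sum>i\<in>F. \<Sum>j\<in>F. c i * (c j * (if i = j then 1 else 0)))"
  proof -
    have i1: "integrable M (\<lambda>x. (f x)\<^sup>2)" using f by (simp add: L2_def)
    have i2: "integrable M (\<lambda>x. \<Sum>i\<in>F. c i * (f x * e i x))" using int by auto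
    have i3: "integrable M (\<lambda>x. \<Sum>i\<in>F. \<Sum>j\<in>F. c i * (c j * (e i x * e j x)))" using int by auto
    have s2: "(\<integral>x. (\<Sum>i\<in>F. c i * (f x * e i x)) \<partial>M) = (\<Sum>i\<in>F. c i * c i)"
      using int by (subst Bochner_Integration.integral_sum) (auto simp: c_def)
    have s3: "(\<integral>x. (\<Sum>i\<in>F. \<Sum>j\<in>F. c i * (c j * (e i x * e j x))) \<partial>M)
        = (\<Sum>i\<in>F. \<Sum>j\<in>F. c i * (c j * (if i = j then 1 else 0)))"
      using int by (subst Bochner_Integration.integral_sum, force)
        (intro sum.cong refl, subst Bochner_Integration.integral_sum, auto simp: ee intro!: sum.cong)
    show ?thesis
      using i1 i2 i3 by (simp add: s2 s3)
  qed
  also have "\<dots> = (\<integral>x. (f x)\<^sup>2 \<partial>M) - (\<Sum>i\<in>F. (c i)\<^sup>2)"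
  proof -
    have "(\<Sum>j\<in>F. c i * (c j * (if i = j then 1 else 0))) = (c i)\<^sup>2" if "i \<in> F" for i
    proof -
      have "(\<Sum>j\<in>F. c i * (c j * (if i = j then 1 else 0))) = (\<Sum>j\<in>F. if i = j then (c i)\<^sup>2 else 0)"
        by (intro sum.cong) (auto simp: power2_eq_square)
      then show ?thesis using that F by simp
    qed
    then show ?thesis by (simp add: power2_eq_square)
  qed
  finally show ?thesis by (simp add: c_def)
qed

lemma space_unit_interval [simp]: "space unit_interval = {0..1}"
  by (simp add: unit_interval_def space_restrict_space)

lemma sets_unit_interval: "sets unit_interval = sets (restrict_space borel {0..1})"
  by (simp add: unit_interval_def sets_restrict_space)

lemma prob_space_unit_interval: "prob_space unit_interval"
  by (rule prob_spaceI) (simp add: unit_interval_def emeasure_restrict_space space_restrict_space)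

lemma continuous_on_in_L2_unit_interval:
  assumes "continuous_on {0..1} f" shows "f \<in> L2 unit_interval"
proof -
  interpret prob_space unit_interval by (rule prob_space_unit_interval)
  obtain B where "\<forall>x\<in>{0..1}. \<bar>f x\<bar> \<le> B"
    using compact_imp_bounded[OF compact_continuous_image[OF assms]] unfolding bounded_iff by auto
  moreover have "f \<in> borel_measurable unit_interval"
    using borel_measurable_continuous_on_restrict[OF assms]
      measurable_cong_sets[OF sets_unit_interval refl] by blast
  ultimately show ?thesis by (intro bounded_in_L2) auto
qed

section \<open>The rate\<close>

text \<open>Injectivity of \<open>h\<close> makes the powers distinct terms of the full geometric
  series; below, \<open>h\<close> is the distance of a level to the resolution level.\<close>

lemma sum_geometric_le:
  fixes q :: real
  assumes "finite L" "inj_on h L" "0 \<le> q" "q < 1"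
  shows "(\<Sum>l\<in>L. q ^ h l) \<le> 1 / (1 - q)"
proof -
  have "(\<Sum>l\<in>L. q ^ h l) = (\<Sum>i\<in>h ` L. q ^ i)"
    using assms by (simp add: sum.reindex)
  also have "\<dots> \<le> (\<Sum>i. q ^ i)"
    using assms by (intro sum_le_suminf summable_geometric) auto
  also have "\<dots> = 1 / (1 - q)"
    using assms by (intro suminf_geometric) auto
  finally show ?thesis .
qed

text \<open>Going down from \<open>j\<close> the first bound decays at least with ratio
  \<open>2 powr (- 1/2)\<close>, as \<open>w\<close> is monotone; going up the second decays with
  ratio \<open>2 powr (- \<gamma>)\<close>, the factor \<open>2 powr (l / 2)\<close> cancelling. The
  denominators are the sums of these two series.\<close>

lemma weighted_level_sum_le:
  fixes m w :: "int \<Rightarrow> real"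
  assumes mono: "mono_on {i..} w" and w: "\<And>l. i \<le> l \<Longrightarrow> 0 \<le> w l"
    and \<gamma>: "0 < \<gamma>" and j: "i \<le> j" and ab: "0 \<le> a" "0 \<le> b" and L: "finite L" "L \<subseteq> {i..}"
    and m: "\<And>l. i \<le> l \<Longrightarrow> m l \<le> a * w l"
      "\<And>l. i \<le> l \<Longrightarrow> m l \<le> b * 2 powr (- (real_of_int l * (\<gamma> + 1/2)))"
  shows "(\<Sum>l\<in>L. m l * 2 powr (real_of_int l / 2))
    \<le> a * w j * 2 powr (real_of_int j / 2) / (1 - 2 powr (- 1/2))
      + b * 2 powr (- (real_of_int j * \<gamma>)) / (1 - 2 powr (- \<gamma>))"
proof -
  have q: "2 powr (- 1/2 :: real) < 1" "2 powr (- \<gamma>) < 1"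
    using powr_less_mono[of "- 1/2" 0 2] powr_less_mono[of "- \<gamma>" 0 2] \<gamma> by auto
  define L1 where "L1 = {l \<in> L. l \<le> j}"
  define L2 where "L2 = {l \<in> L. j < l}"
  have "L = L1 \<union> L2" "L1 \<inter> L2 = {}" "finite L1" "finite L2"
    using L by (auto simp: L1_def L2_def)
  then have "(\<Sum>l\<in>L. m l * 2 powr (real_of_int l / 2))
    = (\<Sum>l\<in>L1. m l * 2 powr (real_of_int l / 2)) + (\<Sum>l\<in>L2. m l * 2 powr (real_of_int l / 2))"
    by (simp add: sum.union_disjoint)
  also have "\<dots> \<le> (\<Sum>l\<in>L1. a * w j * 2 powr (real_of_int j / 2) * (2 powr (- 1/2)) ^ nat (j - l))
     + (\<Sum>l\<in>L2. b * 2 powr (- (real_of_int j * \<gamma>)) * (2 powr (- \<gamma>)) ^ nat (l - j))"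
  proof (intro add_mono sum_mono)
    fix l assume l: "l \<in> L1"
    then have "m l \<le> a * w l" using m L by (auto simp: L1_def)
    also have "\<dots> \<le> a * w j"
      using l L j ab by (intro mult_left_mono mono_onD[OF mono]) (auto simp: L1_def)
    finally have "m l * 2 powr (real_of_int l / 2) \<le> a * w j * 2 powr (real_of_int l / 2)"
      by (intro mult_right_mono) auto
    moreover have "2 powr (real_of_int l / 2) = 2 powr (real_of_int j / 2) * (2 powr (- 1/2)) ^ nat (j - l)"
      using l by (simp add: L1_def powr_realpow[symmetric] powr_powr powr_add[symmetric] field_simps)
    then have "a * w j * 2 powr (real_of_int l / 2)
        = a * w j * 2 powr (real_of_int j / 2) * (2 powr (- 1/2)) ^ nat (j - l)" by simp
    ultimately show "m l * 2 powr (real_of_int l / 2)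
      \<le> a * w j * 2 powr (real_of_int j / 2) * (2 powr (- 1/2)) ^ nat (j - l)"
      by linarith
  next
    fix l assume l: "l \<in> L2"
    then have "m l \<le> b * 2 powr (- (real_of_int l * (\<gamma> + 1/2)))"
      using m L by (auto simp: L2_def)
    then have "m l * 2 powr (real_of_int l / 2)
        \<le> b * 2 powr (- (real_of_int l * (\<gamma> + 1/2))) * 2 powr (real_of_int l / 2)"
      by (intro mult_right_mono) auto
    also have "\<dots> = b * 2 powr (- (real_of_int l * \<gamma>))"
      by (simp add: powr_add[symmetric] algebra_simps)
    also have "2 powr (- (real_of_int l * \<gamma>))
        = 2 powr (- (real_of_int j * \<gamma>)) * (2 powr (- \<gamma>)) ^ nat (l - j)"
      using l by (simp add: L2_def powr_realpow[symmetric] powr_powr powr_add[symmetric] algebra_simps)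
    finally show "m l * 2 powr (real_of_int l / 2)
        \<le> b * 2 powr (- (real_of_int j * \<gamma>)) * (2 powr (- \<gamma>)) ^ nat (l - j)"
      by (simp add: mult.assoc)
  qed
  also have "\<dots> \<le> a * w j * 2 powr (real_of_int j / 2) * (1 / (1 - 2 powr (- 1/2)))
      + b * 2 powr (- (real_of_int j * \<gamma>)) * (1 / (1 - 2 powr (- \<gamma>)))"
    unfolding sum_distrib_left[symmetric] using q ab w[OF j] \<open>finite L1\<close> \<open>finite L2\<close>
    by (intro add_mono mult_left_mono sum_geometric_le)
      (auto simp: inj_on_def L1_def L2_def)
  finally show ?thesis by simp
qed

text \<open>With \<open>y = n / ln n\<close>, the upper half of the \<open>\<Theta>\<close> bound
  controls the noise term and the lower half the bias; the exponents agree because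
  \<open>(p - 1) / 2 = - (p * \<gamma>)\<close> for
  \<open>p = 1 / (2 * \<gamma> + 1)\<close>.\<close>

lemma resolution_level_rate:
  fixes j :: "nat \<Rightarrow> int"
  assumes j: "(\<lambda>n. 2 powr real_of_int (j n)) \<in> \<Theta>(\<lambda>n. (real n / ln (real n)) powr (1 / (2 * \<gamma> + 1)))"
    and \<gamma>: "0 < \<gamma>"
  shows "filterlim j at_top sequentially"
    and "\<exists>C\<ge>0. \<forall>\<^sub>F n in sequentially.
      sqrt (real_of_int (j n)) * 2 powr (real_of_int (j n) / 2) / sqrt (real n)
        \<le> C * (real n / ln (real n)) powr (- \<gamma> / (2 * \<gamma> + 1)) \<and>
      2 powr (- (real_of_int (j n) * \<gamma>)) \<le> C * (real n / ln (real n)) powr (- \<gamma> / (2 * \<gamma> + 1))"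
proof -
  define p where "p = 1 / (2 * \<gamma> + 1)"
  have p: "0 < p" "p < 1" using \<gamma> by (auto simp: p_def)
  have exponent: "p * (- \<gamma>) = - \<gamma> / (2 * \<gamma> + 1)" "(p - 1) / 2 = - \<gamma> / (2 * \<gamma> + 1)"
    using \<gamma> by (auto simp: p_def field_simps)
  define y where "y n = real n / ln (real n)" for n
  have y: "filterlim y at_top sequentially"
    unfolding y_def by real_asymp
  obtain c1 c2 where c: "0 < c1" "0 < c2"
    and lower: "\<forall>\<^sub>F n in sequentially. norm (2 powr real_of_int (j n)) \<ge> c1 * norm (y n powr p)"
    and upper: "\<forall>\<^sub>F n in sequentially. norm (2 powr real_of_int (j n)) \<le> c2 * norm (y n powr p)"
  proof -
    obtain c2 where "0 < c2" "\<forall>\<^sub>F n in sequentially. norm (2 powr real_of_int (j n)) \<le> c2 * norm (y n powr p)"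
      using bigthetaD1[OF j] unfolding y_def p_def by (rule landau_o.bigE)
    moreover obtain c1 where "0 < c1" "\<forall>\<^sub>F n in sequentially. c1 * norm (y n powr p) \<le> norm (2 powr real_of_int (j n))"
      using bigthetaD2[OF j] unfolding y_def p_def by (rule landau_omega.bigE)
    ultimately show thesis using that by blast
  qed
  have "filterlim (\<lambda>n. c1 * y n powr p) at_top sequentially"
    using c p by (intro filterlim_tendsto_pos_mult_at_top[OF tendsto_const] filterlim_compose[OF real_powr_at_top y]) auto
  then have pow: "filterlim (\<lambda>n. 2 powr real_of_int (j n)) at_top sequentially"
    by (rule filterlim_at_top_mono) (use lower in eventually_elim, simp)
  show j_lim: "filterlim j at_top sequentially"
    unfolding filterlim_at_top
  proof
    fix Z :: int
    have "\<forall>\<^sub>F n in sequentially. 2 powr real_of_int Z \<le> 2 powr real_of_int (j n)"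
      using pow unfolding filterlim_at_top by (rule spec)
    then show "\<forall>\<^sub>F n in sequentially. Z \<le> j n" by eventually_elim simp
  qed
  \<comment> \<open>\<open>2 / ln 2\<close> comes from bounding \<open>j n\<close> by a multiple of
    \<open>ln n\<close>, and \<open>c2\<close> from the upper bound on \<open>2 powr j n\<close>;
    both stand under the square root of the noise term.\<close>
  define D where "D = sqrt (2 / ln 2 * c2)"
  define E where "E = c1 powr (- \<gamma>)"
  have "\<forall>\<^sub>F n in sequentially. 1 \<le> y n" "\<forall>\<^sub>F n in sequentially. 1 \<le> j n"
    using y j_lim by (auto simp: filterlim_at_top)
  moreover have "\<forall>\<^sub>F n in sequentially. 1 \<le> ln (real n)" "\<forall>\<^sub>F n in sequentially. max 1 c2 \<le> real n"
    using filterlim_compose[OF ln_at_top filterlim_real_sequentially] filterlim_real_sequentially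
    unfolding filterlim_at_top by blast+
  ultimately have "\<forall>\<^sub>F n in sequentially.
      sqrt (real_of_int (j n)) * 2 powr (real_of_int (j n) / 2) / sqrt (real n)
        \<le> D * y n powr (- \<gamma> / (2 * \<gamma> + 1)) \<and>
      2 powr (- (real_of_int (j n) * \<gamma>)) \<le> E * y n powr (- \<gamma> / (2 * \<gamma> + 1))"
    using lower upper
  proof eventually_elim
    fix n
    let ?j = "real_of_int (j n)"
    assume y1: "1 \<le> y n" and j1: "1 \<le> j n" and ln1: "1 \<le> ln (real n)" and n: "max 1 c2 \<le> real n"
      and lo: "c1 * norm (y n powr p) \<le> norm (2 powr ?j)"
      and up: "norm (2 powr ?j) \<le> c2 * norm (y n powr p)"
    have n_pos: "0 < real n" using n by simp
    have "y n powr p \<le> y n powr 1" using y1 p by (intro powr_mono) auto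
    also have "\<dots> = y n" using y1 by simp
    also have "y n \<le> real n" using ln1 n_pos by (simp add: y_def divide_le_eq mult_left_le)
    finally have yn: "y n powr p \<le> real n" .
    \<comment> \<open>A crude polynomial bound is enough for \<open>j n\<close> to be logarithmic in
      \<open>n\<close>; the second factor \<open>n\<close> merely absorbs \<open>c2\<close>.\<close>
    have "2 powr ?j \<le> c2 * y n powr p" using up by simp
    also have "\<dots> \<le> real n * real n" using yn n c by (intro mult_mono) auto
    finally have "ln (2 powr ?j) \<le> ln (real n * real n)" using n_pos by (subst ln_le_cancel_iff) auto
    then have "?j * ln 2 \<le> 2 * ln (real n)"
      using n_pos by (simp add: ln_powr ln_mult)
    then have jn: "?j \<le> 2 / ln 2 * ln (real n)" by (simp add: field_simps)
    have "?j * 2 powr ?j / real n \<le> (2 / ln 2 * ln (real n)) * (c2 * y n powr p) / real n"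
      using jn up j1 n_pos ln1 by (intro divide_right_mono mult_mono) auto
    \<comment> \<open>Here the logarithm from \<open>j n\<close> is absorbed:
      \<open>ln n / n\<close> is the reciprocal of \<open>y n\<close>.\<close>
    also have "\<dots> = (2 / ln 2 * c2) * (y n powr p / y n)"
      using ln1 by (simp add: y_def)
    also have "y n powr p / y n = y n powr (p - 1)"
      using y1 by (simp add: powr_diff)
    finally have "sqrt (?j * 2 powr ?j / real n) \<le> sqrt ((2 / ln 2 * c2) * y n powr (p - 1))"
      by (rule real_sqrt_le_mono)
    also have "\<dots> = D * sqrt (y n powr (p - 1))"
      unfolding D_def by (rule real_sqrt_mult)
    also have "sqrt (y n powr (p - 1)) = y n powr ((p - 1) / 2)"
      by (simp add: powr_half_sqrt[symmetric] powr_powr)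
    finally have 1: "sqrt ?j * 2 powr (?j / 2) / sqrt (real n) \<le> D * y n powr (- \<gamma> / (2 * \<gamma> + 1))"
      unfolding exponent(2)[symmetric]
      by (simp add: real_sqrt_mult real_sqrt_divide powr_half_sqrt[symmetric] powr_powr)
    have "2 powr (- (?j * \<gamma>)) = (2 powr ?j) powr (- \<gamma>)" by (simp add: powr_powr)
    also have "\<dots> \<le> (c1 * y n powr p) powr (- \<gamma>)"
      using lo c y1 \<gamma> by (intro powr_mono2') (auto intro!: mult_pos_pos)
    also have "\<dots> = E * y n powr (- \<gamma> / (2 * \<gamma> + 1))"
      using c unfolding exponent(1)[symmetric] by (simp add: powr_mult powr_powr E_def)
    finally have 2: "2 powr (- (?j * \<gamma>)) \<le> E * y n powr (- \<gamma> / (2 * \<gamma> + 1))" .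
    show "sqrt ?j * 2 powr (?j / 2) / sqrt (real n) \<le> D * y n powr (- \<gamma> / (2 * \<gamma> + 1)) \<and>
      2 powr (- (?j * \<gamma>)) \<le> E * y n powr (- \<gamma> / (2 * \<gamma> + 1))"
      using 1 2 by blast
  qed
  then have "\<forall>\<^sub>F n in sequentially.
      sqrt (real_of_int (j n)) * 2 powr (real_of_int (j n) / 2) / sqrt (real n)
        \<le> max D E * y n powr (- \<gamma> / (2 * \<gamma> + 1)) \<and>
      2 powr (- (real_of_int (j n) * \<gamma>)) \<le> max D E * y n powr (- \<gamma> / (2 * \<gamma> + 1))"
    by eventually_elim (meson max.cobounded1 max.cobounded2 mult_right_mono order_trans powr_ge_zero)
  moreover have "0 \<le> max D E" by (rule max.coboundedI2) (simp add: E_def)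
  ultimately show "\<exists>C\<ge>0. \<forall>\<^sub>F n in sequentially.
      sqrt (real_of_int (j n)) * 2 powr (real_of_int (j n) / 2) / sqrt (real n)
        \<le> C * (real n / ln (real n)) powr (- \<gamma> / (2 * \<gamma> + 1)) \<and>
      2 powr (- (real_of_int (j n) * \<gamma>)) \<le> C * (real n / ln (real n)) powr (- \<gamma> / (2 * \<gamma> + 1))"
    unfolding y_def by blast
qed

section \<open>Credible bands\<close>

lemma wav_coeffs_in_ell2:
  assumes "wavelet_basis S J0 \<psi>" "f \<in> L2 unit_interval"
  shows "wav_coeffs J0 \<psi> f \<in> ell2 J0"
proof -
  have orth: "orthonormal_on unit_interval (wav_index J0) (\<lambda>(l, k). \<psi> l k)"
    using assms by (auto simp: wavelet_basis_def orthonormal_basis_def)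
  have eq: "(wav_coeffs J0 \<psi> f i)\<^sup>2 = (\<integral>x. f x * (case i of (l, k) \<Rightarrow> \<psi> l k) x \<partial>unit_interval)\<^sup>2"
    if "i \<in> wav_index J0" for i
    using that by (cases i) (simp add: wav_coeffs_def)
  have "(\<lambda>i. (wav_coeffs J0 \<psi> f i)\<^sup>2) summable_on wav_index J0"
  proof (rule nonneg_bdd_above_summable_on)
    show "bdd_above (sum (\<lambda>i. (wav_coeffs J0 \<psi> f i)\<^sup>2) ` {F. F \<subseteq> wav_index J0 \<and> finite F})"
    proof (intro bdd_aboveI2)
      fix F assume F: "F \<in> {F. F \<subseteq> wav_index J0 \<and> finite F}"
      then have "(\<Sum>i\<in>F. (wav_coeffs J0 \<psi> f i)\<^sup>2)
          = (\<Sum>i\<in>F. (\<integral>x. f x * (case i of (l, k) \<Rightarrow> \<psi> l k) x \<partial>unit_interval)\<^sup>2)"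
        by (intro sum.cong refl eq) auto
      also have "\<dots> \<le> (\<integral>x. (f x)\<^sup>2 \<partial>unit_interval)"
        using F by (intro bessel[OF orth assms(2)]) auto
      finally show "(\<Sum>i\<in>F. (wav_coeffs J0 \<psi> f i)\<^sup>2) \<le> (\<integral>x. (f x)\<^sup>2 \<partial>unit_interval)" .
    qed
  qed simp
  then show ?thesis by (simp add: ell2_def wav_coeffs_def)
qed

text \<open>Grouping the expansion by levels, localisation turns the sum over positions into
  \<open>C * 2 powr (l / 2)\<close>. Finite sets of levels suffice since the series bound concerns
  finite partial sums.\<close>

lemma Linf_norm_le_level_sum:
  assumes basis: "wavelet_basis S J0 \<psi>" and loc: "localised J0 \<psi> C" and h: "h \<in> L2 unit_interval"
    and coeff: "\<And>l k. (l, k) \<in> wav_index J0 \<Longrightarrow> \<bar>wav_coeffs J0 \<psi> h (l, k)\<bar> \<le> m l"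
    and sum: "\<And>L. finite L \<Longrightarrow> L \<subseteq> {int J0 - 1..} \<Longrightarrow> (\<Sum>l\<in>L. m l * 2 powr (real_of_int l / 2)) \<le> B"
  shows "Linf_norm h \<le> ennreal (C * B)"
proof -
  interpret prob_space unit_interval by (rule prob_space_unit_interval)
  let ?e = "\<lambda>i::int \<times> nat. case i of (l, k) \<Rightarrow> \<psi> l k"
  have m: "0 \<le> m l" if "int J0 - 1 \<le> l" for l
    using coeff[of l 0] that by (auto simp: wav_index_def intro: order_trans[OF abs_ge_zero])
  have "AE x in unit_interval. \<bar>h x\<bar> \<le> C * B"
  proof (rule orthonormal_series_bound[OF _ countable_wav_index h])
    show "orthonormal_basis unit_interval (wav_index J0) ?e"
      using basis by (simp add: wavelet_basis_def)
    fix x F assume x: "x \<in> space unit_interval" and F: "finite F" "F \<subseteq> wav_index J0"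
    \<comment> \<open>The finite index set is enlarged to complete levels, because localisation
      bounds only sums over whole levels.\<close>
    have F': "F \<subseteq> (SIGMA l:fst ` F. {..<level_size J0 l})"
      using F(2) by (force simp: wav_index_def)
    have "(\<Sum>i\<in>F. \<bar>(\<integral>y. h y * ?e i y \<partial>unit_interval) * ?e i x\<bar>)
        \<le> (\<Sum>i\<in>F. m (fst i) * \<bar>\<psi> (fst i) (snd i) x\<bar>)"
    proof (rule sum_mono)
      fix i assume "i \<in> F"
      then obtain l k where i: "i = (l, k)" "(l, k) \<in> wav_index J0" using F by (cases i) auto
      then have "\<bar>\<integral>y. h y * ?e i y \<partial>unit_interval\<bar> \<le> m l"
        using coeff[of l k] by (simp add: wav_coeffs_def)
      then show "\<bar>(\<integral>y. h y * ?e i y \<partial>unit_interval) * ?e i x\<bar> \<le> m (fst i) * \<bar>\<psi> (fst i) (snd i) x\<bar>"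
        using i by (simp add: abs_mult mult_right_mono)
    qed
    also have "\<dots> \<le> (\<Sum>i\<in>(SIGMA l:fst ` F. {..<level_size J0 l}). m (fst i) * \<bar>\<psi> (fst i) (snd i) x\<bar>)"
      using F F' m by (intro sum_mono2) (auto simp: wav_index_def intro!: mult_nonneg_nonneg)
    also have "\<dots> = (\<Sum>l\<in>fst ` F. m l * (\<Sum>k<level_size J0 l. \<bar>\<psi> l k x\<bar>))"
      unfolding sum_distrib_left using F(1) by (subst sum.Sigma) (auto simp: split_beta)
    also have "\<dots> \<le> (\<Sum>l\<in>fst ` F. m l * (C * 2 powr (real_of_int l / 2)))"
      using loc m F(2) x by (intro sum_mono mult_left_mono) (auto simp: localised_def wav_index_def)
    also have "\<dots> = C * (\<Sum>l\<in>fst ` F. m l * 2 powr (real_of_int l / 2))"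
      by (simp add: sum_distrib_left mult_ac)
    also have "\<dots> \<le> C * B"
      using F loc by (intro mult_left_mono sum) (auto simp: wav_index_def localised_def)
    finally show "(\<Sum>i\<in>F. \<bar>(\<integral>y. h y * ?e i y \<partial>unit_interval) * ?e i x\<bar>) \<le> C * B" .
  qed
  moreover have "(\<lambda>x. ennreal \<bar>h x\<bar>) \<in> borel_measurable unit_interval"
    using h by (auto simp: L2_def intro!: measurable_compose[OF borel_measurable_abs measurable_ennreal])
  ultimately show ?thesis
    unfolding Linf_norm_def by (intro esssup_I) (auto elim!: eventually_mono intro: ennreal_leI)
qed

lemma wav_coeffs_diff:
  assumes basis: "wavelet_basis S J0 \<psi>" and fg: "f \<in> L2 unit_interval" "g \<in> L2 unit_interval"
    and i: "(l, k) \<in> wav_index J0"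
  shows "wav_coeffs J0 \<psi> (\<lambda>x. f x - g x) (l, k) = wav_coeffs J0 \<psi> f (l, k) - wav_coeffs J0 \<psi> g (l, k)"
proof -
  have "\<psi> l k \<in> L2 unit_interval"
    using basis i unfolding wavelet_basis_def orthonormal_basis_def orthonormal_on_def by fastforce
  then show ?thesis
    using i fg[THEN L2_mult_integrable] by (simp add: wav_coeffs_def left_diff_distrib)
qed

text \<open>For two elements of the band the centre \<open>t\<close> cancels, which gives twice the
  radius bound, and the smoothness constraint gives twice the other. Their minimum \<open>?m\<close>
  satisfies both hypotheses of the level sum, and the random radius is replaced by the constant
  \<open>M\<close>.\<close>

lemma sup_diameter_credible_band_le:
  assumes basis: "wavelet_basis S J0 \<psi>" and loc: "localised J0 \<psi> C"
    and adm: "admissible J0 w" and \<gamma>: "0 < \<gamma>" and j: "int J0 - 1 \<le> j" and n: "1 \<le> n"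
    and u: "0 \<le> u" and r: "r \<le> M" "0 \<le> M"
  shows "sup_diameter J0 \<psi> (credible_band J0 w \<gamma> n t r u)
    \<le> ennreal (C * (2 * M / sqrt (real n) * w j * 2 powr (real_of_int j / 2) / (1 - 2 powr (- 1/2))
        + 2 * u * 2 powr (- (real_of_int j * \<gamma>)) / (1 - 2 powr (- \<gamma>))))"
  unfolding sup_diameter_def
proof (rule SUP_least, clarify)
  fix f g
  assume f: "f \<in> L2 unit_interval" and g: "g \<in> L2 unit_interval"
    and band: "wav_coeffs J0 \<psi> f \<in> credible_band J0 w \<gamma> n t r u"
      "wav_coeffs J0 \<psi> g \<in> credible_band J0 w \<gamma> n t r u"
  interpret weight J0 w using adm by unfold_locales (simp add: admissible_def)
  let ?m = "\<lambda>l. min (2 * M / sqrt (real n) * w l) (2 * u * 2 powr (- (real_of_int l * (\<gamma> + 1/2))))"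
  have near: "\<bar>x (l, k) - t (l, k)\<bar> \<le> M / sqrt (real n) * w l"
    and smooth: "\<bar>x (l, k)\<bar> \<le> u * 2 powr (- (real_of_int l * (\<gamma> + 1/2)))"
    if x: "x \<in> credible_band J0 w \<gamma> n t r u" and i: "(l, k) \<in> wav_index J0" for x l k
  proof -
    have "\<bar>x (l, k) - t (l, k)\<bar> / w l \<le> r / sqrt (real n)"
      using x i by (auto simp: credible_band_def credible_set_def SUP_le_iff)
    also have "\<dots> \<le> M / sqrt (real n)" using r by (simp add: divide_right_mono)
    finally show "\<bar>x (l, k) - t (l, k)\<bar> \<le> M / sqrt (real n) * w l"
      using weight_pos[OF i] by (simp add: divide_le_eq)
    have "2 powr (real_of_int l * (\<gamma> + 1/2)) * \<bar>x (l, k)\<bar> \<le> u"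
      using x i by (auto simp: credible_band_def C_norm_def SUP_le_iff)
    then show "\<bar>x (l, k)\<bar> \<le> u * 2 powr (- (real_of_int l * (\<gamma> + 1/2)))"
      unfolding powr_minus_divide by (simp add: pos_le_divide_eq mult.commute)
  qed
  show "Linf_norm (\<lambda>x. f x - g x)
    \<le> ennreal (C * (2 * M / sqrt (real n) * w j * 2 powr (real_of_int j / 2) / (1 - 2 powr (- 1/2))
        + 2 * u * 2 powr (- (real_of_int j * \<gamma>)) / (1 - 2 powr (- \<gamma>))))"
  proof (rule Linf_norm_le_level_sum[OF basis loc L2_diff[OF f g], where m = ?m])
    fix l k assume i: "(l, k) \<in> wav_index J0"
    show "\<bar>wav_coeffs J0 \<psi> (\<lambda>x. f x - g x) (l, k)\<bar> \<le> ?m l"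
      unfolding wav_coeffs_diff[OF basis f g i]
      using near[OF band(1) i] near[OF band(2) i] smooth[OF band(1) i] smooth[OF band(2) i]
      by (intro min.boundedI) linarith+
  next
    fix L assume "finite L" "L \<subseteq> {int J0 - 1..}"
    then show "(\<Sum>l\<in>L. ?m l * 2 powr (real_of_int l / 2))
      \<le> 2 * M / sqrt (real n) * w j * 2 powr (real_of_int j / 2) / (1 - 2 powr (- 1/2))
        + 2 * u * 2 powr (- (real_of_int j * \<gamma>)) / (1 - 2 powr (- \<gamma>))"
      using adm \<gamma> j u r
      by (intro weighted_level_sum_le[where i = "int J0 - 1"])
        (auto simp: admissible_def intro: order_trans[OF zero_le_one])
  qed
qed

lemma outer_prob_le:
  assumes "A \<subseteq> B" "B \<in> sets P" shows "outer_prob P A \<le> emeasure P B"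
  unfolding outer_prob_def using assms by (intro INF_lower) auto

lemma (in credible_setting) band_conclusion:
  fixes j :: "nat \<Rightarrow> int"
  assumes basis: "wavelet_basis S J0 \<psi>" and adm: "admissible J0 w" and \<gamma>: "0 < \<gamma>"
    and \<theta>: "C_norm J0 \<gamma> \<theta> < \<infinity>"
    and j: "(\<lambda>n. 2 powr real_of_int (j n)) \<in> \<Theta>(\<lambda>n. (real n / ln (real n)) powr (1 / (2 * \<gamma> + 1)))"
    and u: "\<And>n. u n = w (j n) / sqrt (real_of_int (j n))"
  shows "(\<lambda>n. measure (P n) {x \<in> space (P n). \<theta> \<in> credible_band J0 w \<gamma> n (T n x) (R n x) (u n)})
          \<longlonglongrightarrow> 1 - \<alpha>"
    and "bigO_in_prob P
          (\<lambda>n x. sup_diameter J0 \<psi> (credible_band J0 w \<gamma> n (T n x) (R n x) (u n)))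
          (\<lambda>n. (real n / ln (real n)) powr (- \<gamma> / (2 * \<gamma> + 1)) * u n)"
proof -
  have j_lim: "filterlim j at_top sequentially"
    by (rule resolution_level_rate(1)[OF j \<gamma>])
  have u_lim: "filterlim u at_top sequentially"
    unfolding u using adm by (intro filterlim_compose[OF _ j_lim]) (simp add: admissible_def)
  obtain c where c: "C_norm J0 \<gamma> \<theta> \<le> ereal c"
    using \<theta> by (cases "C_norm J0 \<gamma> \<theta>") auto
  have "\<forall>\<^sub>F n in sequentially. c \<le> u n"
    using u_lim unfolding filterlim_at_top by blast
  then have "\<forall>\<^sub>F n in sequentially.
      measure (P n) {x \<in> space (P n). \<theta> \<in> credible_set J0 w n (T n x) (R n x)}
      = measure (P n) {x \<in> space (P n). \<theta> \<in> credible_band J0 w \<gamma> n (T n x) (R n x) (u n)}"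
  proof eventually_elim
    fix n assume "c \<le> u n"
    then have "C_norm J0 \<gamma> \<theta> \<le> ereal (u n)" using c by (meson ereal_less_eq(3) order_trans)
    then show "measure (P n) {x \<in> space (P n). \<theta> \<in> credible_set J0 w n (T n x) (R n x)}
      = measure (P n) {x \<in> space (P n). \<theta> \<in> credible_band J0 w \<gamma> n (T n x) (R n x) (u n)}"
      by (simp add: credible_band_def)
  qed
  then show "(\<lambda>n. measure (P n) {x \<in> space (P n). \<theta> \<in> credible_band J0 w \<gamma> n (T n x) (R n x) (u n)})
          \<longlonglongrightarrow> 1 - \<alpha>"
    by (rule Lim_transform_eventually[OF coverage])
  define \<rho> where "\<rho> n = (real n / ln (real n)) powr (- \<gamma> / (2 * \<gamma> + 1))" for n
  obtain M0 where M0: "(\<lambda>n. measure (P n) {x \<in> space (P n). M0 \<le> R n x}) \<longlonglongrightarrow> 0"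
    by (rule radius_bounded_in_prob)
  \<comment> \<open>Truncation at 0 supplies the nonnegative radius bound that the diameter estimate
    asks for.\<close>
  define M where "M = max 0 M0"
  obtain C where loc: "localised J0 \<psi> C" using wavelet_basis_localised[OF basis] by blast
  obtain D where D: "0 \<le> D" and rate: "\<forall>\<^sub>F n in sequentially.
      sqrt (real_of_int (j n)) * 2 powr (real_of_int (j n) / 2) / sqrt (real n) \<le> D * \<rho> n \<and>
      2 powr (- (real_of_int (j n) * \<gamma>)) \<le> D * \<rho> n"
    using resolution_level_rate(2)[OF j \<gamma>] unfolding \<rho>_def by blast
  define a where "a = 2 * M / (1 - 2 powr (- 1/2))"
  define b where "b = 2 / (1 - 2 powr (- \<gamma>))"
  have "0 \<le> a" "0 \<le> b"
    using powr_less_mono[of "- 1/2" 0 2] powr_less_mono[of "- \<gamma>" 0 2] \<gamma>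
    by (auto simp: a_def b_def M_def)
  \<comment> \<open>The added 1 makes the constant strictly positive, as \<open>bigO_in_prob\<close>
    demands. It does not depend on \<open>\<epsilon>\<close>: exceeding the fixed threshold
    \<open>M0\<close> has vanishing probability.\<close>
  define E where "E = C * (a + b) * D + 1"
  have "0 \<le> C" using loc by (simp add: localised_def)
  then have "0 < E" using \<open>0 \<le> a\<close> \<open>0 \<le> b\<close> D unfolding E_def by (intro add_nonneg_pos mult_nonneg_nonneg) auto
  have "\<forall>\<^sub>F n in sequentially. \<forall>x. R n x \<le> M \<longrightarrow>
      sup_diameter J0 \<psi> (credible_band J0 w \<gamma> n (T n x) (R n x) (u n)) \<le> ennreal (E * (\<rho> n * u n))"
  proof -
    have "\<forall>\<^sub>F n in sequentially. max 1 (int J0 - 1) \<le> j n"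
      using j_lim unfolding filterlim_at_top by blast
    then show ?thesis
      using rate eventually_ge_at_top[of 1]
    proof eventually_elim
      fix n :: nat
      let ?j = "real_of_int (j n)"
      assume jn: "max 1 (int J0 - 1) \<le> j n" and n: "1 \<le> n"
        and bounds: "sqrt ?j * 2 powr (?j / 2) / sqrt (real n) \<le> D * \<rho> n \<and> 2 powr (- (?j * \<gamma>)) \<le> D * \<rho> n"
      have w_eq: "w (j n) = u n * sqrt ?j" using jn by (simp add: u)
      have u_pos: "0 \<le> u n" using weight_ge_1[of "j n"] jn by (simp add: u)
      have "C * (2 * M / sqrt (real n) * w (j n) * 2 powr (?j / 2) / (1 - 2 powr (- 1/2))
          + 2 * u n * 2 powr (- (?j * \<gamma>)) / (1 - 2 powr (- \<gamma>)))
        = C * (a * (u n * (sqrt ?j * 2 powr (?j / 2) / sqrt (real n))) + b * (u n * 2 powr (- (?j * \<gamma>))))"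
        by (simp add: a_def b_def w_eq mult_ac)
      also have "\<dots> \<le> C * (a * (u n * (D * \<rho> n)) + b * (u n * (D * \<rho> n)))"
        using bounds \<open>0 \<le> C\<close> \<open>0 \<le> a\<close> \<open>0 \<le> b\<close> u_pos by (intro mult_left_mono add_mono) auto
      also have "\<dots> = C * (a + b) * D * (\<rho> n * u n)" by (simp add: algebra_simps)
      also have "\<dots> \<le> E * (\<rho> n * u n)"
        using u_pos unfolding E_def by (intro mult_right_mono) (auto simp: \<rho>_def)
      finally have le: "ennreal (C * (2 * M / sqrt (real n) * w (j n) * 2 powr (?j / 2) / (1 - 2 powr (- 1/2))
          + 2 * u n * 2 powr (- (?j * \<gamma>)) / (1 - 2 powr (- \<gamma>)))) \<le> ennreal (E * (\<rho> n * u n))"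
        by (rule ennreal_leI)
      show "\<forall>x. R n x \<le> M \<longrightarrow>
          sup_diameter J0 \<psi> (credible_band J0 w \<gamma> n (T n x) (R n x) (u n)) \<le> ennreal (E * (\<rho> n * u n))"
        using jn u_pos n
        by (intro allI impI order_trans[OF sup_diameter_credible_band_le[OF basis loc adm \<gamma>] le])
          (auto simp: M_def)
    qed
  qed
  note diameter = this
  have "\<forall>\<^sub>F n in sequentially. outer_prob (P n) {x \<in> space (P n).
      sup_diameter J0 \<psi> (credible_band J0 w \<gamma> n (T n x) (R n x) (u n)) > ennreal (E * (\<rho> n * u n))} \<le> ennreal \<epsilon>"
    if "0 < \<epsilon>" for \<epsilon>
    using diameter order_tendstoD(2)[OF M0 that] eventually_ge_at_top[of 1]
  proof eventually_elim
    fix n :: nat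
    let ?A = "{x \<in> space (P n).
      sup_diameter J0 \<psi> (credible_band J0 w \<gamma> n (T n x) (R n x) (u n)) > ennreal (E * (\<rho> n * u n))}"
    assume le: "\<forall>x. R n x \<le> M \<longrightarrow>
          sup_diameter J0 \<psi> (credible_band J0 w \<gamma> n (T n x) (R n x) (u n)) \<le> ennreal (E * (\<rho> n * u n))"
      and small: "measure (P n) {x \<in> space (P n). M0 \<le> R n x} < \<epsilon>" and n: "1 \<le> n"
    interpret prob_space "P n" by (rule prob_P)
    note [measurable] = R_measurable[OF n]
    \<comment> \<open>A diameter above the bound forces the radius above \<open>M\<close>; the
      measurable event on the right therefore covers the bad set and bounds its outer
      probability.\<close>
    have "x \<in> {x \<in> space (P n). M0 \<le> R n x}" if "x \<in> ?A" for x
      using le[rule_format, of x] that by (force simp: M_def not_le[symmetric])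
    then have "outer_prob (P n) ?A \<le> emeasure (P n) {x \<in> space (P n). M0 \<le> R n x}"
      by (intro outer_prob_le) auto
    also have "\<dots> \<le> ennreal \<epsilon>"
      using small by (simp add: emeasure_eq_measure ennreal_leI)
    finally show "outer_prob (P n) ?A \<le> ennreal \<epsilon>" .
  qed
  then show "bigO_in_prob P
          (\<lambda>n x. sup_diameter J0 \<psi> (credible_band J0 w \<gamma> n (T n x) (R n x) (u n)))
          (\<lambda>n. (real n / ln (real n)) powr (- \<gamma> / (2 * \<gamma> + 1)) * u n)"
    unfolding bigO_in_prob_def \<rho>_def using \<open>0 < E\<close> by blast
qed

text \<open>On \<open>M0\<close> the supremum defining the norm is attained, so that a sphere is contained in a
  countable union of coordinate level sets.\<close>

lemma (in weight) M_nrm_attained: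
  assumes x: "M_vanishing x" and t: "0 < t" "M_nrm J0 w x = t"
  obtains l k where "(l, k) \<in> wav_index J0" "\<bar>x (l, k)\<bar> = t * w l"
proof (rule ccontr)
  assume "\<not> thesis"
  then have ne: "\<bar>x (l, k)\<bar> \<noteq> t * w l" if "(l, k) \<in> wav_index J0" for l k
    using that \<open>\<And>l k. (l, k) \<in> wav_index J0 \<Longrightarrow> \<bar>x (l, k)\<bar> = t * w l \<Longrightarrow> thesis\<close> by blast
  have less: "\<bar>x (l, k)\<bar> / w l < t" if i: "(l, k) \<in> wav_index J0" for l k
  proof -
    have "\<bar>x (l, k)\<bar> \<le> t * w l" using abs_le_M_nrm[OF x i] t by simp
    with ne[OF i] show ?thesis using weight_pos[OF i] by (simp add: divide_less_eq)
  qed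
  obtain L where L: "\<And>l k. (l, k) \<in> wav_index J0 \<Longrightarrow> L \<le> l \<Longrightarrow> \<bar>x (l, k)\<bar> \<le> t / 2 * w l"
    using x t unfolding M_vanishing_def by (meson half_gt_zero)
  let ?I = "{(l, k) \<in> wav_index J0. l < L}"
  \<comment> \<open>Below level \<open>L\<close> there are finitely many quotients, each strictly
    less than \<open>t\<close>, and the tail stays below \<open>t / 2\<close>. Their maximum is thus
    a norm bound strictly below \<open>t\<close>.\<close>
  define s where "s = Max (insert (t / 2) ((\<lambda>(l, k). \<bar>x (l, k)\<bar> / w l) ` ?I))"
  have fin: "finite (insert (t / 2) ((\<lambda>(l, k). \<bar>x (l, k)\<bar> / w l) ` ?I))"
    using finite_wav_index_below by blast
  have "s < t" unfolding s_def using fin less t by (subst Max_less_iff) auto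
  moreover have "\<bar>x (l, k)\<bar> \<le> s * w l" if i: "(l, k) \<in> wav_index J0" for l k
  proof (cases "L \<le> l")
    case True
    have "t / 2 \<le> s" unfolding s_def using fin by (intro Max_ge) auto
    then have "t / 2 * w l \<le> s * w l" using weight_pos[OF i] by (intro mult_right_mono) auto
    then show ?thesis using L[OF i True] by linarith
  next
    case False
    then have "\<bar>x (l, k)\<bar> / w l \<le> s" unfolding s_def using fin i by (intro Max_ge) force+
    then show ?thesis using weight_pos[OF i] by (simp add: divide_le_eq)
  qed
  then have "M_nrm J0 w x \<le> s" using M_nrm_le_iff[OF x] by blast
  ultimately show False using t by simp
qed

text \<open>For positive \<open>t\<close> the hyperplanes sit at \<open>t * w l\<close> and
  \<open>- (t * w l)\<close>, away from 0. For \<open>t = 0\<close> the sphere lies in every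
  hyperplane through 0, and one null hyperplane \<open>i0\<close> is enough; a degenerate coordinate
  could not serve there.\<close>

lemma (in weight) sphere_null:
  assumes N: "prob_space N" "sets N = sets (M0_borel J0 w)"
    and nonzero: "\<And>i c. i \<in> wav_index J0 \<Longrightarrow> c \<noteq> 0 \<Longrightarrow> measure N {x \<in> M0 J0 w. x i = c} = 0"
    and zero: "i0 \<in> wav_index J0" "measure N {x \<in> M0 J0 w. x i0 = 0} = 0"
    and "0 \<le> t"
  shows "measure N {x \<in> M0 J0 w. M_nrm J0 w x = t} = 0"
proof -
  interpret prob_space N by (rule N)
  have level: "{x \<in> M0 J0 w. x i = c} \<in> sets N" if "i \<in> wav_index J0" for i c
  proof -
    note [measurable] = coordinate_measurable[OF that]
    show ?thesis unfolding N(2) space_M0_borel[symmetric] by measurable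
  qed
  have null: "{x \<in> M0 J0 w. x i = c} \<in> null_sets N" if "i \<in> wav_index J0" "c \<noteq> 0 \<or> i = i0 \<and> c = 0" for i c
    using that level[of i c] nonzero[of i c] zero by (auto simp: null_sets_def emeasure_eq_measure)
  have "{x \<in> M0 J0 w. M_nrm J0 w x = t} \<in> null_sets N"
  proof (cases "t = 0")
    case True
    have "x i0 = 0" if "x \<in> M0 J0 w" "M_nrm J0 w x = 0" for x
      using abs_le_M_nrm[of x "fst i0" "snd i0"] that zero(1) by (simp add: M0_iff)
    then have "{x \<in> M0 J0 w. M_nrm J0 w x = t} \<subseteq> {x \<in> M0 J0 w. x i0 = 0}" using True by auto
    moreover have "{x \<in> M0 J0 w. M_nrm J0 w x = t} \<in> sets N"
      unfolding N(2) space_M0_borel[symmetric] by measurable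
    ultimately show ?thesis using null[OF zero(1)] null_sets_subset by blast
  next
    case False
    then have "0 < t" using \<open>0 \<le> t\<close> by simp
    let ?U = "\<Union>i\<in>wav_index J0. {x \<in> M0 J0 w. x i = t * w (fst i)} \<union> {x \<in> M0 J0 w. x i = - (t * w (fst i))}"
    have "?U \<in> null_sets N"
    proof (intro null_sets_UN' countable_wav_index null_sets.Un null)
      fix i assume "i \<in> wav_index J0"
      then have "0 < t * w (fst i)" using weight_pos[of "fst i" "snd i"] \<open>0 < t\<close> by simp
      then show "t * w (fst i) \<noteq> 0 \<or> i = i0 \<and> t * w (fst i) = 0"
        "- (t * w (fst i)) \<noteq> 0 \<or> i = i0 \<and> - (t * w (fst i)) = 0" by auto
    qed
    moreover have "{x \<in> M0 J0 w. M_nrm J0 w x = t} \<subseteq> ?U"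
    proof
      fix x assume x: "x \<in> {x \<in> M0 J0 w. M_nrm J0 w x = t}"
      then obtain l k where "(l, k) \<in> wav_index J0" "\<bar>x (l, k)\<bar> = t * w l"
        using M_nrm_attained[of x t] \<open>0 < t\<close> by (auto simp: M0_iff)
      then show "x \<in> ?U" using x by (auto simp: abs_if split: if_splits intro!: bexI[of _ "(l, k)"])
    qed
    moreover have "{x \<in> M0 J0 w. M_nrm J0 w x = t} \<in> sets N"
      unfolding N(2) space_M0_borel[symmetric] by measurable
    ultimately show ?thesis using null_sets_subset by blast
  qed
  then show ?thesis by (simp add: null_sets_def measure_def)
qed

section \<open>Null spheres of the two limit laws\<close>

lemma prob_space_std_normal: "prob_space std_normal"
  unfolding std_normal_def by (rule prob_space_normal_density) simp

lemma sets_std_normal [measurable_cong]: "sets std_normal = sets borel"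
  by (simp add: std_normal_def)

lemma std_normal_singleton: "emeasure std_normal {c} = 0"
  unfolding std_normal_def by (subst emeasure_density) (auto simp: nn_integral_indicator_singleton)

text \<open>Mapped to the product space, \<open>N\<close> becomes a product of standard normals, so
  no coordinate has an atom, not even at 0.\<close>

lemma (in weight) white_noise_limit_sphere_null:
  assumes "white_noise_limit J0 w N" "0 \<le> t"
  shows "measure N {x \<in> M0 J0 w. M_nrm J0 w x = t} = 0"
proof (rule sphere_null)
  have N: "prob_space N" "sets N = sets (M0_borel J0 w)"
    and law: "distr N (seq_algebra J0) (\<lambda>x. x) = white_noise J0"
    using assms by (auto simp: white_noise_limit_def space_prob_algebra)
  then show "prob_space N" "sets N = sets (M0_borel J0 w)" by auto
  have "measure N {x \<in> M0 J0 w. x i = c} = 0" if i: "i \<in> wav_index J0" for i c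
  proof -
    have sp: "space N = M0 J0 w" using sets_eq_imp_space_eq[OF N(2)] by (simp add: space_M0_borel)
    have id: "(\<lambda>x. x) \<in> N \<rightarrow>\<^sub>M seq_algebra J0"
      using M0_borel_subset_seq_algebra measurable_cong_sets[OF N(2) refl] by blast
    have coord: "(\<lambda>x. x i) \<in> seq_algebra J0 \<rightarrow>\<^sub>M std_normal"
      unfolding seq_algebra_def measurable_cong_sets[OF refl sets_std_normal]
      using i by (rule measurable_component_singleton)
    have "distr N std_normal (\<lambda>x. x i) = distr (distr N (seq_algebra J0) (\<lambda>x. x)) std_normal (\<lambda>x. x i)"
      using distr_distr[OF coord id] by (simp add: o_def)
    also have "\<dots> = std_normal"
      unfolding law white_noise_def by (rule distr_PiM_component[OF prob_space_std_normal i])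
    finally have "emeasure (distr N std_normal (\<lambda>x. x i)) {c} = 0"
      by (simp add: std_normal_singleton)
    moreover have "(\<lambda>x. x i) \<in> N \<rightarrow>\<^sub>M std_normal"
      using measurable_compose[OF id coord] by simp
    moreover have "(\<lambda>x. x i) -` {c} \<inter> space N = {x \<in> M0 J0 w. x i = c}" using sp by auto
    ultimately show ?thesis
      by (simp add: emeasure_distr sets_std_normal measure_def)
  qed
  then show "\<And>i c. i \<in> wav_index J0 \<Longrightarrow> c \<noteq> 0 \<Longrightarrow> measure N {x \<in> M0 J0 w. x i = c} = 0"
    "measure N {x \<in> M0 J0 w. x (int J0 - 1, 0) = 0} = 0"
    using wav_index_nonempty by auto
qed (use wav_index_nonempty assms in auto)

lemma bounded_density_law:
  assumes f: "bounded_density f"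
  shows "prob_space (density_law f)" "sets (density_law f) = sets unit_interval"
proof -
  interpret U: prob_space unit_interval by (rule prob_space_unit_interval)
  obtain C where C: "\<forall>x\<in>{0..1}. 0 \<le> f x \<and> f x \<le> C" and [measurable]: "f \<in> borel_measurable unit_interval"
    and int: "(\<integral>x. f x \<partial>unit_interval) = 1"
    using f by (auto simp: bounded_density_def)
  have "integrable unit_interval f"
    using C by (intro U.integrable_const_bound[of _ C] AE_I2) auto
  then have "(\<integral>\<^sup>+x. ennreal (f x) \<partial>unit_interval) = 1"
    using C int by (subst nn_integral_eq_integral) (auto intro!: AE_I2)
  moreover have "emeasure (density_law f) (space (density_law f)) = (\<integral>\<^sup>+x. ennreal (f x) \<partial>unit_interval)"
    unfolding density_law_def
    by (simp add: emeasure_density del: space_unit_interval)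
  ultimately show "prob_space (density_law f)" by (intro prob_spaceI) simp
qed (simp add: density_law_def)

text \<open>If every basis function were almost surely constant under the density \<open>f\<close>, then
  \<open>(x - a) f x\<close>, with \<open>a\<close> the mean of \<open>f\<close>, would be orthogonal to the whole basis.\<close>

lemma bridge_cov_nondegenerate:
  assumes basis: "wavelet_basis S J0 \<psi>" and f: "bounded_density f"
  obtains i where "i \<in> wav_index J0" "bridge_cov \<psi> (density_law f) i i \<noteq> 0"
proof (rule ccontr)
  let ?U = unit_interval
  interpret U: prob_space ?U by (rule prob_space_unit_interval)
  assume "\<not> thesis"
  then have degenerate: "bridge_cov \<psi> (density_law f) i i = 0" if "i \<in> wav_index J0" for i
    using that \<open>\<And>i. i \<in> wav_index J0 \<Longrightarrow> bridge_cov \<psi> (density_law f) i i \<noteq> 0 \<Longrightarrow> thesis\<close> by blast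
  obtain C where C: "\<forall>x\<in>{0..1}. 0 \<le> f x \<and> f x \<le> C" and f_meas [measurable]: "f \<in> borel_measurable ?U"
    and int_f: "(\<integral>x. f x \<partial>?U) = 1"
    using f by (auto simp: bounded_density_def)
  have [measurable]: "(\<lambda>x. x) \<in> borel_measurable ?U"
    by (simp add: unit_interval_def measurable_restrict_space1)
  have "0 \<le> C" using C[rule_format, of 0] by auto
  have f_L2: "f \<in> L2 ?U" using C by (intro U.bounded_in_L2[where B = C]) auto
  have id_L2: "(\<lambda>x. x) \<in> L2 ?U" by (rule U.bounded_in_L2[where B = 1]) auto
  have one_L2: "(\<lambda>_. 1) \<in> L2 ?U" by (rule U.bounded_in_L2[where B = 1]) auto
  define a where "a = (\<integral>x. x * f x \<partial>?U)"
  define g where "g x = (x - a) * f x" for x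
  have int_g: "(\<integral>x. g x \<partial>?U) = 0"
    using L2_mult_integrable[OF id_L2 f_L2] L2_mult_integrable[OF one_L2 f_L2] int_f
    by (simp add: g_def left_diff_distrib a_def)
  have g_L2: "g \<in> L2 ?U"
  proof (rule U.bounded_in_L2[where B = "(1 + \<bar>a\<bar>) * C"])
    fix x assume "x \<in> space ?U"
    then show "\<bar>g x\<bar> \<le> (1 + \<bar>a\<bar>) * C"
      using C unfolding g_def abs_mult by (intro mult_mono) auto
  qed (simp add: g_def[abs_def])
  have e_L2: "\<psi> l k \<in> L2 ?U" if "(l, k) \<in> wav_index J0" for l k
    using basis that unfolding wavelet_basis_def orthonormal_basis_def orthonormal_on_def by fastforce
  have "(\<integral>x. g x * \<psi> l k x \<partial>?U) = 0" if i: "(l, k) \<in> wav_index J0" for l k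
  proof -
    define c where "c = (\<integral>y. \<psi> l k y \<partial>density_law f)"
    have [measurable]: "\<psi> l k \<in> borel_measurable ?U" using e_L2[OF i] by (simp add: L2_def)
    have c_L2: "(\<lambda>_. c) \<in> L2 ?U" by (rule U.bounded_in_L2[where B = "\<bar>c\<bar>"]) auto
    have int: "integrable ?U (\<lambda>x. f x * (\<psi> l k x - c)\<^sup>2)"
    proof (rule Bochner_Integration.integrable_bound)
      show "integrable ?U (\<lambda>x. C * (\<psi> l k x - c)\<^sup>2)"
        using L2_diff[OF e_L2[OF i] c_L2] by (simp add: L2_def)
      show "AE x in ?U. norm (f x * (\<psi> l k x - c)\<^sup>2) \<le> norm (C * (\<psi> l k x - c)\<^sup>2)"
        using C \<open>0 \<le> C\<close> by (intro AE_I2) (auto simp: abs_mult mult_right_mono)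
    qed measurable
    have "bridge_cov \<psi> (density_law f) (l, k) (l, k) = (\<integral>x. (\<psi> l k x - c)\<^sup>2 \<partial>density_law f)"
      by (simp add: bridge_cov_def c_def power2_eq_square)
    also have "\<dots> = (\<integral>x. f x * (\<psi> l k x - c)\<^sup>2 \<partial>?U)"
      unfolding density_law_def using C by (intro integral_real_density) auto
    finally have "(\<integral>x. f x * (\<psi> l k x - c)\<^sup>2 \<partial>?U) = bridge_cov \<psi> (density_law f) (l, k) (l, k)" ..
    also have "\<dots> = 0" by (rule degenerate[OF i])
    finally have "AE x in ?U. f x * (\<psi> l k x - c)\<^sup>2 = 0"
      using C by (subst (asm) integral_nonneg_eq_0_iff_AE[OF int]) (auto intro!: AE_I2)
    \<comment> \<open>Where \<open>f\<close> is nonzero the basis function equals \<open>c\<close>;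
      where \<open>f\<close> vanishes, so does \<open>g\<close>.\<close>
    then have "AE x in ?U. g x * \<psi> l k x = c * g x"
      by eventually_elim (auto simp: g_def)
    then have "(\<integral>x. g x * \<psi> l k x \<partial>?U) = (\<integral>x. c * g x \<partial>?U)"
      using g_L2 by (intro integral_cong_AE) (auto simp: L2_def)
    then show ?thesis using int_g by simp
  qed
  moreover have "\<forall>f\<in>L2 ?U. (\<forall>i\<in>wav_index J0. (\<integral>x. f x * (case i of (l, k) \<Rightarrow> \<psi> l k) x \<partial>?U) = 0)
      \<longrightarrow> (AE x in ?U. f x = 0)"
    using basis unfolding wavelet_basis_def orthonormal_basis_def by blast
  ultimately have "AE x in ?U. g x = 0"
    using g_L2 by (auto dest!: bspec[of _ _ g])
  \<comment> \<open>The factor \<open>x - a\<close> vanishes at one point only, so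
    \<open>g = 0\<close> forces \<open>f = 0\<close> almost everywhere, against total mass
    1.\<close>
  moreover have "AE x in ?U. x \<noteq> a"
    unfolding unit_interval_def by (subst AE_restrict_space_iff) (use AE_lborel_singleton[of a] in auto)
  ultimately have "AE x in ?U. f x = 0"
    by eventually_elim (simp add: g_def)
  then have "(\<integral>x. f x \<partial>?U) = (\<integral>x. 0 \<partial>?U)"
    by (intro integral_cong_AE) auto
  then show False using int_f by simp
qed

lemma (in weight) sampling_limit_sphere_null:
  assumes basis: "wavelet_basis S J0 \<psi>" and f: "bounded_density f"
    and lim: "sampling_limit J0 \<psi> w f N" and "0 \<le> t"
  shows "measure N {x \<in> M0 J0 w. M_nrm J0 w x = t} = 0"
proof -
  have N: "prob_space N" "sets N = sets (M0_borel J0 w)"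
    using lim by (auto simp: sampling_limit_def space_prob_algebra)
  let ?s = "\<lambda>i. sqrt (bridge_cov \<psi> (density_law f) i i)"
  have level: "measure N {x \<in> M0 J0 w. x i = c} = 0" if i: "i \<in> wav_index J0" and c: "?s i \<noteq> 0 \<or> c \<noteq> 0" for i c
  proof -
    have sp: "space N = M0 J0 w" using sets_eq_imp_space_eq[OF N(2)] by (simp add: space_M0_borel)
    have coord: "(\<lambda>x. x i) \<in> borel_measurable N"
      using coordinate_measurable[OF i] measurable_cong_sets[OF N(2) refl] by blast
    have law: "distr N borel (\<lambda>x. x i) = distr std_normal borel (\<lambda>z. ?s i * z)"
      using lim[unfolded sampling_limit_def, THEN conjunct2, rule_format, of "{i}" "\<lambda>_. 1"] i by simp
    have "emeasure N {x \<in> M0 J0 w. x i = c} = emeasure (distr N borel (\<lambda>x. x i)) {c}"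
      using coord sp by (subst emeasure_distr) (auto intro!: arg_cong[where f = "emeasure N"])
    also have "\<dots> = emeasure std_normal ((\<lambda>z. ?s i * z) -` {c} \<inter> space std_normal)"
      unfolding law by (subst emeasure_distr) auto
    \<comment> \<open>For a nonzero standard deviation the two sets agree. If it is zero then
      \<open>c \<noteq> 0\<close>, the preimage is empty, and the value of the division by zero is
      immaterial.\<close>
    also have "\<dots> \<le> emeasure std_normal {c / ?s i}"
      using c by (intro emeasure_mono) (auto simp: sets_std_normal field_simps)
    also have "\<dots> = 0" by (rule std_normal_singleton)
    finally show ?thesis by (simp add: measure_def)
  qed
  obtain i0 where "i0 \<in> wav_index J0" "bridge_cov \<psi> (density_law f) i0 i0 \<noteq> 0"
    using bridge_cov_nondegenerate[OF basis f] .
  then show ?thesis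
    using N level \<open>0 \<le> t\<close> by (intro sphere_null[of N i0]) auto
qed

section \<open>The laws of the data in the two models\<close>

lemma white_noise_law:
  "prob_space (white_noise_law J0 n f)" "sets (white_noise_law J0 n f) = sets (seq_algebra J0)"
proof -
  interpret prob_space "white_noise J0"
    unfolding white_noise_def by (intro prob_space_PiM prob_space_std_normal)
  have "(\<lambda>g. \<lambda>i\<in>wav_index J0. f i + g i / sqrt (real n)) \<in> white_noise J0 \<rightarrow>\<^sub>M seq_algebra J0"
    unfolding white_noise_def seq_algebra_def
  proof (rule measurable_restrict)
    fix i assume "i \<in> wav_index J0"
    then have "(\<lambda>g. g i) \<in> PiM (wav_index J0) (\<lambda>_. std_normal) \<rightarrow>\<^sub>M borel"
      unfolding measurable_cong_sets[OF refl sets_std_normal[symmetric]]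
      by (rule measurable_component_singleton)
    then show "(\<lambda>g. f i + g i / sqrt (real n)) \<in> PiM (wav_index J0) (\<lambda>_. std_normal) \<rightarrow>\<^sub>M borel"
      by simp
  qed
  then show "prob_space (white_noise_law J0 n f)"
    unfolding white_noise_law_def by (rule prob_space_distr)
qed (simp add: white_noise_law_def)

text \<open>Estimators and posteriors at stage \<open>n\<close> are measurable for the first
  \<open>n\<close> observations; the measurable identity carries them to the law of the whole
  sequence.\<close>

lemma sampling_law:
  assumes "bounded_density f"
  shows "prob_space (sampling_law f)" "space (sampling_law f) = space (sample_algebra n)"
    and "(\<lambda>x. x) \<in> sampling_law f \<rightarrow>\<^sub>M sample_algebra n"
proof -
  note law = bounded_density_law[OF assms]
  have sets: "sets (sampling_law f) = sets (PiM UNIV (\<lambda>_::nat. unit_interval))"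
    unfolding sampling_law_def by (intro sets_PiM_cong refl law)
  show "prob_space (sampling_law f)"
    unfolding sampling_law_def by (intro prob_space_PiM law)
  show space: "space (sampling_law f) = space (sample_algebra n)"
    using sets_eq_imp_space_eq[OF sets] by (simp add: sample_algebra_def)
  show "(\<lambda>x. x) \<in> sampling_law f \<rightarrow>\<^sub>M sample_algebra n"
    unfolding sample_algebra_def
  proof (rule measurable_vimage_algebra2)
    show "(\<lambda>x. x) \<in> space (sampling_law f) \<rightarrow> space (PiM UNIV (\<lambda>_. unit_interval))"
      using sets_eq_imp_space_eq[OF sets] by auto
    show "(\<lambda>x. restrict x {..<n}) \<in> sampling_law f \<rightarrow>\<^sub>M PiM {..<n} (\<lambda>_. unit_interval)"
      unfolding measurable_cong_sets[OF sets refl] by (rule measurable_restrict_subset) simp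
  qed
qed

theorem proposition5:
  fixes S J0 :: nat
    and \<psi> :: "int \<Rightarrow> nat \<Rightarrow> real \<Rightarrow> real"
    and w :: "int \<Rightarrow> real"
    and \<alpha> \<gamma> :: real
    and f0 :: "real \<Rightarrow> real"
    and j :: "nat \<Rightarrow> int"
    and u :: "nat \<Rightarrow> real"
    and prior N :: "wseq measure"
  assumes basis: "wavelet_basis S J0 \<psi>"
    and admissible: "admissible J0 w"
    and alpha: "0 < \<alpha>" "\<alpha> < 1"
    and gamma: "0 < \<gamma>"
    and f0: "f0 \<in> C_space J0 \<psi> \<gamma>"
    and j: "(\<lambda>n. 2 powr real_of_int (j n)) \<in> \<Theta>(\<lambda>n. (real n / ln (real n)) powr (1 / (2 * \<gamma> + 1)))"
    and u: "\<And>n. u n = w (j n) / sqrt (real_of_int (j n))"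
    and prior: "prior \<in> space (prob_algebra (ell2_borel J0))"
  shows
    \<comment> \<open>white noise model\<close>
    "(\<forall>(T :: nat \<Rightarrow> wseq \<Rightarrow> wseq) (K :: nat \<Rightarrow> wseq \<Rightarrow> wseq measure) (R :: nat \<Rightarrow> wseq \<Rightarrow> real) P.
        (\<forall>n. P n = white_noise_law J0 n (wav_coeffs J0 \<psi> f0)) \<and>
        white_noise_limit J0 w N \<and>
        (\<forall>n\<ge>1. T n \<in> seq_algebra J0 \<rightarrow>\<^sub>M M0_borel J0 w) \<and>
        (\<forall>n\<ge>1. is_posterior J0 (seq_algebra J0) (white_noise_law J0 n) prior (K n)) \<and>
        weak_BvM J0 w P K T N \<and>
        efficient_centring J0 w P T (wav_coeffs J0 \<psi> f0) N \<and>
        (\<forall>n\<ge>1. R n \<in> borel_measurable (seq_algebra J0)) \<and>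
        (\<forall>n\<ge>1. AE x in P n. measure (K n x) (credible_set J0 w n (T n x) (R n x)) = 1 - \<alpha>)
        \<longrightarrow>
        (\<lambda>n. measure (P n)
           {x \<in> space (P n). wav_coeffs J0 \<psi> f0 \<in> credible_band J0 w \<gamma> n (T n x) (R n x) (u n)})
          \<longlonglongrightarrow> 1 - \<alpha> \<and>
        bigO_in_prob P
          (\<lambda>n x. sup_diameter J0 \<psi> (credible_band J0 w \<gamma> n (T n x) (R n x) (u n)))
          (\<lambda>n. (real n / ln (real n)) powr (- \<gamma> / (2 * \<gamma> + 1)) * u n))
     \<and>
     \<comment> \<open>sampling model\<close>
     (\<forall>(T :: nat \<Rightarrow> (nat \<Rightarrow> real) \<Rightarrow> wseq) (K :: nat \<Rightarrow> (nat \<Rightarrow> real) \<Rightarrow> wseq measure)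
        (R :: nat \<Rightarrow> (nat \<Rightarrow> real) \<Rightarrow> real) P.
        bounded_density f0 \<and>
        (AE s in prior. \<exists>f. bounded_density f \<and> s = wav_coeffs J0 \<psi> f) \<and>
        (\<forall>n. P n = sampling_law f0) \<and>
        sampling_limit J0 \<psi> w f0 N \<and>
        (\<forall>n\<ge>1. T n \<in> sample_algebra n \<rightarrow>\<^sub>M M0_borel J0 w) \<and>
        (\<forall>n\<ge>1. is_posterior J0 (sample_algebra n) (\<lambda>s. sampling_law (synth J0 \<psi> s)) prior (K n)) \<and>
        weak_BvM J0 w P K T N \<and>
        efficient_centring J0 w P T (wav_coeffs J0 \<psi> f0) N \<and>
        (\<forall>n\<ge>1. R n \<in> borel_measurable (sample_algebra n)) \<and>
        (\<forall>n\<ge>1. AE x in P n. measure (K n x) (credible_set J0 w n (T n x) (R n x)) = 1 - \<alpha>)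
        \<longrightarrow>
        (\<lambda>n. measure (P n)
           {x \<in> space (P n). wav_coeffs J0 \<psi> f0 \<in> credible_band J0 w \<gamma> n (T n x) (R n x) (u n)})
          \<longlonglongrightarrow> 1 - \<alpha> \<and>
        bigO_in_prob P
          (\<lambda>n x. sup_diameter J0 \<psi> (credible_band J0 w \<gamma> n (T n x) (R n x) (u n)))
          (\<lambda>n. (real n / ln (real n)) powr (- \<gamma> / (2 * \<gamma> + 1)) * u n))"
proof -
  let ?\<theta> = "wav_coeffs J0 \<psi> f0"
  interpret weight J0 w
    using admissible by unfold_locales (simp add: admissible_def)
  have \<theta>: "?\<theta> \<in> ell2 J0" "C_norm J0 \<gamma> ?\<theta> < \<infinity>"
    using f0 wav_coeffs_in_ell2[OF basis continuous_on_in_L2_unit_interval]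
    by (auto simp: C_space_def)
  \<comment> \<open>Instantiating \<open>conjI\<close> at two universal statements separates the
    models but leaves the conjunction of coverage and diameter in each of them intact.\<close>
  show ?thesis
  proof (intro conjI[of "All _" "All _"] allI impI, goal_cases)
    case (1 T K R P)
    then have P: "\<And>n. P n = white_noise_law J0 n ?\<theta>" and N: "white_noise_limit J0 w N"
      and T: "\<And>n. n \<ge> 1 \<Longrightarrow> T n \<in> seq_algebra J0 \<rightarrow>\<^sub>M M0_borel J0 w"
      and K: "\<And>n. n \<ge> 1 \<Longrightarrow> is_posterior J0 (seq_algebra J0) (white_noise_law J0 n) prior (K n)"
      and R: "\<And>n. n \<ge> 1 \<Longrightarrow> R n \<in> borel_measurable (seq_algebra J0)"
      by blast+
    have sets: "sets (P n) = sets (seq_algebra J0)" for n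
      unfolding P by (rule white_noise_law)
    interpret credible_setting J0 w P K T R N ?\<theta> \<alpha>
    proof (intro credible_setting.intro credible_setting_axioms.intro weight_axioms)
      show "prob_space (P n)" for n unfolding P by (rule white_noise_law)
      fix n :: nat assume n: "n \<ge> 1"
      show "T n \<in> P n \<rightarrow>\<^sub>M M0_borel J0 w" "R n \<in> borel_measurable (P n)"
        unfolding measurable_cong_sets[OF sets refl] using T R n by auto
      show "K n x \<in> space (prob_algebra (ell2_borel J0))" if "x \<in> space (P n)" for x
        using K[OF n] that sets_eq_imp_space_eq[OF sets]
        by (auto simp: is_posterior_def dest: measurable_space)
    next
      show "N \<in> space (prob_algebra (M0_borel J0 w))"
        using N by (simp add: white_noise_limit_def)
    qed (use 1 \<theta> alpha white_noise_limit_sphere_null[OF N] in auto)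
    show ?case
      using band_conclusion[OF basis admissible gamma \<theta>(2) j u] by blast
  next
    case (2 T K R P)
    then have f: "bounded_density f0" and P: "\<And>n. P n = sampling_law f0" and N: "sampling_limit J0 \<psi> w f0 N"
      and T: "\<And>n. n \<ge> 1 \<Longrightarrow> T n \<in> sample_algebra n \<rightarrow>\<^sub>M M0_borel J0 w"
      and K: "\<And>n. n \<ge> 1 \<Longrightarrow>
        is_posterior J0 (sample_algebra n) (\<lambda>s. sampling_law (synth J0 \<psi> s)) prior (K n)"
      and R: "\<And>n. n \<ge> 1 \<Longrightarrow> R n \<in> borel_measurable (sample_algebra n)"
      by blast+
    note law = sampling_law[OF f]
    interpret credible_setting J0 w P K T R N ?\<theta> \<alpha>
    proof (intro credible_setting.intro credible_setting_axioms.intro weight_axioms)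
      show "prob_space (P n)" for n unfolding P by (rule law)
      fix n :: nat assume n: "n \<ge> 1"
      show "T n \<in> P n \<rightarrow>\<^sub>M M0_borel J0 w" "R n \<in> borel_measurable (P n)"
        unfolding P using measurable_compose[OF law(3) T[OF n]] measurable_compose[OF law(3) R[OF n]] by auto
      show "K n x \<in> space (prob_algebra (ell2_borel J0))" if "x \<in> space (P n)" for x
        using K[OF n] that law(2)[of n] unfolding P
        by (auto simp: is_posterior_def dest: measurable_space)
    next
      show "N \<in> space (prob_algebra (M0_borel J0 w))"
        using N by (simp add: sampling_limit_def)
    qed (use 2 \<theta> alpha sampling_limit_sphere_null[OF basis f N] in auto)
    show ?case
      using band_conclusion[OF basis admissible gamma \<theta>(2) j u] by blast
  qed
qed

end
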